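(* Let $r>0$, $p\in(0,1)$ and let the prior be $\mu=p\,\delta_r+(1-p)\,\delta_{-r}$. Let $v$ be the value function and $\mathcal{C}$ the continuation region of the problem of optimally stopping a Brownian bridge with unknown pinning point with prior $\mu$, and let $v_r$ be the value function for the known pinning point $r$. Then, for all $(t,z)\in[0,1)\times\mathbb{R}$, $$v(t,z)\ge\pi(t,z)\,v_r(t,z)-(1-\pi(t,z))\,r,\qquad\text{where }\ \pi(t,z):=\frac{\frac{p}{1-p}e^{\frac{2rz}{1-t}}}{\frac{p}{1-p}e^{\frac{2rz}{1-t}}+1}.$$ Consequently, $Q_r:=\{(t,z)\in[0,1)\times\mathbb{R}:z<\pi(t,z)v_r(t,z)-(1-\pi(t,z))r\}\subseteq\mathcal{C}$.
   Context: For $(t,z)\in[0,1)\times\mathbb{R}$ the posterior distribution is $\mu_{t,z}=\pi(t,z)\delta_r+(1-\pi(t,z))\delta_{-r}$, with mean $h(t,z)=r(2\pi(t,z)-1)$. The process $Z^{t,z}$ is the solution of $$dZ_{t+s}=\frac{h(t+s,Z_{t+s})-Z_{t+s}}{1-(t+s)}\,ds+d\hat W_{t+s},\quad0\le s<1-t,\qquad Z_t=z,$$ with $\hat W$ a standard Brownian motion, extended to time $1$ by its a.s. limit; equivalently, in law, it is a Brownian bridge started at time $t$ from $z$ whose (unknown) pinning point at time $1$ has distribution $\mu_{t,z}$. The value function is $$v(t,z)=\sup_{\tau\in\mathcal{T}^Z_{1-t}}\mathbb{E}[Z^{t,z}_{t+\tau}],\qquad(t,z)\in[0,1)\times\mathbb{R},$$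 where $\mathcal{T}^Z_{1-t}$ is the set of $[0,1-t]$-valued stopping times with respect to the filtration generated by $s\mapsto Z^{t,z}_{t+s}$. The continuation region is $\mathcal{C}:=\{(t,z)\in[0,1)\times\mathbb{R}:v(t,z)>z\}$. $v_r(t,z)$ denotes the same value function when the prior is $\delta_r$ (drift $(r-Z)/(1-\cdot)$). It is known (Shepp) that, for $t\in[0,1)$, $$v_r(t,z)=\begin{cases}r+\sqrt{2\pi(1-t)}\,(1-\beta^2)\exp\left(\frac{(z-r)^2}{2(1-t)}\right)\Phi\left(\frac{z-r}{\sqrt{1-t}}\right)&\text{if }z<r+\beta\sqrt{1-t},\\ z&\text{if }z\ge r+\beta\sqrt{1-t},\end{cases}$$ where (in this formula) $\pi$ under the square root is the usual constant, $\Phi$ is the standard normal distribution function, and $\beta$ is the unique positive solution of $\sqrt{2\pi}(1-\beta^2)e^{\beta^2/2}\Phi(\beta)=\beta$. *)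

theory Defs
  imports "HOL-Probability.Probability"
begin

text \<open>A Brownian motion on the time interval \<^term>\<open>{0..<T}\<close> relative to the filtration \<^term>\<open>F\<close>;
  the filtration may be strictly larger than the one generated by \<^term>\<open>W\<close>.\<close>

definition brownian_motion ::
  "'a measure \<Rightarrow> (real \<Rightarrow> 'a measure) \<Rightarrow> real \<Rightarrow> (real \<Rightarrow> 'a \<Rightarrow> real) \<Rightarrow> bool" where
  "brownian_motion M F T W \<longleftrightarrow>
     prob_space M \<and> filtration (space M) F \<and> (\<forall>s. sets (F s) \<subseteq> sets M) \<and>
     (\<forall>s\<in>{0..<T}. W s \<in> borel_measurable (F s)) \<and>
     (AE \<omega> in M. W 0 \<omega> = 0) \<and>
     (AE \<omega> in M. continuous_on {0..<T} (\<lambda>s. W s \<omega>)) \<and>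
     (\<forall>s u. 0 \<le> s \<and> s < u \<and> u < T \<longrightarrow>
        prob_space.indep_set M (sets (F s))
          {(\<lambda>\<omega>. W u \<omega> - W s \<omega>) -` A \<inter> space M |A. A \<in> sets borel} \<and>
        distributed M lborel (\<lambda>\<omega>. W u \<omega> - W s \<omega>)
          (\<lambda>x. ennreal (normal_density 0 (sqrt (u - s)) x)))"

text \<open>The family \<^term>\<open>\<mu>\<close> gives the posterior distribution \<^term>\<open>\<mu> t z\<close> of the pinning point when
  the bridge is at \<^term>\<open>z\<close> at time \<^term>\<open>t\<close>.  The argument of \<^term>\<open>Z\<close> is the time elapsed
  since \<^term>\<open>t\<close>, so that \<^term>\<open>Z (1 - t)\<close> is the value at time 1; that value only has to be an
  almost sure limit.  Since the noise is additive, the stochastic differential equation is a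
  pathwise integral equation.  The paths of \<^term>\<open>Z\<close> on \<^term>\<open>{0..<1 - t}\<close> are continuous without
  exceptional set, because \<^term>\<open>M\<close> need not be complete and the stopped process has to be
  measurable.\<close>

definition pinned_bridge ::
  "(real \<Rightarrow> real \<Rightarrow> real pmf) \<Rightarrow> real \<Rightarrow> real \<Rightarrow> 'a measure \<Rightarrow> (real \<Rightarrow> 'a \<Rightarrow> real) \<Rightarrow> bool" where
  "pinned_bridge \<mu> t z M Z \<longleftrightarrow>
     (\<exists>F W. brownian_motion M F (1 - t) W \<and>
        (\<forall>s\<in>{0..<1 - t}. Z s \<in> borel_measurable (F s)) \<and>
        (\<forall>\<omega>\<in>space M. continuous_on {0..<1 - t} (\<lambda>s. Z s \<omega>)) \<and>
        (AE \<omega> in M. \<forall>s\<in>{0..<1 - t}.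
           Z s \<omega> = z
             + integral {0..s} (\<lambda>u. (measure_pmf.expectation (\<mu> (t + u) (Z u \<omega>)) (\<lambda>x. x) - Z u \<omega>)
                                   / (1 - (t + u)))
             + W s \<omega>) \<and>
        Z (1 - t) \<in> borel_measurable M \<and>
        (AE \<omega> in M. ((\<lambda>s. Z s \<omega>) \<longlongrightarrow> Z (1 - t) \<omega>) (at_left (1 - t))))"

definition generated_filtration ::
  "'a measure \<Rightarrow> real \<Rightarrow> (real \<Rightarrow> 'a \<Rightarrow> real) \<Rightarrow> real \<Rightarrow> 'a measure" where
  "generated_filtration M T Z s =
     sigma (space M) {Z u -` A \<inter> space M |u A. 0 \<le> u \<and> u \<le> T \<and> u \<le> s \<and> A \<in> sets borel}"

definition admissible_times ::
  "'a measure \<Rightarrow> real \<Rightarrow> (real \<Rightarrow> 'a \<Rightarrow> real) \<Rightarrow> ('a \<Rightarrow> real) set" where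
  "admissible_times M T Z =
     {\<tau>. stopping_time (generated_filtration M T Z) \<tau> \<and> (\<forall>\<omega>\<in>space M. 0 \<le> \<tau> \<omega> \<and> \<tau> \<omega> \<le> T)}"

text \<open>For every starting point \<^term>\<open>(t, z)\<close> there is a process \<^term>\<open>Z t z\<close>, possibly living on
  a probability space \<^term>\<open>M t z\<close> of its own.\<close>

definition bridge_value ::
  "(real \<Rightarrow> real \<Rightarrow> 'a measure) \<Rightarrow> (real \<Rightarrow> real \<Rightarrow> real \<Rightarrow> 'a \<Rightarrow> real) \<Rightarrow> real \<Rightarrow> real \<Rightarrow> real" where
  "bridge_value M Z t z =
     (SUP \<tau> \<in> admissible_times (M t z) (1 - t) (Z t z). (\<integral>\<omega>. Z t z (\<tau> \<omega>) \<omega> \<partial>M t z))"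

definition continuation_region :: "(real \<Rightarrow> real \<Rightarrow> real) \<Rightarrow> (real \<times> real) set" where
  "continuation_region v = {(t, z). 0 \<le> t \<and> t < 1 \<and> v t z > z}"

definition two_point :: "real \<Rightarrow> real \<Rightarrow> real pmf" where
  "two_point r q = map_pmf (\<lambda>b. if b then r else - r) (bernoulli_pmf q)"

definition post_prob :: "real \<Rightarrow> real \<Rightarrow> real \<Rightarrow> real \<Rightarrow> real" where
  "post_prob r p t z =
     (p / (1 - p) * exp (2 * r * z / (1 - t))) / (p / (1 - p) * exp (2 * r * z / (1 - t)) + 1)"

definition posterior :: "real \<Rightarrow> real \<Rightarrow> real \<Rightarrow> real \<Rightarrow> real pmf" where
  "posterior r p t z = two_point r (post_prob r p t z)"

lemma post_prob_bounds:
  assumes "0 < p" "p < 1"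
  shows "0 < post_prob r p t z" "post_prob r p t z < 1"
proof -
  define x where "x = p / (1 - p) * exp (2 * r * z / (1 - t))"
  have x: "0 < x"
    unfolding x_def using assms by simp
  have "post_prob r p t z = x / (x + 1)"
    by (simp add: post_prob_def x_def)
  with x show "0 < post_prob r p t z" "post_prob r p t z < 1"
    by simp_all
qed

lemma posterior_mean:
  assumes "0 < p" "p < 1"
  shows "measure_pmf.expectation (posterior r p t z) (\<lambda>x. x) = r * (2 * post_prob r p t z - 1)"
  using post_prob_bounds[OF assms, of r t z]
  by (simp add: posterior_def two_point_def algebra_simps)

lemma posterior_start:
  assumes "0 < p" "p < 1"
  shows "posterior r p 0 0 = two_point r p"
proof -
  have "post_prob r p 0 0 = p"
    using assms by (simp add: post_prob_def field_simps)
  then show ?thesis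
    by (simp add: posterior_def)
qed

end

theory Submission
  imports Defs "HOL-Real_Asymp.Real_Asymp"
begin

text \<open>Let \<open>\<pi>\<^sub>s\<close> be the posterior probability of the pinning point \<open>r\<close> along the bridge.  It is a
  martingale, and under the measure with density \<open>\<pi>\<^sub>s / \<pi>\<^sub>0\<close> the bridge has the law of the bridge
  pinned at \<open>r\<close>; exchanging the two pinning points, the density \<open>(1 - \<pi>\<^sub>s) / (1 - \<pi>\<^sub>0)\<close> gives the bridge
  pinned at \<open>- r\<close>.  Without stochastic calculus, this is read off the characteristic functions of
  the increments of \<open>Z\<^sub>s / (T - s)\<close>, which solve a linear differential equation in \<open>s\<close> by a second order
  Taylor expansion and Doob's maximal inequality.

  A stopping rule for the bridge pinned at \<open>r\<close>, discretised to a finite grid, is an event in path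
  space at each grid point and can be used for the bridge with unknown pinning point.  It is first
  improved by not stopping below \<open>r\<close>.  On the part of the mixture that ends at \<open>r\<close> it then earns at
  least as much as before, and on the other part at least \<open>- r\<close>.\<close>

subsection \<open>Doob's maximal inequality for Brownian motion\<close>

text \<open>The two bridges live on unrelated probability spaces, each with a filtration that may
  exceed the one generated by the process, so a stopping time cannot be carried over pointwise. What
  can be carried over is a measurable set of paths; this forces the passage through product
  sigma-algebras and finite-dimensional laws.

  The densities are used only before the pinning time \<open>T\<close>, since the weight degenerates
  to an indicator as time tends to \<open>T\<close>. Every comparison of laws is made at some
  \<open>u < T\<close>, and the value at \<open>T\<close> enters by dominated convergence: the
  expectation of the weight times the distance to the pin tends to 0, for each of the two pins, and
  this replaces a conditioning on the end point.

  Over a step of length d the Taylor expansion may leave an error of order d^(3/2) only. The drift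
  moves inside the step, and the pathwise estimate of its variation asks for one random bound on the
  oscillation of \<open>W\<close> valid for all times of the step. The maximal inequality supplies
  such a bound with mean of order sqrt d.\<close>

fun runmax :: "(nat \<Rightarrow> real) \<Rightarrow> nat \<Rightarrow> real" where
  "runmax S 0 = S 0"
| "runmax S (Suc n) = max (runmax S n) (S (Suc n))"

lemma runmax_ge: "k \<le> n \<Longrightarrow> S k \<le> runmax S n"
  by (induction n) (auto simp: le_Suc_eq max.coboundedI1)

lemma abs_runmax_le: "\<bar>runmax S n\<bar> \<le> (\<Sum>k\<le>n. \<bar>S k\<bar>)"
  by (induction n) (auto simp: max_def)

lemma measurable_runmax:
  "(\<And>k. k \<le> n \<Longrightarrow> S k \<in> borel_measurable N) \<Longrightarrow> (\<lambda>x. runmax (\<lambda>k. S k x) n) \<in> borel_measurable N"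
  by (induction n) auto

text \<open>A pathwise form of Doob's \<open>L\<^sup>2\<close> maximal inequality: the sum is a martingale transform,
  so it disappears after taking expectations.\<close>

lemma runmax_square_le:
  "(runmax S n)\<^sup>2 \<le> 4 * (S n)\<^sup>2 - 4 * (\<Sum>i<n. runmax S i * (S (Suc i) - S i))"
proof -
  \<comment> \<open>Discrete summation by parts: if the maximum does not move, neither side changes;
    if it jumps to \<open>S (Suc n)\<close>, the slack grows by half the square of the jump.\<close>
  have *: "(runmax S n)\<^sup>2 / 2 \<le> runmax S n * S n - (\<Sum>i<n. runmax S i * (S (Suc i) - S i))"
  proof (induction n)
    case 0
    show ?case by (simp add: power2_eq_square)
  next
    case (Suc n)
    show ?case
    proof (cases "S (Suc n) \<le> runmax S n")
      case True
      with Suc show ?thesis by (simp add: max_def algebra_simps split: if_splits)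
    next
      case False
      have "0 \<le> (S (Suc n) - runmax S n)\<^sup>2" by simp
      with False Suc show ?thesis
        by (simp add: max_def algebra_simps power2_eq_square)
    qed
  qed
  \<comment> \<open>Young's inequality \<open>m * S \<le> m^2 / 4 + S^2\<close> absorbs the product;
    this is the origin of the constant 4.\<close>
  have "0 \<le> (runmax S n - 2 * S n)\<^sup>2" by simp
  with * show ?thesis by (simp add: power2_eq_square algebra_simps)
qed

lemma Int_stable_vimages: "Int_stable {Y -` A \<inter> S |A. A \<in> sets N}"
  unfolding Int_stable_def
proof safe
  fix A B assume "A \<in> sets N" "B \<in> sets N"
  then show "\<exists>C. Y -` A \<inter> S \<inter> (Y -` B \<inter> S) = Y -` C \<inter> S \<and> C \<in> sets N"
    by (intro exI[of _ "A \<inter> B"]) auto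
qed

section \<open>Brownian increments: independence, moments, oscillation\<close>

locale bm_space = prob_space M for M :: "'a measure" +
  fixes F :: "real \<Rightarrow> 'a measure" and T :: real and W :: "real \<Rightarrow> 'a \<Rightarrow> real"
  assumes bm: "brownian_motion M F T W"
begin

lemma F_filtration: "filtration (space M) F"
  and F_sub: "sets (F s) \<subseteq> sets M"
  and W_adapted: "0 \<le> s \<Longrightarrow> s < T \<Longrightarrow> W s \<in> borel_measurable (F s)"
  and W_start: "AE \<omega> in M. W 0 \<omega> = 0"
  and W_cont: "AE \<omega> in M. continuous_on {0..<T} (\<lambda>s. W s \<omega>)"
  using bm by (auto simp: brownian_motion_def)

lemma space_F [simp]: "space (F s) = space M"
  using F_filtration by (simp add: filtration_def)

lemma F_mono: "s \<le> u \<Longrightarrow> sets (F s) \<subseteq> sets (F u)"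
  using F_filtration by (simp add: filtration_def)

lemma F_measurable_mono:
  assumes "f \<in> measurable (F s) N" "s \<le> u"
  shows "f \<in> measurable (F u) N"
  using assms(1) by (rule measurable_mono[OF order_refl refl F_mono, THEN subsetD, rotated 2]) (use assms in auto)

lemma F_measurable:
  assumes "f \<in> measurable (F s) N"
  shows "f \<in> measurable M N"
  using assms by (rule measurable_mono[OF order_refl refl F_sub, THEN subsetD, rotated]) auto

lemma W_measurable: "0 \<le> s \<Longrightarrow> s < T \<Longrightarrow> W s \<in> borel_measurable M"
  by (rule F_measurable[OF W_adapted])

context
  fixes s u :: real
  assumes su: "0 \<le> s" "s < u" "u < T"
begin

lemma W_incr_dist:
  "distributed M lborel (\<lambda>\<omega>. W u \<omega> - W s \<omega>) (\<lambda>x. ennreal (normal_density 0 (sqrt (u - s)) x))"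
  using bm su by (auto simp: brownian_motion_def)

text \<open>The map \<open>g\<close> is built in because increments enter later as powers embedded
  into the real or complex field.\<close>

lemma W_incr_indep:
  fixes X :: "'a \<Rightarrow> 'b :: topological_space"
  assumes X: "X \<in> borel_measurable (F s)" and g: "g \<in> borel_measurable borel"
  shows "indep_var borel X borel (\<lambda>\<omega>. g (W u \<omega> - W s \<omega>))"
proof -
  let ?D = "\<lambda>\<omega>. W u \<omega> - W s \<omega>"
  have D: "?D \<in> borel_measurable M" using W_measurable[of u] W_measurable[of s] su by auto
  have "indep_set (sets (F s)) {?D -` A \<inter> space M |A. A \<in> sets borel}"
    using bm su by (auto simp: brownian_motion_def)
  then have "indep_set {X -` A \<inter> space M |A. A \<in> sets borel}
      {(\<lambda>\<omega>. g (?D \<omega>)) -` A \<inter> space M |A. A \<in> sets borel}"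
    unfolding indep_set_def
    by (rule indep_sets_mono_sets)
      (use measurable_sets[OF X] measurable_sets[OF g] in \<open>auto simp: vimage_def split: bool.split\<close>)
  then have *: "indep_set (sigma_sets (space M) {X -` A \<inter> space M |A. A \<in> sets borel})
      (sigma_sets (space M) {(\<lambda>\<omega>. g (?D \<omega>)) -` A \<inter> space M |A. A \<in> sets borel})"
    by (rule indep_set_sigma_sets) (rule Int_stable_vimages)+
  with F_measurable[OF X] measurable_compose[OF D g] show ?thesis by (simp add: indep_var_eq)
qed

lemma W_incr_moments:
  shows W_incr_integrable: "integrable M (\<lambda>\<omega>. (W u \<omega> - W s \<omega>) ^ k)"
    and W_incr_abs_integrable: "integrable M (\<lambda>\<omega>. \<bar>W u \<omega> - W s \<omega>\<bar> ^ k)"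
    and W_incr_mean: "(\<integral>\<omega>. W u \<omega> - W s \<omega> \<partial>M) = 0"
    and W_incr_square: "(\<integral>\<omega>. (W u \<omega> - W s \<omega>)\<^sup>2 \<partial>M) = u - s"
    and W_incr_abs: "(\<integral>\<omega>. \<bar>W u \<omega> - W s \<omega>\<bar> \<partial>M) \<le> sqrt (u - s)"
    and W_incr_cube: "(\<integral>\<omega>. \<bar>W u \<omega> - W s \<omega>\<bar> ^ 3 \<partial>M) \<le> 2 * (u - s) * sqrt (u - s)"
proof -
  have pos: "0 < sqrt (u - s)" using su by simp
  \<comment> \<open>The odd absolute moments of a normal law carry the factor
    \<open>sqrt (2 / pi)\<close>, which is rounded up to 1.\<close>
  have pi1: "sqrt (2 / pi) \<le> 1" using pi_gt3 by (simp add: field_simps)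
  note I = distributed_integral[OF W_incr_dist] and J = distributed_integrable[OF W_incr_dist]
  show "integrable M (\<lambda>\<omega>. (W u \<omega> - W s \<omega>) ^ k)"
    by (subst J[symmetric]) (use integrable_normal_moment[OF pos, of 0 k] in auto)
  show "integrable M (\<lambda>\<omega>. \<bar>W u \<omega> - W s \<omega>\<bar> ^ k)"
    by (subst J[symmetric]) (use integrable_normal_moment_abs[OF pos, of 0 k] in auto)
  show "(\<integral>\<omega>. W u \<omega> - W s \<omega> \<partial>M) = 0"
    using normal_distributed_expectation[OF pos W_incr_dist] .
  show "(\<integral>\<omega>. (W u \<omega> - W s \<omega>)\<^sup>2 \<partial>M) = u - s"
    by (subst I[symmetric]) (use integral_normal_moment_even[OF pos, of 0 1] su in \<open>auto simp: fact_numeral\<close>)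
  have "(\<integral>\<omega>. \<bar>W u \<omega> - W s \<omega>\<bar> \<partial>M) = sqrt (u - s) * sqrt (2 / pi)"
    by (subst I[symmetric]) (use integral_normal_moment_abs_odd[OF pos, of 0 0] su in auto)
  also have "\<dots> \<le> sqrt (u - s) * 1"
    by (rule mult_left_mono[OF pi1]) (use su in auto)
  finally show "(\<integral>\<omega>. \<bar>W u \<omega> - W s \<omega>\<bar> \<partial>M) \<le> sqrt (u - s)" by simp
  have "(\<integral>\<omega>. \<bar>W u \<omega> - W s \<omega>\<bar> ^ 3 \<partial>M) = 2 * (sqrt (u - s)) ^ 3 * sqrt (2 / pi)"
    by (subst I[symmetric]) (use integral_normal_moment_abs_odd[OF pos, of 0 1] su in \<open>auto simp: numeral_eq_Suc\<close>)
  also have "\<dots> \<le> 2 * (sqrt (u - s)) ^ 3 * 1"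
    by (rule mult_left_mono[OF pi1]) (use su in auto)
  also have "\<dots> = 2 * (u - s) * sqrt (u - s)"
    using su by (simp add: power3_eq_cube)
  finally show "(\<integral>\<omega>. \<bar>W u \<omega> - W s \<omega>\<bar> ^ 3 \<partial>M) \<le> 2 * (u - s) * sqrt (u - s)" .
qed

text \<open>With \<open>k = 1\<close> this is the martingale property and with \<open>k = 2\<close>
  the quadratic variation. The type \<open>'b\<close> covers the real integrands of the maximal
  inequality and the complex ones of the characteristic functions.\<close>

lemma W_incr_mult:
  fixes X :: "'a \<Rightarrow> 'b :: {real_normed_field, banach, second_countable_topology}"
  assumes X: "X \<in> borel_measurable (F s)" "integrable M X"
  shows W_incr_mult_integrable: "integrable M (\<lambda>\<omega>. X \<omega> * of_real ((W u \<omega> - W s \<omega>) ^ k))"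
    and W_incr_mult_integral: "(\<integral>\<omega>. X \<omega> * of_real ((W u \<omega> - W s \<omega>) ^ k) \<partial>M)
           = (\<integral>\<omega>. X \<omega> \<partial>M) * of_real (\<integral>\<omega>. (W u \<omega> - W s \<omega>) ^ k \<partial>M)"
proof -
  have *: "indep_var borel X borel (\<lambda>\<omega>. of_real ((W u \<omega> - W s \<omega>) ^ k) :: 'b)"
    using W_incr_indep[OF X(1), of "\<lambda>x. of_real (x ^ k) :: 'b"] by simp
  have i: "integrable M (\<lambda>\<omega>. of_real ((W u \<omega> - W s \<omega>) ^ k) :: 'b)"
    by (intro integrable_of_real W_incr_integrable)
  show "integrable M (\<lambda>\<omega>. X \<omega> * of_real ((W u \<omega> - W s \<omega>) ^ k))"
    by (rule indep_var_integrable[OF * X(2) i])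
  show "(\<integral>\<omega>. X \<omega> * of_real ((W u \<omega> - W s \<omega>) ^ k) \<partial>M)
           = (\<integral>\<omega>. X \<omega> \<partial>M) * of_real (\<integral>\<omega>. (W u \<omega> - W s \<omega>) ^ k \<partial>M)"
    unfolding indep_var_lebesgue_integral[OF * X(2) i]
    by (simp only: integral_bounded_linear[OF bounded_linear_of_real W_incr_integrable])
qed

end

text \<open>The running maximum up to index \<open>i\<close> is known at time \<open>v i\<close>, so
  the transform in \<open>runmax_square_le\<close> has mean zero. The sign \<open>c\<close> gives
  the maxima of \<open>W\<close> and of \<open>- W\<close>, which together control the absolute
  value. The nonnegative integral is the form that Fatou's lemma needs.\<close>

lemma runmax_W_square:
  fixes v :: "nat \<Rightarrow> real" and c :: real
  assumes v: "0 \<le> v 0" "\<And>k. v k < v (Suc k)" "v n < T" and c: "\<bar>c\<bar> = 1"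
  defines "S \<equiv> \<lambda>k \<omega>. c * (W (v k) \<omega> - W (v 0) \<omega>)"
  shows "(\<integral>\<^sup>+\<omega>. ennreal ((runmax (\<lambda>k. S k \<omega>) n)\<^sup>2) \<partial>M) \<le> ennreal (4 * (v n - v 0))"
proof -
  have mono: "strict_mono v" using v(2) by (simp add: strict_mono_Suc_iff)
  have v0: "0 \<le> v k" for k
    using v(1) strict_mono_less_eq[OF mono, of 0 k] by auto
  have vT: "k \<le> n \<Longrightarrow> v k < T" for k
    using v(3) strict_mono_less_eq[OF mono, of k n] by auto
  have SF: "S j \<in> borel_measurable (F (v k))" if "j \<le> k" "k \<le> n" for j k
    unfolding S_def using that v0 vT strict_mono_less_eq[OF mono]
    by (intro borel_measurable_times borel_measurable_diff borel_measurable_const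
        F_measurable_mono[OF W_adapted]) auto
  have Sint': "integrable M (\<lambda>\<omega>. S k \<omega>) \<and> integrable M (\<lambda>\<omega>. (S k \<omega>)\<^sup>2)" if "k \<le> n" for k
  proof (cases "k = 0")
    case False
    then have *: "0 \<le> v 0" "v 0 < v k" "v k < T"
      using v0 vT[OF that] strict_mono_less[OF mono] by auto
    then show ?thesis
      using W_incr_integrable[OF *, of 1] W_incr_integrable[OF *, of 2]
      by (auto simp: S_def power_mult_distrib)
  qed (auto simp: S_def)
  then have Sint: "integrable M (\<lambda>\<omega>. S k \<omega>)" "integrable M (\<lambda>\<omega>. (S k \<omega>)\<^sup>2)" if "k \<le> n" for k
    using that by auto
  let ?m = "\<lambda>i \<omega>. runmax (\<lambda>k. S k \<omega>) i"
  have mF: "?m i \<in> borel_measurable (F (v i))" if "i \<le> n" for i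
    by (rule measurable_runmax) (use SF that in auto)
  have mint: "integrable M (?m i)" if "i \<le> n" for i
  proof (rule Bochner_Integration.integrable_bound)
    show "integrable M (\<lambda>\<omega>. \<Sum>k\<le>i. \<bar>S k \<omega>\<bar>)"
      by (intro Bochner_Integration.integrable_sum integrable_abs Sint) (use that in auto)
    show "?m i \<in> borel_measurable M" using F_measurable[OF mF[OF that]] .
  qed (use abs_runmax_le in \<open>auto intro!: AE_I2 order_trans[OF abs_runmax_le]\<close>)
  have prod: "integrable M (\<lambda>\<omega>. ?m i \<omega> * (S (Suc i) \<omega> - S i \<omega>))"
      "(\<integral>\<omega>. ?m i \<omega> * (S (Suc i) \<omega> - S i \<omega>) \<partial>M) = 0" if "i < n" for i
  proof -
    have *: "0 \<le> v i" "v i < v (Suc i)" "v (Suc i) < T"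
      using v0 vT[of "Suc i"] that v(2) by auto
    have eq: "?m i \<omega> * (S (Suc i) \<omega> - S i \<omega>) = c * (?m i \<omega> * of_real ((W (v (Suc i)) \<omega> - W (v i) \<omega>) ^ 1))" for \<omega>
      by (simp add: S_def algebra_simps)
    have m: "?m i \<in> borel_measurable (F (v i))" "integrable M (?m i)"
      using mF mint that by auto
    show "integrable M (\<lambda>\<omega>. ?m i \<omega> * (S (Suc i) \<omega> - S i \<omega>))"
      unfolding eq by (intro integrable_mult_right W_incr_mult_integrable[OF *] m)
    show "(\<integral>\<omega>. ?m i \<omega> * (S (Suc i) \<omega> - S i \<omega>) \<partial>M) = 0"
      unfolding eq integral_mult_right_zero W_incr_mult_integral[OF * m]
      using W_incr_mean[OF *] by simp
  qed
  let ?R = "\<lambda>\<omega>. 4 * (S n \<omega>)\<^sup>2 - 4 * (\<Sum>i<n. ?m i \<omega> * (S (Suc i) \<omega> - S i \<omega>))"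
  have Rint: "integrable M ?R"
    by (intro Bochner_Integration.integrable_diff integrable_mult_right Sint
        Bochner_Integration.integrable_sum prod) auto
  have "(\<integral>\<^sup>+\<omega>. ennreal ((?m n \<omega>)\<^sup>2) \<partial>M) \<le> (\<integral>\<^sup>+\<omega>. ennreal (?R \<omega>) \<partial>M)"
    by (intro nn_integral_mono ennreal_leI runmax_square_le)
  also have "\<dots> = ennreal (\<integral>\<omega>. ?R \<omega> \<partial>M)"
    by (rule nn_integral_eq_integral[OF Rint])
      (intro AE_I2 order_trans[OF zero_le_power2 runmax_square_le])
  also have "(\<integral>\<omega>. ?R \<omega> \<partial>M) = 4 * (\<integral>\<omega>. (S n \<omega>)\<^sup>2 \<partial>M)"
    by (subst Bochner_Integration.integral_diff)
      (auto intro!: integrable_mult_right Sint Bochner_Integration.integrable_sum prod simp: Bochner_Integration.integral_sum prod)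
  also have "(\<integral>\<omega>. (S n \<omega>)\<^sup>2 \<partial>M) = v n - v 0"
  proof (cases "n = 0")
    case False
    have *: "0 \<le> v 0" "v 0 < v n" "v n < T"
      using v0 vT[of n] strict_mono_less[OF mono] False by auto
    have "c\<^sup>2 = 1" using c by (metis power2_abs power_one)
    then show ?thesis using W_incr_square[OF *] by (simp add: S_def power_mult_distrib)
  qed (simp add: S_def)
  finally show ?thesis .
qed

text \<open>A supremum over uncountably many times is awkward for measurability, in particular as
  continuity holds only almost surely. A measurable majorant is enough: the root of the limes
  inferior of squared grid maxima, integrable by Fatou's lemma. The case \<open>u = T\<close> is
  included for the bound on the whole path.\<close>

lemma W_sup_dominated:
  assumes su: "0 \<le> s" "s < u" "u \<le> T"
  obtains D where "D \<in> borel_measurable M" "integrable M D" "(\<integral>\<omega>. D \<omega> \<partial>M) \<le> 5 * sqrt (u - s)"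
    "AE \<omega> in M. 0 \<le> D \<omega> \<and> (\<forall>v. s \<le> v \<and> v \<le> u \<and> v < T \<longrightarrow> \<bar>W v \<omega> - W s \<omega>\<bar> \<le> D \<omega>)"
proof -
  \<comment> \<open>The denominator \<open>n + 1\<close> against indices up to \<open>n\<close>
    keeps every grid point strictly below \<open>u\<close>, hence below \<open>T\<close> even when
    \<open>u = T\<close>.\<close>
  define v where "v n k = s + (u - s) * real k / real (n + 1)" for n k :: nat
  define m where "m c n \<omega> = runmax (\<lambda>k. c * (W (v n k) \<omega> - W (v n 0) \<omega>)) n" for c n \<omega>
  define q where "q n \<omega> = (m 1 n \<omega>)\<^sup>2 + (m (-1) n \<omega>)\<^sup>2" for n \<omega>
  have v: "0 \<le> v n 0" "\<And>k. v n k < v n (Suc k)" "v n n < T" "v n 0 = s" "v n n - v n 0 \<le> u - s" for n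
  proof -
    show "0 \<le> v n 0" "v n 0 = s" using su by (auto simp: v_def)
    show "v n k < v n (Suc k)" for k
      unfolding v_def using su by (auto intro!: divide_strict_right_mono)
    have "(u - s) * real n / real (n + 1) < u - s"
      using su by (simp add: field_simps)
    then show "v n n < T" "v n n - v n 0 \<le> u - s" using su by (auto simp: v_def)
  qed
  have vT: "v n k < T" "0 \<le> v n k" if "k \<le> n" for n k
  proof -
    have "strict_mono (v n)" using v(2) by (simp add: strict_mono_Suc_iff)
    from strict_mono_less_eq[OF this, of k n] strict_mono_less_eq[OF this, of 0 k]
    show "v n k < T" "0 \<le> v n k" using v(3)[of n] v(1)[of n] that by auto
  qed
  have mM: "m c n \<in> borel_measurable M" for c n
    unfolding m_def
    by (rule measurable_runmax)
      (intro borel_measurable_times borel_measurable_diff borel_measurable_const W_measurable vT; simp)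
  have [measurable]: "q n \<in> borel_measurable M" for n
    unfolding q_def using mM by auto
  have qint: "(\<integral>\<^sup>+\<omega>. ennreal (q n \<omega>) \<partial>M) \<le> ennreal (8 * (u - s))" for n
  proof -
    have "(\<integral>\<^sup>+\<omega>. ennreal (q n \<omega>) \<partial>M)
        = (\<integral>\<^sup>+\<omega>. ennreal ((m 1 n \<omega>)\<^sup>2) \<partial>M) + (\<integral>\<^sup>+\<omega>. ennreal ((m (-1) n \<omega>)\<^sup>2) \<partial>M)"
      unfolding q_def using mM by (subst nn_integral_add[symmetric]) (auto simp: ennreal_plus)
    also have "\<dots> \<le> ennreal (4 * (v n n - v n 0)) + ennreal (4 * (v n n - v n 0))"
      unfolding m_def by (intro add_mono runmax_W_square v) auto
    also have "\<dots> \<le> ennreal (4 * (u - s)) + ennreal (4 * (u - s))"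
      using v(5)[of n] by (intro add_mono ennreal_leI) auto
    also have "\<dots> = ennreal (8 * (u - s))"
      using su by (subst ennreal_plus[symmetric]) auto
    finally show ?thesis .
  qed
  define L where "L \<omega> = liminf (\<lambda>n. ennreal (q n \<omega>))" for \<omega>
  have LM [measurable]: "L \<in> borel_measurable M" unfolding L_def by measurable
  have "(\<integral>\<^sup>+\<omega>. L \<omega> \<partial>M) \<le> liminf (\<lambda>n. \<integral>\<^sup>+\<omega>. ennreal (q n \<omega>) \<partial>M)"
    unfolding L_def by (rule nn_integral_liminf) auto
  also have "\<dots> \<le> ennreal (8 * (u - s))"
    using Liminf_mono[of "\<lambda>n. \<integral>\<^sup>+\<omega>. ennreal (q n \<omega>) \<partial>M" "\<lambda>_. ennreal (8 * (u - s))" sequentially] qint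
    by (simp add: Liminf_const)
  finally have Lint: "(\<integral>\<^sup>+\<omega>. L \<omega> \<partial>M) \<le> ennreal (8 * (u - s))" .
  then have "(\<integral>\<^sup>+\<omega>. L \<omega> \<partial>M) \<noteq> \<infinity>" by (auto simp: top_unique)
  then have Lfin: "AE \<omega> in M. L \<omega> \<noteq> \<infinity>" by (intro nn_integral_PInf_AE) auto
  define R where "R \<omega> = enn2real (L \<omega>)" for \<omega>
  have RM: "R \<in> borel_measurable M" unfolding R_def by measurable
  have "(\<integral>\<^sup>+\<omega>. ennreal (R \<omega>) \<partial>M) = (\<integral>\<^sup>+\<omega>. L \<omega> \<partial>M)"
    by (rule nn_integral_cong_AE) (use Lfin in \<open>auto simp: R_def less_top\<close>)
  with Lint have Rint': "(\<integral>\<^sup>+\<omega>. ennreal (R \<omega>) \<partial>M) \<le> ennreal (8 * (u - s))" by simp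
  have Rint: "integrable M R"
    by (rule integrableI_nonneg[OF RM]) (use Rint' in \<open>auto simp: R_def intro: le_less_trans\<close>)
  have Rle: "(\<integral>\<omega>. R \<omega> \<partial>M) \<le> 8 * (u - s)"
  proof -
    have "AE \<omega> in M. 0 \<le> R \<omega>" by (simp add: R_def)
    from nn_integral_eq_integral[OF Rint this] Rint' su show ?thesis by (simp del: right_diff_distrib_numeral)
  qed
  define d where "d = sqrt (u - s)"
  have d: "0 < d" "d * d = u - s" using su by (auto simp: d_def)
  \<comment> \<open>Turns the bound on the mean of \<open>R\<close> into one on the mean of its
    root: \<open>d / 2 + 8 * d^2 / (2 * d)\<close> is 4.5 times \<open>d\<close>, rounded up to
    5.\<close>
  have amgm: "sqrt x \<le> d / 2 + x / (2 * d)" if "0 \<le> x" for x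
  proof -
    have "0 \<le> (sqrt x - d)\<^sup>2" by simp
    then have "2 * sqrt x * d \<le> x + d * d"
      using that by (simp add: power2_eq_square algebra_simps)
    then show ?thesis using d by (simp add: field_simps)
  qed
  have bd: "integrable M (\<lambda>\<omega>. d / 2 + R \<omega> / (2 * d))"
    by (intro Bochner_Integration.integrable_add Bochner_Integration.integrable_divide Rint) auto
  show thesis
  proof (rule that[of "\<lambda>\<omega>. sqrt (R \<omega>)"])
    show "(\<lambda>\<omega>. sqrt (R \<omega>)) \<in> borel_measurable M" using RM by measurable
    show int: "integrable M (\<lambda>\<omega>. sqrt (R \<omega>))"
      by (rule Bochner_Integration.integrable_bound[OF bd])
        (use amgm RM d in \<open>auto simp: R_def intro!: AE_I2 order_trans[OF _ abs_ge_self]\<close>)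
    have "(\<integral>\<omega>. sqrt (R \<omega>) \<partial>M) \<le> (\<integral>\<omega>. d / 2 + R \<omega> / (2 * d) \<partial>M)"
      by (rule integral_mono[OF int bd]) (use amgm in \<open>auto simp: R_def\<close>)
    also have "\<dots> = d / 2 + (\<integral>\<omega>. R \<omega> \<partial>M) / (2 * d)"
      using Rint by (simp add: prob_space)
    also have "\<dots> \<le> d / 2 + 8 * (d * d) / (2 * d)"
      using Rle d by (intro add_left_mono divide_right_mono) auto
    also have "\<dots> \<le> 5 * d" using d by (simp add: field_simps)
    finally show "(\<integral>\<omega>. sqrt (R \<omega>) \<partial>M) \<le> 5 * sqrt (u - s)" by (simp add: d_def)
    show "AE \<omega> in M. 0 \<le> sqrt (R \<omega>) \<and> (\<forall>w. s \<le> w \<and> w \<le> u \<and> w < T \<longrightarrow> \<bar>W w \<omega> - W s \<omega>\<bar> \<le> sqrt (R \<omega>))"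
      using W_cont Lfin
    proof eventually_elim
      case (elim \<omega>)
      have "\<bar>W w \<omega> - W s \<omega>\<bar> \<le> sqrt (R \<omega>)" if w: "s \<le> w" "w \<le> u" "w < T" for w
      proof -
        define y where "y = (w - s) / (u - s)"
        have y: "0 \<le> y" "y \<le> 1" "w = s + (u - s) * y" using w su by (auto simp: y_def)
        \<comment> \<open>Rounding \<open>n * y\<close>, not \<open>(n + 1) * y\<close>, keeps the
          index at most \<open>n\<close> also for \<open>y = 1\<close>; the grid points still
          converge to \<open>w\<close>.\<close>
        define k where "k n = nat \<lfloor>real n * y\<rfloor>" for n
        have kn: "k n \<le> n" for n
        proof -
          have "real n * y \<le> real n * 1" using y by (intro mult_left_mono) auto
          then show ?thesis unfolding k_def by linarith
        qed
        have kr: "real (k n) = of_int \<lfloor>real n * y\<rfloor>" for n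
          unfolding k_def using y by simp
        have "(\<lambda>n. real (k n) / real (n + 1)) \<longlonglongrightarrow> y"
        proof (rule tendsto_sandwich[of "\<lambda>n. (real n * y - 1) / real (n + 1)" _ _ "\<lambda>n. real n * y / real (n + 1)"])
          show "(\<lambda>n. (real n * y - 1) / real (n + 1)) \<longlonglongrightarrow> y" by real_asymp
          show "(\<lambda>n. real n * y / real (n + 1)) \<longlonglongrightarrow> y" by real_asymp
          show "\<forall>\<^sub>F n in sequentially. (real n * y - 1) / real (n + 1) \<le> real (k n) / real (n + 1)"
            unfolding kr by (intro always_eventually allI divide_right_mono) linarith+
          show "\<forall>\<^sub>F n in sequentially. real (k n) / real (n + 1) \<le> real n * y / real (n + 1)"
            unfolding kr by (intro always_eventually allI divide_right_mono) linarith+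
        qed
        then have "(\<lambda>n. s + (u - s) * (real (k n) / real (n + 1))) \<longlonglongrightarrow> s + (u - s) * y"
          by (intro tendsto_intros)
        then have "(\<lambda>n. v n (k n)) \<longlonglongrightarrow> w" by (simp add: v_def y(3))
        then have "(\<lambda>n. W (v n (k n)) \<omega>) \<longlonglongrightarrow> W w \<omega>"
          by (rule continuous_on_tendsto_compose[OF elim(1)]) (use w su vT kn in auto)
        then have lim: "(\<lambda>n. ennreal ((W (v n (k n)) \<omega> - W s \<omega>)\<^sup>2)) \<longlonglongrightarrow> ennreal ((W w \<omega> - W s \<omega>)\<^sup>2)"
          by (intro tendsto_intros tendsto_ennrealI)
        have le: "ennreal ((W (v n (k n)) \<omega> - W s \<omega>)\<^sup>2) \<le> ennreal (q n \<omega>)" for n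
        proof (rule ennreal_leI)
          let ?x = "W (v n (k n)) \<omega> - W s \<omega>"
          have "1 * ?x \<le> m 1 n \<omega>" "(-1) * ?x \<le> m (-1) n \<omega>"
            unfolding m_def v(4) by (rule runmax_ge[OF kn])+
          then have "?x\<^sup>2 \<le> (m 1 n \<omega>)\<^sup>2 \<or> ?x\<^sup>2 \<le> (m (-1) n \<omega>)\<^sup>2"
            by (cases "?x \<ge> 0") (auto simp: abs_le_square_iff[symmetric])
          then show "?x\<^sup>2 \<le> q n \<omega>" unfolding q_def
            by (auto intro: add_increasing add_increasing2)
        qed
        have "ennreal ((W w \<omega> - W s \<omega>)\<^sup>2) = liminf (\<lambda>n. ennreal ((W (v n (k n)) \<omega> - W s \<omega>)\<^sup>2))"
          using lim_imp_Liminf[OF _ lim] by simp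
        also have "\<dots> \<le> L \<omega>" unfolding L_def by (intro Liminf_mono always_eventually allI le)
        finally have "(W w \<omega> - W s \<omega>)\<^sup>2 \<le> R \<omega>"
          unfolding R_def using elim(2) by (simp add: ennreal_le_iff2 enn2real_leI less_top flip: ennreal_le_iff)
        then show ?thesis by (metis real_sqrt_abs real_sqrt_le_iff)
      qed
      then show ?case by (auto simp: R_def)
    qed
  qed
qed

end

subsection \<open>Logistic weights and bridge paths\<close>

text \<open>Bayes' formula: \<open>\<kappa>\<close> is the prior odds ratio of the pin
  \<open>- \<rho>\<close> against \<open>\<rho>\<close>, and \<open>exp (- 2 * \<rho> * x)\<close>
  is the likelihood ratio at scaled position \<open>x\<close>.\<close>

definition logit_weight :: "real \<Rightarrow> real \<Rightarrow> real \<Rightarrow> real" where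
  "logit_weight \<rho> \<kappa> x = 1 / (1 + \<kappa> * exp (- 2 * \<rho> * x))"

lemma logit_weight_bounds:
  assumes "0 \<le> \<kappa>"
  shows "0 < logit_weight \<rho> \<kappa> x" "logit_weight \<rho> \<kappa> x \<le> 1"
proof -
  have "0 \<le> \<kappa> * exp (- 2 * \<rho> * x)" using assms by simp
  then show "0 < logit_weight \<rho> \<kappa> x" "logit_weight \<rho> \<kappa> x \<le> 1"
    unfolding logit_weight_def by (simp_all add: add_pos_nonneg)
qed

text \<open>The logistic differential equation. Its right side is a polynomial in the weight, so all
  higher derivatives are polynomials in it as well and therefore bounded.\<close>

lemma logit_weight_deriv:
  assumes "0 \<le> \<kappa>"
  shows "(logit_weight \<rho> \<kappa> has_real_derivative
           2 * \<rho> * (logit_weight \<rho> \<kappa> x - (logit_weight \<rho> \<kappa> x)\<^sup>2)) (at x)"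
proof -
  have nz: "1 + \<kappa> * exp (- 2 * \<rho> * y) \<noteq> 0" for y
    using logit_weight_bounds(1)[OF assms, of \<rho> y] by (auto simp: logit_weight_def)
  have "(logit_weight \<rho> \<kappa> has_real_derivative
         - (\<kappa> * (exp (- 2 * \<rho> * x) * (- 2 * \<rho>))) / (1 + \<kappa> * exp (- 2 * \<rho> * x))\<^sup>2) (at x)"
    unfolding logit_weight_def[abs_def]
    by (rule derivative_eq_intros refl nz | simp add: power2_eq_square nz)+
  moreover have "- (\<kappa> * (exp (- 2 * \<rho> * x) * (- 2 * \<rho>))) / (1 + \<kappa> * exp (- 2 * \<rho> * x))\<^sup>2
      = 2 * \<rho> * (logit_weight \<rho> \<kappa> x - (logit_weight \<rho> \<kappa> x)\<^sup>2)"
  proof -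
    define e where "e = \<kappa> * exp (- 2 * \<rho> * x)"
    have e: "1 + e \<noteq> 0" using nz[of x] by (simp add: e_def)
    have "1 / (1 + e) - (1 / (1 + e))\<^sup>2 = e / (1 + e)\<^sup>2"
      using e by (simp add: diff_divide_eq_iff power_divide) (simp add: power2_eq_square field_simps)
    then show ?thesis unfolding logit_weight_def e_def[symmetric]
      by (simp add: e_def)
  qed
  ultimately show ?thesis by simp
qed

lemma logit_weight_measurable [measurable]: "logit_weight \<rho> \<kappa> \<in> borel_measurable borel"
  unfolding logit_weight_def[abs_def] by measurable

lemma norm_diff_le_vector_derivative:
  fixes f :: "real \<Rightarrow> 'b :: real_normed_vector"
  assumes "convex S" "x \<in> S" "y \<in> S"
    and "\<And>x. x \<in> S \<Longrightarrow> (f has_vector_derivative f' x) (at x within S)"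
    and "\<And>x. x \<in> S \<Longrightarrow> norm (f' x) \<le> B"
  shows "norm (f x - f y) \<le> B * \<bar>x - y\<bar>"
proof -
  have "norm (f x - f y) \<le> B * norm (x - y)"
  proof (rule differentiable_bound[OF assms(1) _ _ assms(2,3), where f' = "\<lambda>x h. h *\<^sub>R f' x"])
    show "(f has_derivative (\<lambda>h. h *\<^sub>R f' x)) (at x within S)" if "x \<in> S" for x
      using assms(4)[OF that] by (simp add: has_vector_derivative_def)
    show "onorm (\<lambda>h. h *\<^sub>R f' x) \<le> B" if "x \<in> S" for x
      by (rule onorm_le) (use assms(5)[OF that] in \<open>simp add: mult.commute[of B] mult_left_mono\<close>)
  qed
  then show ?thesis by simp
qed

lemma logit_weight_lipschitz:
  assumes "0 \<le> \<kappa>"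
  shows "\<bar>logit_weight \<rho> \<kappa> x - logit_weight \<rho> \<kappa> y\<bar> \<le> 2 * \<bar>\<rho>\<bar> * \<bar>x - y\<bar>"
proof -
  have "norm (logit_weight \<rho> \<kappa> x - logit_weight \<rho> \<kappa> y) \<le> 2 * \<bar>\<rho>\<bar> * \<bar>x - y\<bar>"
  proof (rule norm_diff_le_vector_derivative[where S = UNIV])
    show "(logit_weight \<rho> \<kappa> has_vector_derivative
        2 * \<rho> * (logit_weight \<rho> \<kappa> z - (logit_weight \<rho> \<kappa> z)\<^sup>2)) (at z within UNIV)" for z
      using logit_weight_deriv[OF assms] by (simp add: has_real_derivative_iff_has_vector_derivative)
    show "norm (2 * \<rho> * (logit_weight \<rho> \<kappa> z - (logit_weight \<rho> \<kappa> z)\<^sup>2)) \<le> 2 * \<bar>\<rho>\<bar>" for z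
    proof -
      define y where "y = logit_weight \<rho> \<kappa> z"
      have y: "0 \<le> y" "y \<le> 1" using logit_weight_bounds[OF assms, of \<rho> z] by (auto simp: y_def)
      have "0 \<le> y * (1 - y)" using y by (intro mult_nonneg_nonneg) auto
      then have "0 \<le> y - y\<^sup>2" by (simp add: power2_eq_square algebra_simps)
      moreover have "y - y\<^sup>2 \<le> 1" using y by (smt (verit) zero_le_power2)
      ultimately have "\<bar>y - y\<^sup>2\<bar> \<le> 1" by simp
      then have "(2 * \<bar>\<rho>\<bar>) * \<bar>y - y\<^sup>2\<bar> \<le> (2 * \<bar>\<rho>\<bar>) * 1" by (rule mult_left_mono) simp
      then show ?thesis by (simp add: y_def abs_mult)
    qed
  qed auto
  then show ?thesis by simp
qed

section \<open>Taylor bounds and the generator of the scaled bridge\<close>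

lemma taylor_bounds:
  fixes \<phi>0 \<phi>1 \<phi>2 \<phi>3 :: "real \<Rightarrow> 'b :: real_normed_vector"
  assumes d: "\<And>x. (\<phi>0 has_vector_derivative \<phi>1 x) (at x)" "\<And>x. (\<phi>1 has_vector_derivative \<phi>2 x) (at x)"
      "\<And>x. (\<phi>2 has_vector_derivative \<phi>3 x) (at x)"
    and B: "\<And>x. norm (\<phi>1 x) \<le> B" "\<And>x. norm (\<phi>2 x) \<le> B" "\<And>x. norm (\<phi>3 x) \<le> B"
  shows "norm (\<phi>0 (x + e) - \<phi>0 x) \<le> B * \<bar>e\<bar>"
    and "norm (\<phi>1 (x + e) - \<phi>1 x) \<le> B * \<bar>e\<bar>"
    and "norm (\<phi>0 (x + e) - \<phi>0 x - e *\<^sub>R \<phi>1 x) \<le> B * e\<^sup>2"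
    and "norm (\<phi>0 (x + e) - \<phi>0 x - e *\<^sub>R \<phi>1 x - (e\<^sup>2 / 2) *\<^sub>R \<phi>2 x) \<le> B * \<bar>e\<bar> ^ 3"
proof -
  have B0: "0 \<le> B" using B(1)[of 0] norm_ge_zero order_trans by blast
  have lip: "norm (\<phi> (x + e) - \<phi> x) \<le> B * \<bar>e\<bar>"
    if "\<And>x. (\<phi> has_vector_derivative \<phi>' x) (at x)" "\<And>x. norm (\<phi>' x) \<le> B"
    for \<phi> \<phi>' :: "real \<Rightarrow> 'b" and x e
    using norm_diff_le_vector_derivative[of UNIV "x + e" x \<phi> \<phi>' B] that by simp
  have shift: "((\<lambda>t. \<phi> (x + t)) has_vector_derivative \<phi>' (x + t)) (at t within S)"
    if "\<And>x. (\<phi> has_vector_derivative \<phi>' x) (at x)" for \<phi> \<phi>' :: "real \<Rightarrow> 'b" and t S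
  proof -
    have "((\<lambda>t. x + t) has_vector_derivative 1) (at t within S)"
      by (auto intro!: derivative_eq_intros)
    from vector_diff_chain_within[OF this has_vector_derivative_at_within[OF that]]
    show ?thesis by (simp add: comp_def)
  qed
  show "norm (\<phi>0 (x + e) - \<phi>0 x) \<le> B * \<bar>e\<bar>" by (rule lip[OF d(1) B(1)])
  show "norm (\<phi>1 (x + e) - \<phi>1 x) \<le> B * \<bar>e\<bar>" by (rule lip[OF d(2) B(2)])
  have sec: "norm (\<phi> (x + e) - \<phi> x - e *\<^sub>R \<phi>' x) \<le> B * e\<^sup>2"
    if D: "\<And>x. (\<phi> has_vector_derivative \<phi>' x) (at x)" "\<And>x. (\<phi>' has_vector_derivative \<phi>'' x) (at x)"
       "\<And>x. norm (\<phi>'' x) \<le> B" for \<phi> \<phi>' \<phi>'' :: "real \<Rightarrow> 'b" and e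
  proof -
    have "norm ((\<phi> (x + e) - \<phi> x - e *\<^sub>R \<phi>' x) - (\<phi> (x + 0) - \<phi> x - 0 *\<^sub>R \<phi>' x)) \<le> (B * \<bar>e\<bar>) * \<bar>e - 0\<bar>"
    proof (rule norm_diff_le_vector_derivative[where S = "closed_segment 0 e"])
      fix t assume "t \<in> closed_segment 0 e"
      then have t: "\<bar>t\<bar> \<le> \<bar>e\<bar>" by (auto simp: closed_segment_eq_real_ivl split: if_splits)
      show "((\<lambda>t. \<phi> (x + t) - \<phi> x - t *\<^sub>R \<phi>' x) has_vector_derivative \<phi>' (x + t) - \<phi>' x)
            (at t within closed_segment 0 e)"
        by (auto intro!: derivative_eq_intros shift[OF D(1)])
      have "norm (\<phi>' (x + t) - \<phi>' x) \<le> B * \<bar>t\<bar>" by (rule lip[OF D(2,3)])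
      also have "\<dots> \<le> B * \<bar>e\<bar>" using t B0 by (rule mult_left_mono)
      finally show "norm (\<phi>' (x + t) - \<phi>' x) \<le> B * \<bar>e\<bar>" .
    qed auto
    then show ?thesis by (simp add: power2_eq_square mult.assoc)
  qed
  show "norm (\<phi>0 (x + e) - \<phi>0 x - e *\<^sub>R \<phi>1 x) \<le> B * e\<^sup>2"
    by (rule sec[OF d(1,2) B(2)])
  let ?f = "\<lambda>t. \<phi>0 (x + t) - \<phi>0 x - t *\<^sub>R \<phi>1 x - (t\<^sup>2 / 2) *\<^sub>R \<phi>2 x"
  have "norm (?f e - ?f 0) \<le> (B * \<bar>e\<bar>\<^sup>2) * \<bar>e - 0\<bar>"
  proof (rule norm_diff_le_vector_derivative[where S = "closed_segment 0 e"])
    fix t assume "t \<in> closed_segment 0 e"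
    then have t: "\<bar>t\<bar> \<le> \<bar>e\<bar>" by (auto simp: closed_segment_eq_real_ivl split: if_splits)
    show "(?f has_vector_derivative \<phi>1 (x + t) - \<phi>1 x - t *\<^sub>R \<phi>2 x) (at t within closed_segment 0 e)"
      by (auto intro!: derivative_eq_intros shift[OF d(1)])
    have "norm (\<phi>1 (x + t) - \<phi>1 x - t *\<^sub>R \<phi>2 x) \<le> B * t\<^sup>2" by (rule sec[OF d(2,3) B(3)])
    also have "\<dots> \<le> B * \<bar>e\<bar>\<^sup>2" using power_mono[OF t, of 2] B0 by (intro mult_left_mono) auto
    finally show "norm (\<phi>1 (x + t) - \<phi>1 x - t *\<^sub>R \<phi>2 x) \<le> B * \<bar>e\<bar>\<^sup>2" .
  qed auto
  then show "norm (\<phi>0 (x + e) - \<phi>0 x - e *\<^sub>R \<phi>1 x - (e\<^sup>2 / 2) *\<^sub>R \<phi>2 x) \<le> B * \<bar>e\<bar> ^ 3"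
    by (simp add: power2_eq_square power3_eq_cube mult.assoc)
qed

text \<open>The identity below says that \<open>\<phi>\<close> is an eigenfunction of the generator of a Brownian motion
  with drift \<open>\<rho> (2 g - 1)\<close>, where \<open>g\<close> is the logistic weight.\<close>

lemma logit_weight_eigenfunction:
  fixes \<rho> \<kappa> \<theta> :: real and \<phi> :: "real \<Rightarrow> complex"
  assumes \<kappa>: "0 \<le> \<kappa>"
    and \<phi>_eq: "\<And>x. \<phi> x = of_real (logit_weight \<rho> \<kappa> x) * exp (\<i> * of_real (\<theta> * x))"
  obtains \<phi>' \<phi>'' \<phi>''' :: "real \<Rightarrow> complex" and B :: real
  where "\<And>x. (\<phi> has_vector_derivative \<phi>' x) (at x)" "\<And>x. (\<phi>' has_vector_derivative \<phi>'' x) (at x)"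
      "\<And>x. (\<phi>'' has_vector_derivative \<phi>''' x) (at x)"
      "\<And>x. norm (\<phi>' x) \<le> B" "\<And>x. norm (\<phi>'' x) \<le> B" "\<And>x. norm (\<phi>''' x) \<le> B"
      "\<And>x. of_real (\<rho> * (2 * logit_weight \<rho> \<kappa> x - 1)) * \<phi>' x + \<phi>'' x / 2
              = (\<i> * of_real (\<theta> * \<rho>) - of_real (\<theta>\<^sup>2 / 2)) * \<phi> x"
      "\<phi>' \<in> borel_measurable borel" "\<phi>'' \<in> borel_measurable borel"
proof -
  have \<phi>_def: "\<phi> = (\<lambda>x. of_real (logit_weight \<rho> \<kappa> x) * exp (\<i> * of_real (\<theta> * x)))"
    using \<phi>_eq by (rule ext)
  let ?g = "logit_weight \<rho> \<kappa>"
  define e where "e x = exp (\<i> * of_real (\<theta> * x))" for x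
  let ?t = "\<i> * complex_of_real \<theta>" and ?r = "complex_of_real \<rho>"
  \<comment> \<open>By the logistic equation each derivative of \<open>\<phi>\<close> is a
    polynomial in the weight times \<open>e\<close>: differentiation sends \<open>P\<close> to
    \<open>\<i> * \<theta> * P + 2 * \<rho> * (y - y^2) * P'\<close>. The polynomials
    \<open>Q1\<close> and \<open>Q2\<close> are the derivatives of \<open>P1\<close> and
    \<open>P2\<close>.\<close>
  define P1 where "P1 y = ?t * y + 2 * ?r * (y - y\<^sup>2)" for y
  define Q1 where "Q1 y = ?t + 2 * ?r * (1 - 2 * y)" for y
  define P2 where "P2 y = ?t * P1 y + 2 * ?r * (y - y\<^sup>2) * Q1 y" for y
  define Q2 where "Q2 y = ?t * Q1 y + 2 * ?r * ((1 - 2 * y) * Q1 y - 4 * ?r * (y - y\<^sup>2))" for y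
  define P3 where "P3 y = ?t * P2 y + 2 * ?r * (y - y\<^sup>2) * Q2 y" for y
  have Pd: "(P1 has_field_derivative Q1 y) (at y)" for y
    unfolding P1_def[abs_def] Q1_def by (auto intro!: derivative_eq_intros simp: algebra_simps)
  have Pd2: "(P2 has_field_derivative Q2 y) (at y)" for y
  proof -
    have "(Q1 has_field_derivative 2 * ?r * (-2)) (at y)"
      unfolding Q1_def[abs_def] by (auto intro!: derivative_eq_intros)
    note [derivative_intros] = this Pd
    show ?thesis
      unfolding P2_def[abs_def] Q2_def by (auto intro!: derivative_eq_intros simp: algebra_simps)
  qed
  have ed: "(e has_vector_derivative ?t * e x) (at x)" for x
  proof -
    have "((\<lambda>x. \<i> * complex_of_real (\<theta> * x)) has_vector_derivative ?t) (at x)"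
      by (auto intro!: derivative_eq_intros)
    from field_vector_diff_chain_at[OF this DERIV_exp]
    show ?thesis by (simp add: e_def[abs_def] comp_def)
  qed
  have main: "((\<lambda>x. P (of_real (?g x)) * e x) has_vector_derivative
      (?t * P (of_real (?g x)) + 2 * ?r * (of_real (?g x) - (of_real (?g x))\<^sup>2) * Q (of_real (?g x))) * e x) (at x)"
    if "\<And>y. (P has_field_derivative Q y) (at y)" for P Q x
  proof -
    have "((\<lambda>x. complex_of_real (?g x)) has_vector_derivative of_real (2 * \<rho> * (?g x - (?g x)\<^sup>2))) (at x)"
      by (intro has_vector_derivative_of_real)
        (use logit_weight_deriv[OF \<kappa>] in \<open>simp add: has_real_derivative_iff_has_vector_derivative\<close>)
    from field_vector_diff_chain_at[OF this that[of "of_real (?g x)"]]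
    have "((\<lambda>x. P (of_real (?g x))) has_vector_derivative
        of_real (2 * \<rho> * (?g x - (?g x)\<^sup>2)) * Q (of_real (?g x))) (at x)"
      by (simp add: comp_def)
    from has_vector_derivative_mult[OF this ed[of x]]
    show ?thesis by (simp add: algebra_simps)
  qed
  have gb: "?g x \<in> {0..1}" for x
    using logit_weight_bounds[OF \<kappa>, of \<rho> x] by auto
  \<comment> \<open>The weight takes values in the compact interval [0, 1] and \<open>e\<close> has
    modulus 1, so continuity of the polynomial is all that boundedness requires.\<close>
  have bound: "\<exists>B. \<forall>x. norm (P (of_real (?g x)) * e x) \<le> B" if "continuous_on UNIV P" for P :: "complex \<Rightarrow> complex"
  proof -
    have "continuous_on {0..1} (\<lambda>y::real. complex_of_real y)"
      by (intro continuous_intros)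
    then have "continuous_on {0..1} (\<lambda>y::real. P (of_real y))"
      by (rule continuous_on_compose2[OF that]) simp
    then have "bounded ((\<lambda>y::real. P (of_real y)) ` {0..1})"
      by (intro compact_imp_bounded compact_continuous_image compact_Icc)
    then obtain B where "\<forall>y\<in>{0..1}. norm (P (of_real y)) \<le> B"
      by (auto simp: bounded_iff)
    with gb have "norm (P (of_real (?g x)) * e x) \<le> B" for x
      by (simp add: norm_mult e_def)
    then show ?thesis by blast
  qed
  have c: "continuous_on UNIV P1" "continuous_on UNIV P2" "continuous_on UNIV P3"
    unfolding P3_def[abs_def] P2_def[abs_def] Q2_def[abs_def] P1_def[abs_def] Q1_def[abs_def]
    by (intro continuous_intros)+
  obtain B1 B2 B3 where B: "\<And>x. norm (P1 (of_real (?g x)) * e x) \<le> B1"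
      "\<And>x. norm (P2 (of_real (?g x)) * e x) \<le> B2" "\<And>x. norm (P3 (of_real (?g x)) * e x) \<le> B3"
    using bound[OF c(1)] bound[OF c(2)] bound[OF c(3)] by metis
  have em: "e \<in> borel_measurable borel"
    unfolding e_def by (intro borel_measurable_continuous_onI continuous_intros)
  have m: "(\<lambda>x. P (of_real (?g x)) * e x) \<in> borel_measurable borel" if "continuous_on UNIV P" for P :: "complex \<Rightarrow> complex"
    by (intro borel_measurable_times em measurable_compose[OF _ borel_measurable_continuous_onI[OF that]]
        measurable_compose[OF logit_weight_measurable borel_measurable_of_real])
  show thesis
  proof (rule that[where \<phi>' = "\<lambda>x. P1 (of_real (?g x)) * e x" and \<phi>'' = "\<lambda>x. P2 (of_real (?g x)) * e x"
        and \<phi>''' = "\<lambda>x. P3 (of_real (?g x)) * e x" and B = "max B1 (max B2 B3)"])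
    show "(\<phi> has_vector_derivative P1 (of_real (?g x)) * e x) (at x)" for x
      using main[of "\<lambda>y. y" "\<lambda>_. 1" x] by (simp add: \<phi>_def e_def[abs_def] P1_def)
    show "((\<lambda>x. P1 (of_real (?g x)) * e x) has_vector_derivative P2 (of_real (?g x)) * e x) (at x)" for x
      using main[OF Pd, of x] by (simp add: P2_def)
    show "((\<lambda>x. P2 (of_real (?g x)) * e x) has_vector_derivative P3 (of_real (?g x)) * e x) (at x)" for x
      using main[OF Pd2, of x] by (simp add: P3_def)
    show "of_real (\<rho> * (2 * ?g x - 1)) * (P1 (of_real (?g x)) * e x) + P2 (of_real (?g x)) * e x / 2
              = (\<i> * of_real (\<theta> * \<rho>) - of_real (\<theta>\<^sup>2 / 2)) * \<phi> x" for x
    proof -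
      define y where "y = complex_of_real (?g x)"
      have ii: "\<i> * (\<i> * q) = - q" for q by (simp add: flip: mult.assoc)
      \<comment> \<open>A polynomial identity in \<open>y\<close> in which the quadratic and cubic
        terms cancel. The factor that remains is twice the characteristic exponent of a Brownian
        motion with constant drift \<open>\<rho>\<close>, which is why the tilt makes the drift
        deterministic.\<close>
      have "2 * (?r * (2 * y - 1) * P1 y) + P2 y = (2 * (\<i> * of_real \<theta> * ?r) - (of_real \<theta>)\<^sup>2) * y"
        unfolding P2_def P1_def Q1_def by (simp add: algebra_simps power2_eq_square ii)
      then have "(2 * (?r * (2 * y - 1) * P1 y) + P2 y) / 2 = (2 * (\<i> * of_real \<theta> * ?r) - (of_real \<theta>)\<^sup>2) * y / 2"
        by simp
      then have *: "?r * (2 * y - 1) * P1 y + P2 y / 2 = (\<i> * of_real \<theta> * ?r - (of_real \<theta>)\<^sup>2 / 2) * y"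
        by (simp add: add_divide_distrib diff_divide_distrib left_diff_distrib)
      have "of_real (\<rho> * (2 * ?g x - 1)) * (P1 y * e x) + P2 y * e x / 2
          = (?r * (2 * y - 1) * P1 y + P2 y / 2) * e x"
        by (simp add: algebra_simps y_def)
      also have "\<dots> = (\<i> * of_real (\<theta> * \<rho>) - of_real (\<theta>\<^sup>2 / 2)) * \<phi> x"
        unfolding * \<phi>_def e_def by (simp add: y_def)
      finally show ?thesis by (simp add: y_def)
    qed
  qed (use B m c in \<open>auto simp: le_max_iff_disj\<close>)
qed

section \<open>Estimates for a single path of the bridge equation\<close>

locale bridge_path =
  fixes \<rho> \<kappa> T z :: real and w x :: "real \<Rightarrow> real"
  assumes \<kappa>: "0 \<le> \<kappa>"
    and w_cont: "continuous_on {0..<T} w"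
    and x_cont: "continuous_on {0..<T} x"
    and sde: "\<And>s. 0 \<le> s \<Longrightarrow> s < T \<Longrightarrow> x s = z + integral {0..s}
          (\<lambda>v. (\<rho> * (2 * logit_weight \<rho> \<kappa> (x v / (T - v)) - 1) - x v) / (T - v)) + w s"
begin

abbreviation h :: "real \<Rightarrow> real" where
  "h v \<equiv> \<rho> * (2 * logit_weight \<rho> \<kappa> (x v / (T - v)) - 1)"

lemma h_bound: "\<bar>h v\<bar> \<le> \<bar>\<rho>\<bar>"
proof -
  have "\<bar>2 * logit_weight \<rho> \<kappa> (x v / (T - v)) - 1\<bar> \<le> 1"
    using logit_weight_bounds[OF \<kappa>, of \<rho> "x v / (T - v)"] by auto
  then show ?thesis using mult_left_mono[of _ 1 "\<bar>\<rho>\<bar>"] by (simp add: abs_mult)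
qed

text \<open>The path \<open>x\<close> is as rough as the noise, but \<open>x - w\<close> is
  differentiable with derivative \<open>(h v - x v) / (T - v)\<close>. After division by
  \<open>T - v\<close> the quotient rule contributes \<open>x v\<close>, which cancels the restoring
  force, so only the bounded \<open>h\<close> and the noise remain. The shift \<open>b\<close> will
  be the noise at the left end of a step.\<close>

lemma scaled_deriv:
  assumes "0 \<le> v" "v < u" "u < T"
  shows "((\<lambda>v. (x v - w v + b) / (T - v)) has_real_derivative (h v + b - w v) / (T - v)\<^sup>2) (at v within {0..u})"
proof -
  have c: "continuous_on {0..u} (\<lambda>v. (h v - x v) / (T - v))"
  proof -
    have xc: "continuous_on {0..u} x" using x_cont by (rule continuous_on_subset) (use assms in auto)
    have "continuous_on UNIV (logit_weight \<rho> \<kappa>)"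
      by (rule DERIV_continuous_on[OF has_field_derivative_at_within[OF logit_weight_deriv[OF \<kappa>]]])
    then have "continuous_on {0..u} (\<lambda>v. logit_weight \<rho> \<kappa> (x v / (T - v)))"
      by (rule continuous_on_compose2) (use assms xc in \<open>auto intro!: continuous_intros\<close>)
    with xc show ?thesis using assms by (intro continuous_intros) auto
  qed
  have "((\<lambda>v. integral {0..v} (\<lambda>v. (h v - x v) / (T - v))) has_real_derivative (h v - x v) / (T - v)) (at v within {0..u})"
    using integral_has_vector_derivative[OF c, of v] assms
    by (simp add: has_real_derivative_iff_has_vector_derivative)
  then have "((\<lambda>v. (z + b + integral {0..v} (\<lambda>v. (h v - x v) / (T - v))) / (T - v)) has_real_derivative
      ((h v - x v) / (T - v) * (T - v) + (z + b + integral {0..v} (\<lambda>v. (h v - x v) / (T - v)))) / (T - v)\<^sup>2) (at v within {0..u})"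
    using assms by (auto intro!: derivative_eq_intros simp: power2_eq_square)
  moreover have I: "z + b + integral {0..s} (\<lambda>v. (h v - x v) / (T - v)) = x s - w s + b" if "s \<in> {0..u}" for s
    using sde[of s] that assms by simp
  moreover have "(h v - x v) / (T - v) * (T - v) + (z + b + integral {0..v} (\<lambda>v. (h v - x v) / (T - v))) = h v + b - w v"
    using I[of v] assms by simp
  ultimately have "((\<lambda>v. (z + b + integral {0..v} (\<lambda>v. (h v - x v) / (T - v))) / (T - v)) has_real_derivative
      (h v + b - w v) / (T - v)\<^sup>2) (at v within {0..u})"
    by (simp only:)
  then show ?thesis
    by (rule has_field_derivative_transform_within[OF _ zero_less_one]) (use assms I in auto)
qed

text \<open>Mean value inequality for the differentiable part, compared with a majorant
  \<open>\<psi>\<close> and centred at a constant rate \<open>c\<close>. The freedom in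
  \<open>\<psi>\<close> matters: near \<open>T\<close> it must blow up like
  \<open>1 / (T - y)\<close>, whereas over a short step it is linear.\<close>

lemma scaled_incr:
  assumes s: "0 \<le> s" "s \<le> v" "v < T"
    and deriv: "\<And>y. s < y \<Longrightarrow> y < v \<Longrightarrow> (\<psi> has_real_derivative \<psi>' y) (at y)"
    and cont: "continuous_on {s..v} \<psi>"
    and cont': "\<And>y. s < y \<Longrightarrow> y < v \<Longrightarrow> \<bar>(h y + w s - w y) / (T - y)\<^sup>2 - c\<bar> \<le> \<psi>' y"
  shows "\<bar>x v / (T - v) - x s / (T - s) - (w v - w s) / (T - v) - c * (v - s)\<bar> \<le> \<psi> v - \<psi> s"
proof (cases "s = v")
  case False
  with s have sv: "s < v" by simp
  let ?\<Gamma> = "\<lambda>y. (x y - w y + w s) / (T - y) - c * y"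
  have "norm (?\<Gamma> v - ?\<Gamma> s) \<le> \<psi> v - \<psi> s"
  proof (rule differentiable_bound_general[OF sv])
    show "continuous_on {s..v} ?\<Gamma>"
    proof -
      have "continuous_on {s..v} x" "continuous_on {s..v} w"
        using x_cont w_cont s by (auto elim!: continuous_on_subset)
      then show ?thesis using s by (intro continuous_intros) auto
    qed
    fix y assume y: "s < y" "y < v"
    have "((\<lambda>v. (x v - w v + w s) / (T - v)) has_real_derivative (h y + w s - w y) / (T - y)\<^sup>2) (at y within {0..v})"
      by (rule scaled_deriv) (use y s in auto)
    then have "((\<lambda>v. (x v - w v + w s) / (T - v)) has_real_derivative (h y + w s - w y) / (T - y)\<^sup>2) (at y)"
      using y s by (simp add: at_within_Icc_at)
    then have "(?\<Gamma> has_real_derivative (h y + w s - w y) / (T - y)\<^sup>2 - c) (at y)"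
      by (rule DERIV_diff) (auto intro!: derivative_eq_intros)
    then show "(?\<Gamma> has_vector_derivative (h y + w s - w y) / (T - y)\<^sup>2 - c) (at y)"
      by (simp add: has_real_derivative_iff_has_vector_derivative)
    show "(\<psi> has_vector_derivative \<psi>' y) (at y)"
      using deriv[OF y] by (simp add: has_real_derivative_iff_has_vector_derivative)
    show "norm ((h y + w s - w y) / (T - y)\<^sup>2 - c) \<le> \<psi>' y" using cont'[OF y] by simp
  qed (rule cont)
  moreover have "?\<Gamma> v - ?\<Gamma> s = x v / (T - v) - x s / (T - s) - (w v - w s) / (T - v) - c * (v - s)"
    by (simp add: diff_divide_distrib add_divide_distrib algebra_simps)
  ultimately show ?thesis by simp
qed simp

text \<open>The scaled path is bounded by a multiple of \<open>1 / (T - v)\<close>, and multiplying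
  by \<open>T - v\<close> returns a bound uniform up to \<open>T\<close> in spite of the singular
  drift. One \<open>S\<close> comes from the integrated noise, the other from \<open>w v\<close>
  itself.\<close>

lemma path_bound:
  assumes S: "\<And>y. 0 \<le> y \<Longrightarrow> y < T \<Longrightarrow> \<bar>w y\<bar> \<le> S" and w0: "w 0 = 0" and v: "0 \<le> v" "v < T"
  shows "\<bar>x v\<bar> \<le> \<bar>z\<bar> + \<bar>\<rho>\<bar> + 2 * S"
proof -
  have x0: "x 0 = z" using sde[of 0] v w0 by simp
  have S0: "0 \<le> S" using S[of 0] v by (meson abs_ge_zero order_trans order_refl le_less_trans)
  let ?\<psi> = "\<lambda>y. (\<bar>\<rho>\<bar> + S) / (T - y)"
  have "\<bar>x v / (T - v) - x 0 / (T - 0) - (w v - w 0) / (T - v) - 0 * (v - 0)\<bar> \<le> ?\<psi> v - ?\<psi> 0"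
  proof (rule scaled_incr)
    show "(?\<psi> has_real_derivative (\<bar>\<rho>\<bar> + S) / (T - y)\<^sup>2) (at y)" if "0 < y" "y < v" for y
      using that v by (auto intro!: derivative_eq_intros simp: power2_eq_square)
    show "continuous_on {0..v} ?\<psi>" using v by (intro continuous_intros) auto
    show "\<bar>(h y + w 0 - w y) / (T - y)\<^sup>2 - 0\<bar> \<le> (\<bar>\<rho>\<bar> + S) / (T - y)\<^sup>2" if "0 < y" "y < v" for y
    proof -
      have "\<bar>h y + w 0 - w y\<bar> \<le> \<bar>\<rho>\<bar> + S" using h_bound[of y] S[of y] that v w0 by linarith
      then show ?thesis by (simp add: divide_right_mono)
    qed
  qed (use v in auto)
  then have "\<bar>x v / (T - v) - z / T - w v / (T - v)\<bar> \<le> (\<bar>\<rho>\<bar> + S) / (T - v) - (\<bar>\<rho>\<bar> + S) / T"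
    using x0 w0 by simp
  also have "\<dots> \<le> (\<bar>\<rho>\<bar> + S) / (T - v)" using v S0 by simp
  finally have "\<bar>x v / (T - v) - z / T - w v / (T - v)\<bar> * (T - v) \<le> (\<bar>\<rho>\<bar> + S) / (T - v) * (T - v)"
    using v by (intro mult_right_mono) auto
  then have "\<bar>(x v / (T - v) - z / T - w v / (T - v)) * (T - v)\<bar> \<le> \<bar>\<rho>\<bar> + S"
    using v by (simp add: abs_mult)
  moreover have "(x v / (T - v) - z / T - w v / (T - v)) * (T - v) = x v - z * ((T - v) / T) - w v"
    using v by (simp add: left_diff_distrib)
  moreover have "\<bar>z * ((T - v) / T)\<bar> \<le> \<bar>z\<bar>"
    using mult_left_mono[of "(T - v) / T" 1 "\<bar>z\<bar>"] v by (simp add: abs_mult)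
  ultimately have "\<bar>x v - z * ((T - v) / T) - w v\<bar> \<le> \<bar>\<rho>\<bar> + S" "\<bar>z * ((T - v) / T)\<bar> \<le> \<bar>z\<bar>"
    by simp_all
  moreover have "\<bar>a\<bar> \<le> \<bar>a - q - c\<bar> + \<bar>q\<bar> + \<bar>c\<bar>" for a q c :: real by linarith
  ultimately have "\<bar>x v\<bar> \<le> (\<bar>\<rho>\<bar> + S) + \<bar>z\<bar> + S"
    using S[OF v] by (meson add_mono order_trans)
  then show ?thesis by simp
qed

text \<open>The constant \<open>K\<close> must not depend on the path, whence the explicit formula.\<close>

lemma scaled_step:
  assumes s: "0 \<le> s" "0 \<le> d" "s + d \<le> u" "u < T"
    and S: "\<And>y. s \<le> y \<Longrightarrow> y \<le> s + d \<Longrightarrow> \<bar>w y - w s\<bar> \<le> S"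
  defines "b \<equiv> 1 / (T - u)"
  defines "H \<equiv> 4 * \<rho>\<^sup>2"
  defines "K \<equiv> b\<^sup>2 + b\<^sup>2 * (H * (b + T * b\<^sup>2) + 1) + (b\<^sup>2 * (H * b\<^sup>2 * \<bar>\<rho>\<bar>) + 2 * \<bar>\<rho>\<bar> * b ^ 3)"
  shows "\<bar>x (s + d) / (T - (s + d)) - x s / (T - s) - (w (s + d) - w s) / (T - s) - h s / (T - s)\<^sup>2 * d\<bar>
           \<le> K * (d * S + d\<^sup>2)"
proof -
  have b0: "0 < b" using s by (simp add: b_def)
  have T0: "0 < T" using s by simp
  have ab: "1 / (T - y) \<le> b" "0 < 1 / (T - y)" if "y \<le> u" for y
    using that s by (auto simp: b_def intro!: divide_left_mono)
  have S0: "0 \<le> S" using S[of s] s by simp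
  have adiff: "1 / (T - y) - 1 / (T - s) \<le> b\<^sup>2 * (y - s)" "0 \<le> 1 / (T - y) - 1 / (T - s)"
    if "s \<le> y" "y \<le> s + d" for y
  proof -
    have "1 / (T - y) - 1 / (T - s) = (1 / (T - y)) * (1 / (T - s)) * (y - s)"
      using that s by (simp add: field_simps)
    moreover have "(1 / (T - y)) * (1 / (T - s)) \<le> b * b"
      using ab[of y] ab[of s] that s b0 by (intro mult_mono) auto
    moreover from this have "(1 / (T - y)) * (1 / (T - s)) * (y - s) \<le> b * b * (y - s)"
      by (rule mult_right_mono) (use that in simp)
    ultimately show "1 / (T - y) - 1 / (T - s) \<le> b\<^sup>2 * (y - s)"
      by (simp only: power2_eq_square)
    show "0 \<le> 1 / (T - y) - 1 / (T - s)" using that s by (simp add: frac_le)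
  qed
  have sq: "1 / (T - y)\<^sup>2 = (1 / (T - y))\<^sup>2" for y by (simp add: power_divide)
  have a2diff: "\<bar>1 / (T - y)\<^sup>2 - 1 / (T - s)\<^sup>2\<bar> \<le> 2 * b ^ 3 * d" if "s \<le> y" "y \<le> s + d" for y
  proof -
    let ?a = "1 / (T - y)" and ?c = "1 / (T - s)"
    have "?a\<^sup>2 - ?c\<^sup>2 = (?a - ?c) * (?a + ?c)" by (simp add: power2_eq_square algebra_simps)
    also have "\<bar>\<dots>\<bar> \<le> (b\<^sup>2 * d) * (2 * b)"
    proof -
      have "?a - ?c \<le> b\<^sup>2 * d" using adiff(1)[OF that] that
        by (smt (verit, best) mult_left_mono zero_le_power2)
      then show ?thesis using adiff(2)[OF that] ab[of y] ab[of s] that s b0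
        unfolding abs_mult by (intro mult_mono) auto
    qed
    finally show ?thesis unfolding sq by (simp add: power2_eq_square power3_eq_cube algebra_simps)
  qed
  have a2b: "1 / (T - y)\<^sup>2 \<le> b\<^sup>2" if "y \<le> u" for y
    unfolding sq using ab[OF that] by (intro power_mono) auto
  \<comment> \<open>A first, crude pass with centre 0: the scaled path moves by order
    \<open>S + d\<close> within the step. Through the Lipschitz bound of the weight this controls
    the variation of \<open>h\<close>.\<close>
  have xdiff: "\<bar>x y / (T - y) - x s / (T - s)\<bar> \<le> (b + T * b\<^sup>2) * S + d * (b\<^sup>2 * \<bar>\<rho>\<bar>)"
    if "s \<le> y" "y \<le> s + d" for y
  proof -
    have "\<bar>x y / (T - y) - x s / (T - s) - (w y - w s) / (T - y) - 0 * (y - s)\<bar>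
        \<le> b\<^sup>2 * (\<bar>\<rho>\<bar> + S) * y - b\<^sup>2 * (\<bar>\<rho>\<bar> + S) * s"
    proof (rule scaled_incr)
      show "((\<lambda>y. b\<^sup>2 * (\<bar>\<rho>\<bar> + S) * y) has_real_derivative b\<^sup>2 * (\<bar>\<rho>\<bar> + S)) (at v)" for v
        by (auto intro!: derivative_eq_intros)
      show "\<bar>(h v + w s - w v) / (T - v)\<^sup>2 - 0\<bar> \<le> b\<^sup>2 * (\<bar>\<rho>\<bar> + S)" if "s < v" "v < y" for v
      proof -
        have "\<bar>h v + w s - w v\<bar> \<le> \<bar>\<rho>\<bar> + S"
          using h_bound[of v] S[of v] that \<open>y \<le> s + d\<close> by linarith
        then have "\<bar>h v + w s - w v\<bar> * (1 / (T - v)\<^sup>2) \<le> (\<bar>\<rho>\<bar> + S) * b\<^sup>2"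
          using a2b[of v] that \<open>y \<le> s + d\<close> s S0 by (intro mult_mono) auto
        then show ?thesis by (simp add: algebra_simps)
      qed
    qed (use s that in \<open>auto intro!: continuous_intros\<close>)
    moreover have "\<bar>(w y - w s) / (T - y)\<bar> \<le> S * b"
    proof -
      have "\<bar>w y - w s\<bar> * (1 / (T - y)) \<le> S * b"
        using S[OF that] ab[of y] that s S0 by (intro mult_mono) auto
      then show ?thesis using that s by simp
    qed
    moreover have "b\<^sup>2 * (\<bar>\<rho>\<bar> + S) * y - b\<^sup>2 * (\<bar>\<rho>\<bar> + S) * s \<le> b\<^sup>2 * (\<bar>\<rho>\<bar> * d) + b\<^sup>2 * (S * T)"
    proof -
      have "b\<^sup>2 * (\<bar>\<rho>\<bar> + S) * y - b\<^sup>2 * (\<bar>\<rho>\<bar> + S) * s = b\<^sup>2 * (\<bar>\<rho>\<bar> * (y - s)) + b\<^sup>2 * (S * (y - s))"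
        by (simp add: algebra_simps)
      also have "\<dots> \<le> b\<^sup>2 * (\<bar>\<rho>\<bar> * d) + b\<^sup>2 * (S * T)"
        using that s S0 by (intro add_mono mult_left_mono) auto
      finally show ?thesis .
    qed
    ultimately have "\<bar>x y / (T - y) - x s / (T - s)\<bar> \<le> S * b + (b\<^sup>2 * (\<bar>\<rho>\<bar> * d) + b\<^sup>2 * (S * T))"
      by linarith
    then show ?thesis by (simp add: algebra_simps)
  qed
  have hdiff: "\<bar>h y - h s\<bar> \<le> H * ((b + T * b\<^sup>2) * S + d * (b\<^sup>2 * \<bar>\<rho>\<bar>))" if "s \<le> y" "y \<le> s + d" for y
  proof -
    have "\<bar>h y - h s\<bar> = 2 * \<bar>\<rho>\<bar> * \<bar>logit_weight \<rho> \<kappa> (x y / (T - y)) - logit_weight \<rho> \<kappa> (x s / (T - s))\<bar>"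
    proof -
      have "h y - h s = 2 * \<rho> * (logit_weight \<rho> \<kappa> (x y / (T - y)) - logit_weight \<rho> \<kappa> (x s / (T - s)))"
        by (simp add: algebra_simps)
      then show ?thesis by (simp add: abs_mult)
    qed
    also have "\<dots> \<le> 2 * \<bar>\<rho>\<bar> * (2 * \<bar>\<rho>\<bar> * \<bar>x y / (T - y) - x s / (T - s)\<bar>)"
      by (intro mult_left_mono logit_weight_lipschitz \<kappa>) auto
    also have "\<dots> = H * \<bar>x y / (T - y) - x s / (T - s)\<bar>"
      using abs_mult_self_eq[of \<rho>] by (simp add: H_def power2_eq_square)
    also have "\<dots> \<le> H * ((b + T * b\<^sup>2) * S + d * (b\<^sup>2 * \<bar>\<rho>\<bar>))"
      by (intro mult_left_mono xdiff that) (simp add: H_def)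
    finally show ?thesis .
  qed
  \<comment> \<open>Second pass, centred at the drift at time \<open>s\<close>. The first summand of
    \<open>E\<close> bounds the variation of \<open>h\<close> and of the noise, the second the
    variation of \<open>1 / (T - y)^2\<close>.\<close>
  define E where "E = b\<^sup>2 * (H * ((b + T * b\<^sup>2) * S + d * (b\<^sup>2 * \<bar>\<rho>\<bar>)) + S) + \<bar>\<rho>\<bar> * (2 * b ^ 3 * d)"
  have "\<bar>x (s + d) / (T - (s + d)) - x s / (T - s) - (w (s + d) - w s) / (T - (s + d)) - h s / (T - s)\<^sup>2 * (s + d - s)\<bar>
       \<le> E * (s + d) - E * s"
  proof (rule scaled_incr)
    show "((\<lambda>y. E * y) has_real_derivative E) (at v)" for v
      by (auto intro!: derivative_eq_intros)
    fix y assume y: "s < y" "y < s + d"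
    have "(h y + w s - w y) / (T - y)\<^sup>2 - h s / (T - s)\<^sup>2
        = (1 / (T - y)\<^sup>2) * ((h y - h s) - (w y - w s)) + h s * (1 / (T - y)\<^sup>2 - 1 / (T - s)\<^sup>2)"
      by (simp add: algebra_simps diff_divide_distrib add_divide_distrib)
    also have "\<bar>\<dots>\<bar> \<le> \<bar>(1 / (T - y)\<^sup>2) * ((h y - h s) - (w y - w s))\<bar> + \<bar>h s * (1 / (T - y)\<^sup>2 - 1 / (T - s)\<^sup>2)\<bar>"
      by (rule abs_triangle_ineq)
    also have "\<dots> \<le> E"
    proof -
      have "\<bar>(1 / (T - y)\<^sup>2) * ((h y - h s) - (w y - w s))\<bar>
          \<le> b\<^sup>2 * (H * ((b + T * b\<^sup>2) * S + d * (b\<^sup>2 * \<bar>\<rho>\<bar>)) + S)"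
        unfolding abs_mult[of "1 / (T - y)\<^sup>2"]
      proof (rule mult_mono)
        show "\<bar>1 / (T - y)\<^sup>2\<bar> \<le> b\<^sup>2" using a2b[of y] y s by simp
        show "\<bar>h y - h s - (w y - w s)\<bar> \<le> H * ((b + T * b\<^sup>2) * S + d * (b\<^sup>2 * \<bar>\<rho>\<bar>)) + S"
          by (rule order_trans[OF abs_triangle_ineq4 add_mono[OF hdiff S]]) (use y in auto)
      qed auto
      moreover have "\<bar>h s * (1 / (T - y)\<^sup>2 - 1 / (T - s)\<^sup>2)\<bar> \<le> \<bar>\<rho>\<bar> * (2 * b ^ 3 * d)"
        unfolding abs_mult[of "h s"] by (rule mult_mono[OF h_bound a2diff]) (use y in auto)
      ultimately show ?thesis unfolding E_def by (rule add_mono)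
    qed
    finally show "\<bar>(h y + w s - w y) / (T - y)\<^sup>2 - h s / (T - s)\<^sup>2\<bar> \<le> E" .
  qed (use s in \<open>auto intro!: continuous_intros\<close>)
  \<comment> \<open>Moves the noise coefficient from the right to the left end of the step, so that
    it becomes the square root of the coefficient \<open>1 / (T - s)^2\<close> of the drift.\<close>
  moreover have "\<bar>(w (s + d) - w s) / (T - (s + d)) - (w (s + d) - w s) / (T - s)\<bar> \<le> b\<^sup>2 * d * S"
  proof -
    have "(w (s + d) - w s) / (T - (s + d)) - (w (s + d) - w s) / (T - s)
       = (1 / (T - (s + d)) - 1 / (T - s)) * (w (s + d) - w s)" by (simp add: left_diff_distrib)
    also have "\<bar>\<dots>\<bar> \<le> b\<^sup>2 * d * S"
      unfolding abs_mult using adiff[of "s + d"] S[of "s + d"] s by (intro mult_mono) auto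
    finally show ?thesis .
  qed
  moreover have "h s / (T - s)\<^sup>2 * (s + d - s) = h s / (T - s)\<^sup>2 * d" "E * (s + d) - E * s = E * d"
    by (simp_all add: distrib_left)
  ultimately have "\<bar>x (s + d) / (T - (s + d)) - x s / (T - s) - (w (s + d) - w s) / (T - s) - h s / (T - s)\<^sup>2 * d\<bar>
      \<le> E * d + b\<^sup>2 * d * S"
    by linarith
  also have "\<dots> = (b\<^sup>2 + b\<^sup>2 * (H * (b + T * b\<^sup>2) + 1)) * (d * S) + (b\<^sup>2 * (H * b\<^sup>2 * \<bar>\<rho>\<bar>) + 2 * \<bar>\<rho>\<bar> * b ^ 3) * d\<^sup>2"
    by (simp add: E_def algebra_simps power2_eq_square power3_eq_cube)
  also have "\<dots> \<le> K * (d * S) + K * d\<^sup>2"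
  proof -
    have "0 \<le> b\<^sup>2 + b\<^sup>2 * (H * (b + T * b\<^sup>2) + 1)" "0 \<le> b\<^sup>2 * (H * b\<^sup>2 * \<bar>\<rho>\<bar>) + 2 * \<bar>\<rho>\<bar> * b ^ 3"
      using b0 T0 by (auto simp: H_def intro!: add_nonneg_nonneg mult_nonneg_nonneg)
    then have "b\<^sup>2 + b\<^sup>2 * (H * (b + T * b\<^sup>2) + 1) \<le> K" "b\<^sup>2 * (H * b\<^sup>2 * \<bar>\<rho>\<bar>) + 2 * \<bar>\<rho>\<bar> * b ^ 3 \<le> K"
      unfolding K_def by linarith+
    then show ?thesis using s S0 by (intro add_mono mult_right_mono) auto
  qed
  finally show ?thesis by (simp add: algebra_simps)
qed

end

subsection \<open>Characteristic functions under the change of measure\<close>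

text \<open>Here \<open>p\<close> is the noise, \<open>q\<close> the drift and \<open>r\<close> the
  error of one increment, of orders d^(1/2), d and d^(3/2). All terms in the bound are of order
  d^(3/2) or smaller. The increment is undone in the order \<open>r\<close>, \<open>q\<close>,
  \<open>p\<close>, so that only first order in \<open>q\<close> and second order in
  \<open>p\<close> survive.\<close>

lemma taylor_step:
  fixes \<phi> \<phi>' \<phi>'' \<phi>''' :: "real \<Rightarrow> 'b :: real_normed_vector"
  assumes d: "\<And>x. (\<phi> has_vector_derivative \<phi>' x) (at x)" "\<And>x. (\<phi>' has_vector_derivative \<phi>'' x) (at x)"
      "\<And>x. (\<phi>'' has_vector_derivative \<phi>''' x) (at x)"
    and B: "\<And>x. norm (\<phi>' x) \<le> B" "\<And>x. norm (\<phi>'' x) \<le> B" "\<And>x. norm (\<phi>''' x) \<le> B"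
  shows "norm (\<phi> (x + p + q + r) - \<phi> x - p *\<^sub>R \<phi>' x - (p\<^sup>2 / 2) *\<^sub>R \<phi>'' x - q *\<^sub>R \<phi>' x)
           \<le> B * (\<bar>r\<bar> + q\<^sup>2 + \<bar>q\<bar> * \<bar>p\<bar> + \<bar>p\<bar> ^ 3)"
proof -
  note t = taylor_bounds[OF d B]
  define e1 where "e1 = \<phi> (x + p + q + r) - \<phi> (x + p + q)"
  define e2 where "e2 = \<phi> (x + p + q) - \<phi> (x + p) - q *\<^sub>R \<phi>' (x + p)"
  define e3 where "e3 = q *\<^sub>R (\<phi>' (x + p) - \<phi>' x)"
  define e4 where "e4 = \<phi> (x + p) - \<phi> x - p *\<^sub>R \<phi>' x - (p\<^sup>2 / 2) *\<^sub>R \<phi>'' x"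
  have e: "\<phi> (x + p + q + r) - \<phi> x - p *\<^sub>R \<phi>' x - (p\<^sup>2 / 2) *\<^sub>R \<phi>'' x - q *\<^sub>R \<phi>' x
      = e1 + e2 + e3 + e4"
  proof -
    have "a1 - x0 - b0 - f - c = (a1 - a2) + (a2 - a3 - b) + (b - c) + (a3 - x0 - b0 - f)"
      for a1 a2 a3 b c x0 b0 f :: 'b by simp
    then show ?thesis unfolding e1_def e2_def e3_def e4_def scaleR_diff_right .
  qed
  have "norm e1 \<le> B * \<bar>r\<bar>" "norm e2 \<le> B * q\<^sup>2" "norm e4 \<le> B * \<bar>p\<bar> ^ 3"
    unfolding e1_def e2_def e4_def by (rule t)+
  moreover have "norm e3 \<le> B * (\<bar>q\<bar> * \<bar>p\<bar>)"
    using mult_left_mono[OF t(2)[of x p], of "\<bar>q\<bar>"] by (simp add: e3_def mult.left_commute)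
  moreover have "norm (e1 + e2 + e3 + e4) \<le> norm e1 + norm e2 + norm e3 + norm e4"
    by (intro norm_triangle_le add_mono order_refl)
  ultimately show ?thesis unfolding e distrib_left by linarith
qed

text \<open>The increments are controlled from their left end point only. Uniformity of the bound in
  that point yields Lipschitz continuity of \<open>e\<close>, then with continuity of
  \<open>c * e\<close> also the backward difference quotients; the integrating factor
  \<open>exp (- \<Psi> t)\<close> finishes.\<close>

lemma linear_ode_from_increments:
  fixes e c \<Psi> :: "real \<Rightarrow> complex"
  assumes su: "s < u" and C: "0 \<le> C"
    and incr: "\<And>t d. s \<le> t \<Longrightarrow> 0 < d \<Longrightarrow> t + d \<le> u \<Longrightarrow> norm (e (t + d) - e t - d *\<^sub>R (c t * e t)) \<le> C * (d * sqrt d)"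
    and c: "continuous_on {s..u} c" and cb: "\<And>t. t \<in> {s..u} \<Longrightarrow> norm (c t * e t) \<le> L"
    and \<Psi>: "\<And>t. t \<in> {s..u} \<Longrightarrow> (\<Psi> has_vector_derivative c t) (at t within {s..u})"
  shows "e u = exp (\<Psi> u - \<Psi> s) * e s"
proof -
  have lip1: "norm (e y - e x) \<le> (C * sqrt (u - s) + L) * (y - x)" if "x \<in> {s..u}" "y \<in> {s..u}" "x < y" for x y
  proof -
    define d where "d = y - x"
    have d: "0 < d" "d \<le> u - s" using that by (auto simp: d_def)
    have "norm (e y - e x) \<le> norm (e (x + d) - e x - d *\<^sub>R (c x * e x)) + norm (d *\<^sub>R (c x * e x))"
      using norm_triangle_ineq[of "e (x + d) - e x - d *\<^sub>R (c x * e x)" "d *\<^sub>R (c x * e x)"] by (simp add: d_def)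
    also have "\<dots> \<le> C * (d * sqrt d) + d * L"
      using incr[of x d] cb[OF that(1)] d that by (intro add_mono) (auto simp: d_def)
    also have "\<dots> \<le> C * (d * sqrt (u - s)) + d * L"
      using C d by (intro add_mono mult_left_mono) auto
    finally show ?thesis by (simp add: algebra_simps d_def)
  qed
  have e: "continuous_on {s..u} e"
  proof -
    have L: "0 \<le> L" using cb[of s] su norm_ge_zero by (meson atLeastAtMost_iff less_imp_le order_refl order_trans)
    have "(C * sqrt (u - s) + L)-lipschitz_on {s..u} e"
    proof (rule lipschitz_onI)
      show "dist (e x) (e y) \<le> (C * sqrt (u - s) + L) * dist x y" if "x \<in> {s..u}" "y \<in> {s..u}" for x y
        using lip1[of x y] lip1[of y x] that
        by (cases x y rule: linorder_cases) (auto simp: dist_norm norm_minus_commute)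
    qed (use C L su in auto)
    then show ?thesis by (rule lipschitz_on_continuous_on)
  qed
  have ce: "continuous_on {s..u} (\<lambda>t. c t * e t)" using c e by (intro continuous_intros)
  have der: "(e has_vector_derivative c t * e t) (at t within {s..u})" if t: "t \<in> {s..u}" for t
    unfolding has_vector_derivative_def has_derivative_iff_norm
  proof (rule conjI[OF bounded_linear_scaleR_left], rule tendsto_0_le[where K = 1])
    have "((\<lambda>y. c y * e y) \<longlongrightarrow> c t * e t) (at t within {s..u})"
      using ce t by (auto simp: continuous_on_def)
    from tendsto_norm[OF tendsto_diff[OF this tendsto_const[of "c t * e t"]]]
    have "((\<lambda>y. norm (c y * e y - c t * e t)) \<longlongrightarrow> 0) (at t within {s..u})" by simp
    moreover have "((\<lambda>y. C * sqrt \<bar>y - t\<bar>) \<longlongrightarrow> C * sqrt \<bar>t - t\<bar>) (at t within {s..u})"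
      by (intro tendsto_intros)
    ultimately show "((\<lambda>y. C * sqrt \<bar>y - t\<bar> + norm (c y * e y - c t * e t)) \<longlongrightarrow> 0) (at t within {s..u})"
      using tendsto_add by fastforce
    show "\<forall>\<^sub>F y in at t within {s..u}. norm (norm (e y - e t - (y - t) *\<^sub>R (c t * e t)) / norm (y - t))
          \<le> norm (C * sqrt \<bar>y - t\<bar> + norm (c y * e y - c t * e t)) * 1"
      unfolding eventually_at_filter
    proof (intro always_eventually allI impI)
      fix y assume y: "y \<noteq> t" "y \<in> {s..u}"
      define d where "d = \<bar>y - t\<bar>"
      have d: "0 < d" using y by (simp add: d_def)
      have "norm (e y - e t - (y - t) *\<^sub>R (c t * e t)) \<le> C * (d * sqrt d) + d * norm (c y * e y - c t * e t)"
      proof (cases "t < y")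
        case True
        then have "norm (e y - e t - (y - t) *\<^sub>R (c t * e t)) \<le> C * (d * sqrt d)"
          using incr[of t d] t y by (simp add: d_def)
        moreover have "0 \<le> d * norm (c y * e y - c t * e t)" using d by simp
        ultimately show ?thesis by linarith
      next
        case False
        then have "y < t" using y by simp
        \<comment> \<open>The backward increment is read as the forward one from \<open>y\<close>;
          the price is the exchange of \<open>c y * e y\<close> for
          \<open>c t * e t\<close>.\<close>
        then have "norm (e t - e y - d *\<^sub>R (c y * e y)) \<le> C * (d * sqrt d)"
          using incr[of y d] t y by (simp add: d_def)
        moreover have "e y - e t - (y - t) *\<^sub>R (c t * e t)
            = - (e t - e y - d *\<^sub>R (c y * e y)) - d *\<^sub>R (c y * e y - c t * e t)"
          using \<open>y < t\<close> by (simp add: d_def algebra_simps)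
        moreover have "norm (d *\<^sub>R (c y * e y - c t * e t)) = d * norm (c y * e y - c t * e t)"
          using d by simp
        ultimately show ?thesis
          using norm_triangle_ineq4[of "- (e t - e y - d *\<^sub>R (c y * e y))" "d *\<^sub>R (c y * e y - c t * e t)"]
          unfolding norm_minus_cancel by (simp only:)
      qed
      then have "norm (e y - e t - (y - t) *\<^sub>R (c t * e t)) / d \<le> (C * (d * sqrt d) + d * norm (c y * e y - c t * e t)) / d"
        using d by (intro divide_right_mono) auto
      also have "\<dots> = C * sqrt d + norm (c y * e y - c t * e t)"
        using d by (simp add: field_simps)
      finally show "norm (norm (e y - e t - (y - t) *\<^sub>R (c t * e t)) / norm (y - t))
          \<le> norm (C * sqrt \<bar>y - t\<bar> + norm (c y * e y - c t * e t)) * 1"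
        using C by (simp add: d_def)
    qed
  qed
  have "((\<lambda>t. exp (- \<Psi> t) * e t) has_vector_derivative 0) (at t within {s..u})" if t: "t \<in> {s..u}" for t
  proof -
    have "((\<lambda>t. - \<Psi> t) has_vector_derivative - c t) (at t within {s..u})"
      using \<Psi>[OF t] by (rule has_vector_derivative_minus)
    from field_vector_diff_chain_within[OF this, of exp "exp (- \<Psi> t)"]
    have "((\<lambda>t. exp (- \<Psi> t)) has_vector_derivative - c t * exp (- \<Psi> t)) (at t within {s..u})"
      by (simp add: comp_def DERIV_exp has_field_derivative_at_within)
    from has_vector_derivative_mult[OF this der[OF t]]
    show ?thesis by (simp add: algebra_simps)
  qed
  then obtain k where "\<And>t. t \<in> {s..u} \<Longrightarrow> exp (- \<Psi> t) * e t = k"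
    by (rule has_vector_derivative_zero_constant[OF convex_real_interval(5)]) blast+
  then have "exp (- \<Psi> u) * e u = exp (- \<Psi> s) * e s" using su by simp
  then have "exp (\<Psi> u) * (exp (- \<Psi> u) * e u) = exp (\<Psi> u) * (exp (- \<Psi> s) * e s)" by simp
  then show ?thesis by (simp add: exp_diff exp_minus field_simps)
qed

text \<open>\<open>\<kappa>\<close> stands for the odds \<open>(1 - p) / p\<close> against the pinning point \<open>\<rho>\<close>, so that \<open>\<kappa> = 0\<close> is the
  bridge with known pinning point.\<close>

locale drift_bridge = bm_space M F T W for M :: "'a measure" and F T W +
  fixes Z :: "real \<Rightarrow> 'a \<Rightarrow> real" and \<rho> \<kappa> z :: real
  assumes T_pos: "0 < T" and \<kappa>: "0 \<le> \<kappa>"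
    and Z_adapted: "\<And>s. 0 \<le> s \<Longrightarrow> s < T \<Longrightarrow> Z s \<in> borel_measurable (F s)"
    and Z_cont: "\<And>\<omega>. \<omega> \<in> space M \<Longrightarrow> continuous_on {0..<T} (\<lambda>s. Z s \<omega>)"
    and Z_sde: "AE \<omega> in M. \<forall>s\<in>{0..<T}. Z s \<omega> = z + integral {0..s}
          (\<lambda>v. (\<rho> * (2 * logit_weight \<rho> \<kappa> (Z v \<omega> / (T - v)) - 1) - Z v \<omega>) / (T - v)) + W s \<omega>"
begin

text \<open>Dividing by the remaining time turns the unbounded drift of the bridge into a bounded one, and
  makes the posterior weight a function of the state alone.\<close>

definition X :: "real \<Rightarrow> 'a \<Rightarrow> real" where "X s \<omega> = Z s \<omega> / (T - s)"

abbreviation wt :: "real \<Rightarrow> 'a \<Rightarrow> real" where "wt s \<omega> \<equiv> logit_weight \<rho> \<kappa> (X s \<omega>)"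

lemma Z_measurable: "0 \<le> s \<Longrightarrow> s < T \<Longrightarrow> Z s \<in> borel_measurable M"
  by (rule F_measurable[OF Z_adapted])

lemma X_adapted: "0 \<le> s \<Longrightarrow> s < T \<Longrightarrow> X s \<in> borel_measurable (F s)"
  unfolding X_def[abs_def] using Z_adapted by measurable

lemma X_measurable: "0 \<le> s \<Longrightarrow> s < T \<Longrightarrow> X s \<in> borel_measurable M"
  by (rule F_measurable[OF X_adapted])

lemma AE_path: "AE \<omega> in M. bridge_path \<rho> \<kappa> T z (\<lambda>s. W s \<omega>) (\<lambda>s. Z s \<omega>)"
  using W_cont Z_sde AE_space
proof eventually_elim
  case (elim \<omega>)
  then show ?case using \<kappa> Z_cont by unfold_locales auto
qed

lemma wt_bounds: "0 < wt s \<omega>" "wt s \<omega> \<le> 1" "\<bar>wt s \<omega>\<bar> \<le> 1"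
  using logit_weight_bounds[OF \<kappa>, of \<rho> "X s \<omega>"] by auto

lemma wt_measurable: "0 \<le> s \<Longrightarrow> s < T \<Longrightarrow> wt s \<in> borel_measurable M"
  using X_measurable by measurable

text \<open>Girsanov's theorem in disguise: under the change of measure with density
  \<open>wt u / wt 0\<close>, the process \<open>X\<close> has independent Gaussian increments.  The proof shows that
  \<open>s \<mapsto> E [Y \<phi> (X s)]\<close> solves a linear differential equation.\<close>

lemma weighted_characteristic:
  fixes Y :: "'a \<Rightarrow> complex"
  assumes su: "0 \<le> s" "s < u" "u < T"
    and Y: "Y \<in> borel_measurable (F s)" "\<And>\<omega>. norm (Y \<omega>) \<le> 1"
  shows "(\<integral>\<omega>. Y \<omega> * (of_real (wt u \<omega>) * exp (\<i> * of_real (\<theta> * X u \<omega>))) \<partial>M)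
       = exp ((\<i> * of_real (\<theta> * \<rho>) - of_real (\<theta>\<^sup>2 / 2)) * of_real (1 / (T - u) - 1 / (T - s)))
         * (\<integral>\<omega>. Y \<omega> * (of_real (wt s \<omega>) * exp (\<i> * of_real (\<theta> * X s \<omega>))) \<partial>M)"
proof -
  define \<nu> where "\<nu> = \<i> * complex_of_real (\<theta> * \<rho>) - of_real (\<theta>\<^sup>2 / 2)"
  define \<phi> where "\<phi> x = complex_of_real (logit_weight \<rho> \<kappa> x) * exp (\<i> * of_real (\<theta> * x))" for x
  obtain \<phi>' \<phi>'' \<phi>''' :: "real \<Rightarrow> complex" and B where
      d: "\<And>x. (\<phi> has_vector_derivative \<phi>' x) (at x)" "\<And>x. (\<phi>' has_vector_derivative \<phi>'' x) (at x)"
      "\<And>x. (\<phi>'' has_vector_derivative \<phi>''' x) (at x)"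
      and B: "\<And>x. norm (\<phi>' x) \<le> B" "\<And>x. norm (\<phi>'' x) \<le> B" "\<And>x. norm (\<phi>''' x) \<le> B"
      and eig: "\<And>x. of_real (\<rho> * (2 * logit_weight \<rho> \<kappa> x - 1)) * \<phi>' x + \<phi>'' x / 2 = \<nu> * \<phi> x"
      and m: "\<phi>' \<in> borel_measurable borel" "\<phi>'' \<in> borel_measurable borel"
    unfolding \<nu>_def by (rule logit_weight_eigenfunction[OF \<kappa> \<phi>_def]) blast
  have B0: "0 \<le> B" using B(1)[of 0] norm_ge_zero order_trans by blast
  have \<phi>m: "\<phi> \<in> borel_measurable borel"
    by (intro borel_measurable_continuous_onI continuous_at_imp_continuous_on ballI
        has_vector_derivative_continuous[OF d(1)])
  have \<phi>b: "norm (\<phi> x) \<le> 1" for x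
    using logit_weight_bounds[OF \<kappa>, of \<rho> x] by (simp add: \<phi>_def norm_mult)
  define e where "e t = (\<integral>\<omega>. Y \<omega> * \<phi> (X t \<omega>) \<partial>M)" for t
  define c where "c t = \<nu> * of_real (1 / (T - t)\<^sup>2)" for t
  define b where "b = 1 / (T - u)"
  \<comment> \<open>The constant of \<open>scaled_step\<close> for the final time \<open>u\<close>:
    one value for all paths and all steps inside \<open>{s..u}\<close>.\<close>
  define K where "K = b\<^sup>2 + b\<^sup>2 * ((4 * \<rho>\<^sup>2) * (b + T * b\<^sup>2) + 1) + (b\<^sup>2 * ((4 * \<rho>\<^sup>2) * b\<^sup>2 * \<bar>\<rho>\<bar>) + 2 * \<bar>\<rho>\<bar> * b ^ 3)"
  \<comment> \<open>The 5 is that of \<open>W_sup_dominated\<close>, the 2 that of the third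
    absolute moment, and \<open>sqrt T\<close> comes from
    \<open>\<delta>^2 \<le> sqrt T * (\<delta> * sqrt \<delta>)\<close>.\<close>
  define C where "C = B * (K * (5 + sqrt T) + (b\<^sup>2 * \<bar>\<rho>\<bar>)\<^sup>2 * sqrt T + b ^ 3 * \<bar>\<rho>\<bar> + 2 * b ^ 3)"
  have b0: "0 < b" using su by (simp add: b_def)
  have K0: "0 \<le> K" unfolding K_def using b0 T_pos
    by (intro add_nonneg_nonneg mult_nonneg_nonneg zero_le_power zero_le_power2 abs_ge_zero) auto
  have C0: "0 \<le> C" unfolding C_def using B0 K0 b0 T_pos
    by (intro add_nonneg_nonneg mult_nonneg_nonneg zero_le_power zero_le_power2) auto
  have ab: "1 / (T - t) \<le> b" "0 \<le> 1 / (T - t)" if "t \<le> u" for t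
    using that su by (auto simp: b_def intro!: divide_left_mono)
  have sq: "1 / (T - t)\<^sup>2 = (1 / (T - t))\<^sup>2" for t by (simp add: power_divide)
  have a2b: "1 / (T - t)\<^sup>2 \<le> b\<^sup>2" if "t \<le> u" for t
    unfolding sq using ab[OF that] by (intro power_mono) auto
  have adapted: "(\<lambda>\<omega>. Y \<omega> * f (X t \<omega>)) \<in> borel_measurable (F t)"
    if "f \<in> borel_measurable borel" "s \<le> t" "t < T" for t and f :: "real \<Rightarrow> complex"
    using F_measurable_mono[OF Y(1) that(2)] measurable_compose[OF X_adapted that(1), of t] that su
    by (intro borel_measurable_times) auto
  have int: "integrable M (\<lambda>\<omega>. Y \<omega> * f (X t \<omega>))"
    if "f \<in> borel_measurable borel" "s \<le> t" "t < T" "\<And>x. norm (f x) \<le> D" for t D and f :: "real \<Rightarrow> complex"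
  proof (rule integrable_const_bound[of _ D])
    show "AE \<omega> in M. norm (Y \<omega> * f (X t \<omega>)) \<le> D"
      using mult_mono[OF Y(2) that(4)] by (auto simp: norm_mult)
    show "(\<lambda>\<omega>. Y \<omega> * f (X t \<omega>)) \<in> borel_measurable M"
      using F_measurable[OF adapted] that by blast
  qed
  define h where "h x = \<rho> * (2 * logit_weight \<rho> \<kappa> x - 1)" for x
  have hb: "\<bar>h x\<bar> \<le> \<bar>\<rho>\<bar>" for x
  proof -
    have "\<bar>2 * logit_weight \<rho> \<kappa> x - 1\<bar> \<le> 1"
      using logit_weight_bounds[OF \<kappa>, of \<rho> x] by auto
    then show ?thesis using mult_left_mono[of _ 1 "\<bar>\<rho>\<bar>"] by (simp add: abs_mult h_def)
  qed
  have hm: "h \<in> borel_measurable borel" unfolding h_def by measurable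
  have incr: "norm (e (t + \<delta>) - e t - \<delta> *\<^sub>R (c t * e t)) \<le> C * (\<delta> * sqrt \<delta>)"
    if t: "s \<le> t" "0 < \<delta>" "t + \<delta> \<le> u" for t \<delta>
  proof -
    have t': "0 \<le> t" "t < t + \<delta>" "t + \<delta> < T" "t < T" "s \<le> t + \<delta>" using t su by auto
    obtain D where D: "D \<in> borel_measurable M" "integrable M D" "(\<integral>\<omega>. D \<omega> \<partial>M) \<le> 5 * sqrt \<delta>"
      "AE \<omega> in M. 0 \<le> D \<omega> \<and> (\<forall>v. t \<le> v \<and> v \<le> t + \<delta> \<and> v < T \<longrightarrow> \<bar>W v \<omega> - W t \<omega>\<bar> \<le> D \<omega>)"
      using W_sup_dominated[of t "t + \<delta>"] t' by (auto simp: less_imp_le)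
    define \<xi> where "\<xi> \<omega> = W (t + \<delta>) \<omega> - W t \<omega>" for \<omega>
    define a where "a = 1 / (T - t)"
    have a: "0 \<le> a" "a \<le> b" using ab[of t] t by (auto simp: a_def)
    \<comment> \<open>The remainder of \<open>taylor_step\<close> with noise part
      \<open>a * \<xi>\<close> and with the drift frozen at time \<open>t\<close>; every coefficient
      is then known at time \<open>t\<close> and independent of \<open>\<xi>\<close>.\<close>
    define err where "err \<omega> = \<phi> (X (t + \<delta>) \<omega>) - \<phi> (X t \<omega>) - (a * \<xi> \<omega>) *\<^sub>R \<phi>' (X t \<omega>)
        - ((a * \<xi> \<omega>)\<^sup>2 / 2) *\<^sub>R \<phi>'' (X t \<omega>) - (a\<^sup>2 * h (X t \<omega>) * \<delta>) *\<^sub>R \<phi>' (X t \<omega>)" for \<omega>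
    define bd where "bd \<omega> = B * (K * (\<delta> * D \<omega> + \<delta>\<^sup>2) + (b\<^sup>2 * \<bar>\<rho>\<bar>)\<^sup>2 * \<delta>\<^sup>2 + b ^ 3 * \<bar>\<rho>\<bar> * \<delta> * \<bar>\<xi> \<omega>\<bar> + b ^ 3 * \<bar>\<xi> \<omega>\<bar> ^ 3)" for \<omega>
    have errb: "AE \<omega> in M. norm (Y \<omega> * err \<omega>) \<le> bd \<omega>"
      using D(4) AE_path
    proof eventually_elim
      case (elim \<omega>)
      interpret bridge_path \<rho> \<kappa> T z "\<lambda>s. W s \<omega>" "\<lambda>s. Z s \<omega>" by (rule elim(2))
      let ?r = "X (t + \<delta>) \<omega> - X t \<omega> - a * \<xi> \<omega> - a\<^sup>2 * h (X t \<omega>) * \<delta>"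
      have r: "\<bar>?r\<bar> \<le> K * (\<delta> * D \<omega> + \<delta>\<^sup>2)"
        using scaled_step[of t \<delta> u "D \<omega>"] t t' su elim(1)
        by (auto simp: X_def a_def \<xi>_def h_def K_def b_def power_divide)
      have "norm (err \<omega>) \<le> B * (\<bar>?r\<bar> + (a\<^sup>2 * h (X t \<omega>) * \<delta>)\<^sup>2 + \<bar>a\<^sup>2 * h (X t \<omega>) * \<delta>\<bar> * \<bar>a * \<xi> \<omega>\<bar> + \<bar>a * \<xi> \<omega>\<bar> ^ 3)"
        using taylor_step[OF d B, of "X t \<omega>" "a * \<xi> \<omega>" "a\<^sup>2 * h (X t \<omega>) * \<delta>" ?r] by (simp add: err_def)
      also have "\<dots> \<le> bd \<omega>" unfolding bd_def
      proof (intro mult_left_mono add_mono r B0)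
        have "\<bar>a\<^sup>2 * h (X t \<omega>) * \<delta>\<bar> \<le> b\<^sup>2 * \<bar>\<rho>\<bar> * \<delta>"
          unfolding abs_mult using a b0 hb t by (intro mult_mono power_mono) (auto intro: power_mono)
        note * = this
        from power_mono[OF *, of 2] show "(a\<^sup>2 * h (X t \<omega>) * \<delta>)\<^sup>2 \<le> (b\<^sup>2 * \<bar>\<rho>\<bar>)\<^sup>2 * \<delta>\<^sup>2"
          by (simp add: power_mult_distrib)
        have **: "\<bar>a * \<xi> \<omega>\<bar> \<le> b * \<bar>\<xi> \<omega>\<bar>" using a by (simp add: abs_mult mult_right_mono)
        from power_mono[OF **, of 3] show "\<bar>a * \<xi> \<omega>\<bar> ^ 3 \<le> b ^ 3 * \<bar>\<xi> \<omega>\<bar> ^ 3"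
          by (simp add: power_mult_distrib)
        have "\<bar>a\<^sup>2 * h (X t \<omega>) * \<delta>\<bar> * \<bar>a * \<xi> \<omega>\<bar> \<le> (b\<^sup>2 * \<bar>\<rho>\<bar> * \<delta>) * (b * \<bar>\<xi> \<omega>\<bar>)"
          using t b0 by (intro mult_mono * **) auto
        then show "\<bar>a\<^sup>2 * h (X t \<omega>) * \<delta>\<bar> * \<bar>a * \<xi> \<omega>\<bar> \<le> b ^ 3 * \<bar>\<rho>\<bar> * \<delta> * \<bar>\<xi> \<omega>\<bar>"
          by (simp add: power2_eq_square power3_eq_cube ac_simps)
      qed
      finally have "norm (err \<omega>) \<le> bd \<omega>" .
      then show ?case using mult_mono[OF Y(2)[of \<omega>], of "norm (err \<omega>)" "bd \<omega>"] norm_ge_zero[of "err \<omega>"]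
        by (simp add: norm_mult)
    qed
    have \<xi>int: "integrable M (\<lambda>\<omega>. \<bar>\<xi> \<omega>\<bar>)" "integrable M (\<lambda>\<omega>. \<bar>\<xi> \<omega>\<bar> ^ 3)"
      using W_incr_abs_integrable[OF t'(1-3), of 1] W_incr_abs_integrable[OF t'(1-3), of 3] by (auto simp: \<xi>_def)
    have bdint: "integrable M bd"
      unfolding bd_def using D(2) \<xi>int
      by (intro integrable_mult_right Bochner_Integration.integrable_add integrable_const) auto
    have "(\<integral>\<omega>. bd \<omega> \<partial>M) = B * (K * (\<delta> * (\<integral>\<omega>. D \<omega> \<partial>M) + \<delta>\<^sup>2) + (b\<^sup>2 * \<bar>\<rho>\<bar>)\<^sup>2 * \<delta>\<^sup>2
        + b ^ 3 * \<bar>\<rho>\<bar> * \<delta> * (\<integral>\<omega>. \<bar>\<xi> \<omega>\<bar> \<partial>M) + b ^ 3 * (\<integral>\<omega>. \<bar>\<xi> \<omega>\<bar> ^ 3 \<partial>M))"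
      unfolding bd_def using D(2) \<xi>int by (simp add: prob_space)
    also have "\<dots> \<le> B * (K * (\<delta> * (5 * sqrt \<delta>) + sqrt T * (\<delta> * sqrt \<delta>)) + (b\<^sup>2 * \<bar>\<rho>\<bar>)\<^sup>2 * (sqrt T * (\<delta> * sqrt \<delta>))
        + b ^ 3 * \<bar>\<rho>\<bar> * \<delta> * sqrt \<delta> + b ^ 3 * (2 * \<delta> * sqrt \<delta>))"
    proof -
      have "\<delta>\<^sup>2 = sqrt \<delta> * (\<delta> * sqrt \<delta>)" using t by (simp add: power2_eq_square)
      also have "\<dots> \<le> sqrt T * (\<delta> * sqrt \<delta>)" using t t' by (intro mult_right_mono) auto
      finally have "\<delta>\<^sup>2 \<le> sqrt T * (\<delta> * sqrt \<delta>)" .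
      then show ?thesis
        using D(3) B0 K0 b0 t W_incr_abs[OF t'(1-3)] W_incr_cube[OF t'(1-3)] unfolding \<xi>_def
        by (intro mult_left_mono add_mono) auto
    qed
    also have "\<dots> = C * (\<delta> * sqrt \<delta>)" by (simp add: C_def algebra_simps)
    finally have bdle: "(\<integral>\<omega>. bd \<omega> \<partial>M) \<le> C * (\<delta> * sqrt \<delta>)" .
    have eq: "Y \<omega> * err \<omega> = Y \<omega> * \<phi> (X (t + \<delta>) \<omega>) - Y \<omega> * \<phi> (X t \<omega>) - of_real a * (Y \<omega> * \<phi>' (X t \<omega>) * of_real (\<xi> \<omega> ^ 1))
        - of_real (a\<^sup>2 / 2) * (Y \<omega> * \<phi>'' (X t \<omega>) * of_real (\<xi> \<omega> ^ 2)) - of_real (a\<^sup>2 * \<delta>) * (Y \<omega> * (of_real (h (X t \<omega>)) * \<phi>' (X t \<omega>)))" for \<omega>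
      by (simp add: err_def scaleR_conv_of_real power_mult_distrib algebra_simps)
    have hp: "(\<lambda>x. complex_of_real (h x) * \<phi>' x) \<in> borel_measurable borel"
      using hm m by measurable
    have hpb: "norm (complex_of_real (h x) * \<phi>' x) \<le> \<bar>\<rho>\<bar> * B" for x
      using mult_mono[OF hb B(1)] by (simp add: norm_mult)
    note ints = int[OF \<phi>m t'(5,3) \<phi>b] int[OF \<phi>m t(1) t'(4) \<phi>b] int[OF m(1) t(1) t'(4) B(1)]
      int[OF m(2) t(1) t'(4) B(2)] int[OF hp t(1) t'(4) hpb]
    note wints = W_incr_mult_integrable[OF t'(1-3) adapted[OF m(1) t(1) t'(4)] ints(3), of 1]
      W_incr_mult_integrable[OF t'(1-3) adapted[OF m(2) t(1) t'(4)] ints(4), of 2]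
    note wvals = W_incr_mult_integral[OF t'(1-3) adapted[OF m(1) t(1) t'(4)] ints(3), of 1]
      W_incr_mult_integral[OF t'(1-3) adapted[OF m(2) t(1) t'(4)] ints(4), of 2]
    have "(\<integral>\<omega>. Y \<omega> * err \<omega> \<partial>M) = e (t + \<delta>) - e t - of_real a * (\<integral>\<omega>. Y \<omega> * \<phi>' (X t \<omega>) * of_real (\<xi> \<omega> ^ 1) \<partial>M)
        - of_real (a\<^sup>2 / 2) * (\<integral>\<omega>. Y \<omega> * \<phi>'' (X t \<omega>) * of_real (\<xi> \<omega> ^ 2) \<partial>M)
        - of_real (a\<^sup>2 * \<delta>) * (\<integral>\<omega>. Y \<omega> * (of_real (h (X t \<omega>)) * \<phi>' (X t \<omega>)) \<partial>M)"
      unfolding eq e_def \<xi>_def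
      by (intro Bochner_Integration.integral_diff[THEN trans] arg_cong2[where f = minus] integral_mult_right_zero refl
          Bochner_Integration.integrable_diff integrable_mult_right ints wints)
    \<comment> \<open>The linear noise term has mean zero and the squared one contributes
      \<open>\<delta>\<close>, so half a second derivative joins the drift term. Together they form
      the generator applied to \<open>\<phi>\<close>, which the eigenfunction identity replaces by
      \<open>\<nu> * \<phi>\<close>.\<close>
    also have "(\<integral>\<omega>. Y \<omega> * \<phi>' (X t \<omega>) * of_real (\<xi> \<omega> ^ 1) \<partial>M) = 0"
      unfolding \<xi>_def wvals using W_incr_mean[OF t'(1-3)] by simp
    also have "(\<integral>\<omega>. Y \<omega> * \<phi>'' (X t \<omega>) * of_real (\<xi> \<omega> ^ 2) \<partial>M) = of_real \<delta> * (\<integral>\<omega>. Y \<omega> * \<phi>'' (X t \<omega>) \<partial>M)"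
      unfolding \<xi>_def wvals using W_incr_square[OF t'(1-3)] by simp
    also have "e (t + \<delta>) - e t - of_real a * 0 - of_real (a\<^sup>2 / 2) * (of_real \<delta> * (\<integral>\<omega>. Y \<omega> * \<phi>'' (X t \<omega>) \<partial>M))
          - of_real (a\<^sup>2 * \<delta>) * (\<integral>\<omega>. Y \<omega> * (of_real (h (X t \<omega>)) * \<phi>' (X t \<omega>)) \<partial>M)
        = e (t + \<delta>) - e t - of_real (a\<^sup>2 * \<delta>) * ((\<integral>\<omega>. Y \<omega> * (of_real (h (X t \<omega>)) * \<phi>' (X t \<omega>)) \<partial>M) + (\<integral>\<omega>. Y \<omega> * \<phi>'' (X t \<omega>) \<partial>M) / 2)"
      by (simp add: algebra_simps)
    also have "(\<integral>\<omega>. Y \<omega> * (of_real (h (X t \<omega>)) * \<phi>' (X t \<omega>)) \<partial>M) + (\<integral>\<omega>. Y \<omega> * \<phi>'' (X t \<omega>) \<partial>M) / 2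
        = (\<integral>\<omega>. Y \<omega> * (of_real (h (X t \<omega>)) * \<phi>' (X t \<omega>)) + Y \<omega> * \<phi>'' (X t \<omega>) / 2 \<partial>M)"
      using ints by (subst Bochner_Integration.integral_add) auto
    also have "(\<lambda>\<omega>. Y \<omega> * (of_real (h (X t \<omega>)) * \<phi>' (X t \<omega>)) + Y \<omega> * \<phi>'' (X t \<omega>) / 2) = (\<lambda>\<omega>. \<nu> * (Y \<omega> * \<phi> (X t \<omega>)))"
    proof
      fix \<omega>
      have "Y \<omega> * (of_real (h (X t \<omega>)) * \<phi>' (X t \<omega>)) + Y \<omega> * \<phi>'' (X t \<omega>) / 2
          = Y \<omega> * (of_real (\<rho> * (2 * wt t \<omega> - 1)) * \<phi>' (X t \<omega>) + \<phi>'' (X t \<omega>) / 2)"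
        by (simp add: h_def distrib_left)
      then show "Y \<omega> * (of_real (h (X t \<omega>)) * \<phi>' (X t \<omega>)) + Y \<omega> * \<phi>'' (X t \<omega>) / 2 = \<nu> * (Y \<omega> * \<phi> (X t \<omega>))"
        unfolding eig by simp
    qed
    also have "(\<integral>\<omega>. \<nu> * (Y \<omega> * \<phi> (X t \<omega>)) \<partial>M) = \<nu> * e t" by (simp add: e_def)
    also have "e (t + \<delta>) - e t - of_real (a\<^sup>2 * \<delta>) * (\<nu> * e t) = e (t + \<delta>) - e t - \<delta> *\<^sub>R (c t * e t)"
      by (simp add: c_def a_def scaleR_conv_of_real power_divide)
    finally have "norm (e (t + \<delta>) - e t - \<delta> *\<^sub>R (c t * e t)) = norm (\<integral>\<omega>. Y \<omega> * err \<omega> \<partial>M)" by simp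
    also have "\<dots> \<le> (\<integral>\<omega>. norm (Y \<omega> * err \<omega>) \<partial>M)" by (rule integral_norm_bound)
    also have "\<dots> \<le> (\<integral>\<omega>. bd \<omega> \<partial>M)"
    proof (rule integral_mono_AE[OF integrable_norm bdint errb])
      show "integrable M (\<lambda>\<omega>. Y \<omega> * err \<omega>)"
        unfolding eq \<xi>_def by (intro Bochner_Integration.integrable_diff integrable_mult_right ints wints)
    qed
    also note bdle
    finally show ?thesis .
  qed
  \<comment> \<open>The antiderivative of \<open>c\<close> is \<open>\<nu> / (T - t)\<close>: the
    scaled process runs on the clock \<open>1 / (T - t)\<close>, whose increments are the variances
    below.\<close>
  have "e u = exp (\<nu> * of_real (1 / (T - u)) - \<nu> * of_real (1 / (T - s))) * e s"
  proof (rule linear_ode_from_increments[OF su(2) C0 incr])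
    show "continuous_on {s..u} c" unfolding c_def using su by (intro continuous_intros) auto
    show "norm (c t * e t) \<le> norm \<nu> * b\<^sup>2 * 1" if "t \<in> {s..u}" for t
    proof -
      have "norm (e t) \<le> (\<integral>\<omega>. 1 \<partial>M)"
        unfolding e_def
      proof (rule order_trans[OF integral_norm_bound], rule integral_mono)
        show "integrable M (\<lambda>\<omega>. norm (Y \<omega> * \<phi> (X t \<omega>)))"
          by (intro integrable_norm int[OF \<phi>m _ _ \<phi>b]) (use that su in auto)
        show "norm (Y \<omega> * \<phi> (X t \<omega>)) \<le> 1" for \<omega>
          using mult_mono[OF Y(2) \<phi>b] by (simp add: norm_mult)
      qed simp
      moreover have "norm (c t) \<le> norm \<nu> * b\<^sup>2"
        unfolding c_def norm_mult norm_of_real using a2b[of t] that by (intro mult_left_mono) auto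
      ultimately show ?thesis unfolding norm_mult[of "c t"]
        by (intro mult_mono) (auto simp: prob_space)
    qed
    show "((\<lambda>t. \<nu> * of_real (1 / (T - t))) has_vector_derivative c t) (at t within {s..u})" if "t \<in> {s..u}" for t
    proof -
      have "((\<lambda>t. 1 / (T - t)) has_real_derivative 1 / (T - t)\<^sup>2) (at t within {s..u})"
        using that su by (auto intro!: derivative_eq_intros simp: power2_eq_square)
      then show ?thesis unfolding c_def
        by (intro has_vector_derivative_mult_right has_vector_derivative_of_real)
          (simp add: has_real_derivative_iff_has_vector_derivative)
    qed
  qed
  then show ?thesis
    by (simp add: e_def \<phi>_def \<nu>_def algebra_simps)
qed

end

subsection \<open>Uniqueness of the tilted law\<close>

text \<open>The normal law with mean \<open>m\<close> and variance \<open>v\<close>, as an image of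
  the standard one, so that identifying it takes only the characteristic function of the standard
  normal law.\<close>

definition gauss :: "real \<Rightarrow> real \<Rightarrow> real measure" where
  "gauss m v = distr std_normal_distribution borel (\<lambda>y. m + sqrt v * y)"

lemma sets_gauss [measurable_cong, simp]: "sets (gauss m v) = sets borel"
  by (simp add: gauss_def)

lemma prob_space_gauss: "prob_space (gauss m v)"
proof -
  interpret prob_space std_normal_distribution by (rule prob_space_normal_density) simp
  show ?thesis unfolding gauss_def by (rule prob_space_distr) simp
qed

lemma gauss_abs_moment:
  assumes "0 \<le> v"
  shows "integrable (gauss m v) (\<lambda>x. \<bar>x - m\<bar>)" "(\<integral>x. \<bar>x - m\<bar> \<partial>gauss m v) \<le> sqrt v"
proof -
  have i: "integrable lborel (\<lambda>x. std_normal_density x * \<bar>x\<bar>)"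
    using integrable_std_normal_moment_abs[of 1] by simp
  have i': "integrable std_normal_distribution (\<lambda>x. \<bar>x\<bar>)"
    using i by (subst integrable_density) auto
  have pi1: "sqrt (2 / pi) \<le> 1" using pi_gt3 by (simp add: field_simps)
  have v: "(\<integral>x. \<bar>x\<bar> \<partial>std_normal_distribution) = sqrt (2 / pi)"
    using integral_std_normal_moment_abs_odd[of 0] by (subst integral_density) auto
  show "integrable (gauss m v) (\<lambda>x. \<bar>x - m\<bar>)"
    unfolding gauss_def by (subst integrable_distr_eq) (use i' in \<open>auto simp: abs_mult\<close>)
  have "(\<integral>x. \<bar>x - m\<bar> \<partial>gauss m v) = (\<integral>x. sqrt v * \<bar>x\<bar> \<partial>std_normal_distribution)"
    unfolding gauss_def by (subst integral_distr) (use assms in \<open>auto simp: abs_mult\<close>)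
  also have "\<dots> = sqrt v * sqrt (2 / pi)" using v by simp
  also have "\<dots> \<le> sqrt v * 1" by (intro mult_left_mono pi1) (use assms in simp)
  finally show "(\<integral>x. \<bar>x - m\<bar> \<partial>gauss m v) \<le> sqrt v" by simp
qed

section \<open>The tilted measures and their Gaussian increments\<close>

context drift_bridge
begin

definition wt0 :: real where "wt0 = logit_weight \<rho> \<kappa> (z / T)"

text \<open>One measure for each \<open>u < T\<close> instead of a single one at the end. They are
  consistent: \<open>tilted u\<close> and \<open>tilted s\<close> agree on \<open>F s\<close> for
  \<open>s < u\<close>.\<close>

definition tilted :: "real \<Rightarrow> 'a measure" where
  "tilted u = density M (\<lambda>\<omega>. ennreal (wt u \<omega> / wt0))"

lemma wt0_pos: "0 < wt0"
  unfolding wt0_def by (rule logit_weight_bounds[OF \<kappa>])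

lemma sets_tilted [measurable_cong, simp]: "sets (tilted u) = sets M" and space_tilted [simp]: "space (tilted u) = space M"
  by (auto simp: tilted_def)

lemma X_start: "AE \<omega> in M. X 0 \<omega> = z / T"
  using Z_sde W_start by eventually_elim (use T_pos in \<open>simp add: X_def\<close>)

lemma wt_integrable: "0 \<le> s \<Longrightarrow> s < T \<Longrightarrow> integrable M (wt s)"
  by (rule integrable_const_bound[of _ 1]) (use wt_bounds wt_measurable in auto)

lemma indicator_wt_integrable:
  "0 \<le> s \<Longrightarrow> s < T \<Longrightarrow> A \<in> sets M \<Longrightarrow> integrable M (\<lambda>\<omega>. indicat_real A \<omega> * wt s \<omega>)"
  using wt_measurable[of s] wt_bounds[of s]
  by (intro integrable_const_bound[of _ 1]) (auto split: split_indicator)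

lemma indicator_wt_nonneg: "0 \<le> indicat_real A \<omega> * wt s \<omega>"
  by (intro mult_nonneg_nonneg less_imp_le[OF wt_bounds(1)]) simp

lemma emeasure_tilted:
  assumes "0 \<le> s" "s < T" "A \<in> sets M"
  shows "emeasure (tilted s) A = ennreal ((\<integral>\<omega>. indicat_real A \<omega> * wt s \<omega> \<partial>M) / wt0)"
proof -
  have [measurable]: "wt s \<in> borel_measurable M" using wt_measurable assms by blast
  have "emeasure (tilted s) A = (\<integral>\<^sup>+\<omega>. ennreal (wt s \<omega> / wt0) * indicator A \<omega> \<partial>M)"
    unfolding tilted_def by (rule emeasure_density) (use assms in auto)
  also have "\<dots> = (\<integral>\<^sup>+\<omega>. ennreal (indicat_real A \<omega> * wt s \<omega> / wt0) \<partial>M)"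
    by (intro nn_integral_cong) (auto split: split_indicator)
  also have "\<dots> = ennreal (\<integral>\<omega>. indicat_real A \<omega> * wt s \<omega> / wt0 \<partial>M)"
    by (rule nn_integral_eq_integral[OF Bochner_Integration.integrable_divide[OF indicator_wt_integrable[OF assms]]])
      (intro AE_I2 divide_nonneg_pos indicator_wt_nonneg wt0_pos)
  finally show ?thesis by simp
qed

context
  fixes s u v :: real
  assumes su: "0 \<le> s" "s < u" "u < T"
  defines "v \<equiv> 1 / (T - u) - 1 / (T - s)"
begin

lemma v_pos: "0 < v"
  unfolding v_def using su by (simp add: frac_less2)

text \<open>The test variable in \<open>weighted_characteristic\<close> is the indicator of
  \<open>A\<close> times the conjugate phase at time \<open>s\<close>; the phase turns
  \<open>X u\<close> into the increment and cancels on the right side.\<close>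

lemma weighted_increment_characteristic:
  assumes A: "A \<in> sets (F s)"
  shows "(\<integral>\<omega>. of_real (indicat_real A \<omega> * wt u \<omega>) * exp (\<i> * of_real (\<theta> * (X u \<omega> - X s \<omega>))) \<partial>M)
       = exp ((\<i> * of_real (\<theta> * \<rho>) - of_real (\<theta>\<^sup>2 / 2)) * of_real v) * of_real (\<integral>\<omega>. indicat_real A \<omega> * wt s \<omega> \<partial>M)"
proof -
  define Y where "Y \<omega> = of_real (indicat_real A \<omega>) * exp (- \<i> * of_real (\<theta> * X s \<omega>))" for \<omega>
  have [measurable]: "X s \<in> borel_measurable (F s)" using X_adapted su by simp
  have Y: "Y \<in> borel_measurable (F s)" "norm (Y \<omega>) \<le> 1" for \<omega>
    unfolding Y_def using A by (measurable, simp add: norm_mult)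
  have 1: "of_real (indicat_real A \<omega> * wt u \<omega>) * exp (\<i> * of_real (\<theta> * (X u \<omega> - X s \<omega>)))
      = Y \<omega> * (of_real (wt u \<omega>) * exp (\<i> * of_real (\<theta> * X u \<omega>)))" for \<omega>
    by (simp add: Y_def exp_diff exp_minus right_diff_distrib field_simps)
  have 2: "Y \<omega> * (of_real (wt s \<omega>) * exp (\<i> * of_real (\<theta> * X s \<omega>))) = of_real (indicat_real A \<omega> * wt s \<omega>)" for \<omega>
    by (simp add: Y_def exp_minus field_simps)
  show ?thesis unfolding 1 weighted_characteristic[OF su Y, of \<theta>] 2 v_def
    by (simp only: integral_complex_of_real)
qed

text \<open>Normalised on \<open>A\<close>, the tilted measure gives the increment the
  characteristic function of a normal law with mean \<open>\<rho> * v\<close> and variance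
  \<open>v\<close>, whatever \<open>A\<close> is. Levy's theorem thus yields the distribution and
  the independence from \<open>F s\<close> at once.\<close>

lemma tilted_increment:
  assumes A: "A \<in> sets (F s)" and B: "B \<in> sets borel"
  shows "emeasure (tilted u) (A \<inter> {\<omega> \<in> space M. X u \<omega> - X s \<omega> \<in> B}) = emeasure (tilted s) A * emeasure (gauss (\<rho> * v) v) B"
proof -
  have AM: "A \<in> sets M" using A F_sub by blast
  have s': "0 \<le> s" "s < T" "0 \<le> u" "u < T" using su by auto
  have [measurable]: "X s \<in> borel_measurable M" "X u \<in> borel_measurable M" "A \<in> sets M"
    using X_measurable s' AM by auto
  have [measurable]: "wt u \<in> borel_measurable M" by measurable
  let ?E = "A \<inter> {\<omega> \<in> space M. X u \<omega> - X s \<omega> \<in> B}"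
  have E: "?E \<in> sets M" using B by measurable
  define c where "c = (\<integral>\<omega>. indicat_real A \<omega> * wt s \<omega> \<partial>M)"
  have c0: "0 \<le> c" unfolding c_def
    by (intro Bochner_Integration.integral_nonneg indicator_wt_nonneg)
  note char = weighted_increment_characteristic[OF A, folded c_def]
  \<comment> \<open>The frequency 0: the weight is a martingale, so \<open>A\<close> has the same
    weighted mass at times \<open>s\<close> and \<open>u\<close>.\<close>
  have cu: "(\<integral>\<omega>. indicat_real A \<omega> * wt u \<omega> \<partial>M) = c"
  proof -
    have "(\<integral>\<omega>. of_real (indicat_real A \<omega> * wt u \<omega>) * exp (\<i> * of_real (0 * (X u \<omega> - X s \<omega>))) \<partial>M) = complex_of_real c"
      unfolding char by simp
    then show ?thesis
      by (simp only: mult_zero_left of_real_0 mult_zero_right exp_zero mult_1_right integral_complex_of_real of_real_eq_iff)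
  qed
  show ?thesis
  proof (cases "c = 0")
    case True
    have "emeasure (tilted u) ?E \<le> emeasure (tilted u) A" by (rule emeasure_mono) (auto simp: AM)
    also have "\<dots> = 0" using emeasure_tilted[OF s'(3,4) AM] cu True by simp
    finally show ?thesis using emeasure_tilted[OF s'(1,2) AM] True by (simp add: c_def)
  next
    case False
    with c0 have c: "0 < c" by simp
    define g where "g \<omega> = indicat_real A \<omega> * wt u \<omega> / c" for \<omega>
    have g0: "0 \<le> g \<omega>" for \<omega>
      unfolding g_def using c wt_bounds(1)[of u \<omega>] by (simp add: less_imp_le)
    have gm [measurable]: "g \<in> borel_measurable M" unfolding g_def by measurable
    \<comment> \<open>The tilted measure conditioned on \<open>A\<close>; the excluded case
      \<open>c = 0\<close> is the one where both sides of the claim vanish.\<close>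
    define Q where "Q = density M (\<lambda>\<omega>. ennreal (g \<omega>))"
    have gi: "integrable M g" unfolding g_def
      by (intro Bochner_Integration.integrable_divide indicator_wt_integrable s' AM)
    have "(\<integral>\<^sup>+\<omega>. ennreal (g \<omega>) \<partial>M) = 1"
    proof -
      have "(\<integral>\<omega>. g \<omega> \<partial>M) = 1" unfolding g_def using cu c by simp
      then show ?thesis using nn_integral_eq_integral[OF gi] g0 by simp
    qed
    then have "emeasure Q (space Q) = 1"
      unfolding Q_def by (subst emeasure_density) (auto cong: nn_integral_cong simp: indicator_def)
    then interpret Q: prob_space Q by (rule prob_spaceI)
    define S where "S \<omega> = (X u \<omega> - X s \<omega> - \<rho> * v) / sqrt v" for \<omega>
    have Sm [measurable]: "S \<in> borel_measurable M" unfolding S_def by measurable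
    then have SQ [measurable]: "S \<in> borel_measurable Q" by (simp add: Q_def)
    have "distr Q borel S = std_normal_distribution"
    proof (rule Levy_uniqueness)
      show "real_distribution (distr Q borel S)" by (rule Q.real_distribution_distr[OF SQ])
      show "real_distribution std_normal_distribution" by (rule real_dist_normal_dist)
      show "char (distr Q borel S) = char std_normal_distribution"
        unfolding char_std_normal_distribution
      proof
        fix t :: real
        define \<theta> where "\<theta> = t / sqrt v"
        have \<theta>: "t * S \<omega> = \<theta> * (X u \<omega> - X s \<omega>) - \<theta> * \<rho> * v" "\<theta>\<^sup>2 * v = t\<^sup>2" for \<omega>
          unfolding S_def \<theta>_def using v_pos
          by (simp_all add: diff_divide_distrib right_diff_distrib power_divide)
        have "char (distr Q borel S) t = (\<integral>\<omega>. exp (\<i> * of_real (t * S \<omega>)) \<partial>Q)"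
          unfolding char_def by (rule integral_distr[OF SQ]) measurable
        also have "\<dots> = (\<integral>\<omega>. g \<omega> *\<^sub>R exp (\<i> * of_real (t * S \<omega>)) \<partial>M)"
          unfolding Q_def by (rule integral_density) (use g0 in auto)
        also have "(\<lambda>\<omega>. g \<omega> *\<^sub>R exp (\<i> * of_real (t * S \<omega>)))
            = (\<lambda>\<omega>. exp (- \<i> * of_real (\<theta> * \<rho> * v)) / of_real c *
                (of_real (indicat_real A \<omega> * wt u \<omega>) * exp (\<i> * of_real (\<theta> * (X u \<omega> - X s \<omega>)))))"
        proof
          fix \<omega>
          have "\<i> * complex_of_real (t * S \<omega>)
              = - \<i> * of_real (\<theta> * \<rho> * v) + \<i> * of_real (\<theta> * (X u \<omega> - X s \<omega>))"
            unfolding \<theta> of_real_diff right_diff_distrib[of \<i>] by simp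
          then show "g \<omega> *\<^sub>R exp (\<i> * of_real (t * S \<omega>)) = exp (- \<i> * of_real (\<theta> * \<rho> * v)) / of_real c *
                (of_real (indicat_real A \<omega> * wt u \<omega>) * exp (\<i> * of_real (\<theta> * (X u \<omega> - X s \<omega>))))"
            unfolding g_def scaleR_conv_of_real by (simp only: exp_add of_real_divide) (simp add: mult.assoc)
        qed
        also have "(\<integral>\<omega>. exp (- \<i> * of_real (\<theta> * \<rho> * v)) / of_real c *
                (of_real (indicat_real A \<omega> * wt u \<omega>) * exp (\<i> * of_real (\<theta> * (X u \<omega> - X s \<omega>)))) \<partial>M)
            = exp (- \<i> * of_real (\<theta> * \<rho> * v)) / of_real c * (exp ((\<i> * of_real (\<theta> * \<rho>) - of_real (\<theta>\<^sup>2 / 2)) * of_real v) * of_real c)"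
          unfolding integral_mult_right_zero char ..
        also have "\<dots> = exp (- \<i> * of_real (\<theta> * \<rho> * v) + (\<i> * of_real (\<theta> * \<rho>) - of_real (\<theta>\<^sup>2 / 2)) * of_real v)"
          unfolding exp_add using c by simp
        also have "- \<i> * of_real (\<theta> * \<rho> * v) + (\<i> * of_real (\<theta> * \<rho>) - of_real (\<theta>\<^sup>2 / 2)) * of_real v
            = complex_of_real (- (\<theta>\<^sup>2 * v) / 2)"
          by (simp add: algebra_simps)
        also have "exp (complex_of_real (- (\<theta>\<^sup>2 * v) / 2)) = complex_of_real (exp (- t\<^sup>2 / 2))"
          unfolding \<theta>(2) by (rule exp_of_real)
        finally show "char (distr Q borel S) t = complex_of_real (exp (- t\<^sup>2 / 2))" .
      qed
    qed
    then have "gauss (\<rho> * v) v = distr (distr Q borel S) borel (\<lambda>y. \<rho> * v + sqrt v * y)"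
      by (simp add: gauss_def)
    also have "\<dots> = distr Q borel (\<lambda>\<omega>. X u \<omega> - X s \<omega>)"
      by (subst distr_distr) (use v_pos in \<open>auto simp: comp_def S_def Q_def\<close>)
    finally have G: "gauss (\<rho> * v) v = distr Q borel (\<lambda>\<omega>. X u \<omega> - X s \<omega>)" .
    have "emeasure (gauss (\<rho> * v) v) B = emeasure Q {\<omega> \<in> space M. X u \<omega> - X s \<omega> \<in> B}"
      unfolding G by (subst emeasure_distr) (use B in \<open>auto simp: Q_def vimage_def Int_def conj_commute\<close>)
    also have "\<dots> = (\<integral>\<^sup>+\<omega>. ennreal (g \<omega>) * indicator {\<omega> \<in> space M. X u \<omega> - X s \<omega> \<in> B} \<omega> \<partial>M)"
      unfolding Q_def by (rule emeasure_density) (use B in auto)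
    also have "\<dots> = (\<integral>\<^sup>+\<omega>. ennreal (wt0 / c) * (ennreal (wt u \<omega> / wt0) * indicator ?E \<omega>) \<partial>M)"
      using c wt0_pos wt_bounds(1)[of u]
      by (intro nn_integral_cong) (auto simp: g_def ennreal_mult[symmetric] less_imp_le split: split_indicator)
    also have "\<dots> = ennreal (wt0 / c) * emeasure (tilted u) ?E"
      unfolding tilted_def using E by (subst nn_integral_cmult) (auto simp: emeasure_density)
    finally have "emeasure (tilted s) A * emeasure (gauss (\<rho> * v) v) B
        = ennreal (c / wt0) * ennreal (wt0 / c) * emeasure (tilted u) ?E"
      using emeasure_tilted[OF s'(1,2) AM] by (simp add: c_def mult.assoc)
    also have "ennreal (c / wt0) * ennreal (wt0 / c) = 1"
      using c wt0_pos by (simp add: ennreal_mult[symmetric])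
    finally show ?thesis by simp
  qed
qed

lemma tilted_mono_time:
  assumes "A \<in> sets (F s)"
  shows "emeasure (tilted u) A = emeasure (tilted s) A"
proof -
  have "A \<subseteq> space M" using sets.sets_into_space[OF assms] by simp
  then have "A \<inter> {\<omega> \<in> space M. X u \<omega> - X s \<omega> \<in> UNIV} = A" by auto
  with tilted_increment[OF assms, of UNIV] prob_space.emeasure_space_1[OF prob_space_gauss[of "\<rho> * v" v]]
  show ?thesis by (simp add: gauss_def)
qed

end

lemma prob_space_tilted:
  assumes "0 \<le> u" "u < T"
  shows "prob_space (tilted u)"
proof (rule prob_spaceI)
  have "emeasure (tilted 0) (space M) = 1"
  proof -
    have "(\<integral>\<omega>. indicat_real (space M) \<omega> * wt 0 \<omega> \<partial>M) = (\<integral>\<omega>. wt0 \<partial>M)"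
      by (rule integral_cong_AE)
        (use X_start AE_space wt_measurable[of 0] T_pos in \<open>auto simp: wt0_def elim: eventually_elim2\<close>)
    then show ?thesis using emeasure_tilted[of 0 "space M"] T_pos wt0_pos by (simp add: prob_space)
  qed
  moreover have "emeasure (tilted u) (space M) = emeasure (tilted 0) (space M)"
    using tilted_mono_time[of 0 u "space M"] assms sets.top[of "F 0"] by (cases "u = 0") auto
  ultimately show "emeasure (tilted u) (space (tilted u)) = 1" by simp
qed

text \<open>Since \<open>X 0\<close> is almost surely \<open>z / T\<close>, the increment from time
  0 gives the exact normal law of \<open>X u\<close>. Time 0 is treated apart because an increment
  needs two distinct times.\<close>

lemma tilted_X_moment:
  assumes u: "0 \<le> u" "u < T"
  defines "v \<equiv> 1 / (T - u) - 1 / T"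
  shows "integrable (tilted u) (\<lambda>\<omega>. \<bar>X u \<omega> - z / T - \<rho> * v\<bar>)"
    and "(\<integral>\<omega>. \<bar>X u \<omega> - z / T - \<rho> * v\<bar> \<partial>tilted u) \<le> sqrt v"
proof -
  have [measurable]: "X u \<in> borel_measurable M" "X 0 \<in> borel_measurable M" using X_measurable u T_pos by auto
  have PAE: "AE \<omega> in tilted u. X 0 \<omega> = z / T"
    using X_start wt_measurable[OF u] unfolding tilted_def by (subst AE_density) (auto elim: eventually_mono)
  have *: "integrable (tilted u) (\<lambda>\<omega>. \<bar>X u \<omega> - z / T - \<rho> * v\<bar>) \<and> (\<integral>\<omega>. \<bar>X u \<omega> - z / T - \<rho> * v\<bar> \<partial>tilted u) \<le> sqrt v"
  proof (cases "u = 0")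
    case True
    then have "AE \<omega> in tilted u. \<bar>X u \<omega> - z / T - \<rho> * v\<bar> = 0"
      using PAE T_pos by (auto simp: v_def)
    moreover have "(\<lambda>\<omega>. \<bar>X u \<omega> - z / T - \<rho> * v\<bar>) \<in> borel_measurable (tilted u)" by measurable
    ultimately show ?thesis
      using integrable_cong_AE[of "\<lambda>\<omega>. \<bar>X u \<omega> - z / T - \<rho> * v\<bar>" "tilted u" "\<lambda>_. 0"]
        integral_cong_AE[of "\<lambda>\<omega>. \<bar>X u \<omega> - z / T - \<rho> * v\<bar>" "tilted u" "\<lambda>_. 0"] True
      by (simp add: v_def)
  next
    case False
    then have u0: "(0::real) \<le> 0" "0 < u" "u < T" using u by auto
    have v0: "0 < v" using v_pos[OF u0] by (simp add: v_def)
    have "distr (tilted u) borel (\<lambda>\<omega>. X u \<omega> - X 0 \<omega>) = gauss (\<rho> * v) v"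
    proof (rule measure_eqI)
      fix B assume "B \<in> sets (distr (tilted u) borel (\<lambda>\<omega>. X u \<omega> - X 0 \<omega>))"
      then have B: "B \<in> sets borel" by simp
      have "emeasure (distr (tilted u) borel (\<lambda>\<omega>. X u \<omega> - X 0 \<omega>)) B
          = emeasure (tilted u) (space M \<inter> {\<omega> \<in> space M. X u \<omega> - X 0 \<omega> \<in> B})"
        using B by (subst emeasure_distr) (auto intro!: arg_cong2[where f = emeasure])
      also have "\<dots> = emeasure (tilted 0) (space M) * emeasure (gauss (\<rho> * v) v) B"
        using tilted_increment[OF u0, of "space M" B] B sets.top[of "F 0"] by (simp add: v_def)
      also have "emeasure (tilted 0) (space M) = 1"
        using prob_space.emeasure_space_1[OF prob_space_tilted[of 0]] T_pos by simp
      finally show "emeasure (distr (tilted u) borel (\<lambda>\<omega>. X u \<omega> - X 0 \<omega>)) B = emeasure (gauss (\<rho> * v) v) B"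
        by simp
    qed simp
    note d = this
    have i: "integrable (tilted u) (\<lambda>\<omega>. \<bar>X u \<omega> - X 0 \<omega> - \<rho> * v\<bar>)"
      using gauss_abs_moment(1)[OF less_imp_le[OF v0], of "\<rho> * v"] unfolding d[symmetric]
      by (subst (asm) integrable_distr_eq) auto
    have j: "(\<integral>\<omega>. \<bar>X u \<omega> - X 0 \<omega> - \<rho> * v\<bar> \<partial>tilted u) \<le> sqrt v"
      using gauss_abs_moment(2)[OF less_imp_le[OF v0], of "\<rho> * v"] unfolding d[symmetric]
      by (subst (asm) integral_distr) auto
    have eq: "AE \<omega> in tilted u. \<bar>X u \<omega> - X 0 \<omega> - \<rho> * v\<bar> = \<bar>X u \<omega> - z / T - \<rho> * v\<bar>"
      using PAE by eventually_elim simp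
    have m: "(\<lambda>\<omega>. \<bar>X u \<omega> - X 0 \<omega> - \<rho> * v\<bar>) \<in> borel_measurable (tilted u)"
      "(\<lambda>\<omega>. \<bar>X u \<omega> - z / T - \<rho> * v\<bar>) \<in> borel_measurable (tilted u)" by measurable
    show ?thesis
      using integrable_cong_AE[OF m eq] integral_cong_AE[OF m eq] i j by simp
  qed
  then show "integrable (tilted u) (\<lambda>\<omega>. \<bar>X u \<omega> - z / T - \<rho> * v\<bar>)"
    and "(\<integral>\<omega>. \<bar>X u \<omega> - z / T - \<rho> * v\<bar> \<partial>tilted u) \<le> sqrt v" by auto
qed

text \<open>The index set may be finite or a whole interval, and \<open>u\<close> only names the
  tilted measure. Finite sets serve the recursion, intervals the transport of stopping
  rules.\<close>

definition marginal :: "real \<Rightarrow> real set \<Rightarrow> (real \<Rightarrow> real) measure" where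
  "marginal u J = distr (tilted u) (Pi\<^sub>M J (\<lambda>_. borel)) (\<lambda>\<omega>. \<lambda>i\<in>J. X i \<omega>)"

lemma sets_marginal [measurable_cong, simp]: "sets (marginal u J) = sets (Pi\<^sub>M J (\<lambda>_. borel))"
  by (simp add: marginal_def)

lemma coordinates_adapted:
  assumes "J \<subseteq> {0..s}" "s < T"
  shows "(\<lambda>\<omega>. \<lambda>i\<in>J. X i \<omega>) \<in> measurable (F s) (Pi\<^sub>M J (\<lambda>_. borel))"
  by (rule measurable_restrict) (use assms in \<open>force intro: F_measurable_mono[OF X_adapted]\<close>)

lemma coordinates_measurable:
  assumes "J \<subseteq> {0..<T}"
  shows "(\<lambda>\<omega>. \<lambda>i\<in>J. X i \<omega>) \<in> measurable (tilted u) (Pi\<^sub>M J (\<lambda>_. borel))"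
proof -
  have "(\<lambda>\<omega>. \<lambda>i\<in>J. X i \<omega>) \<in> measurable M (Pi\<^sub>M J (\<lambda>_. borel))"
    by (rule measurable_restrict) (use assms X_measurable in auto)
  then show ?thesis by (simp add: tilted_def)
qed

lemma prob_space_marginal:
  assumes "J \<subseteq> {0..<T}" "0 \<le> u" "u < T"
  shows "prob_space (marginal u J)"
  unfolding marginal_def by (intro prob_space.prob_space_distr prob_space_tilted assms coordinates_measurable)

lemma marginal_mono_time:
  assumes "J \<subseteq> {0..s}" "0 \<le> s" "s \<le> u" "u < T"
  shows "marginal u J = marginal s J"
proof (cases "s = u")
  case False
  with assms have su: "0 \<le> s" "s < u" "u < T" by auto
  have J: "J \<subseteq> {0..<T}" using assms by auto
  show ?thesis
  proof (rule measure_eqI)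
    fix A assume "A \<in> sets (marginal u J)"
    then have A: "A \<in> sets (Pi\<^sub>M J (\<lambda>_. borel))" by simp
    have "(\<lambda>\<omega>. \<lambda>i\<in>J. X i \<omega>) -` A \<inter> space M \<in> sets (F s)"
      using measurable_sets[OF coordinates_adapted[of J s] A] assms by simp
    from tilted_mono_time[OF su this] show "emeasure (marginal u J) A = emeasure (marginal s J) A"
      unfolding marginal_def by (simp add: emeasure_distr coordinates_measurable J A)
  qed simp
qed simp

text \<open>A recursion whose transition adds an independent normal increment to the last
  coordinate. It depends on \<open>\<rho>\<close> and on the times, but neither on
  \<open>\<kappa>\<close> nor on the probability space.\<close>

lemma marginal_insert:
  assumes su: "0 \<le> s" "s < u" "u < T" and J: "finite J" "J \<subseteq> {0..s}" "s \<in> J"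
  defines "v \<equiv> 1 / (T - u) - 1 / (T - s)"
  shows "marginal u (insert u J) = distr (marginal s J \<Otimes>\<^sub>M gauss (\<rho> * v) v) (Pi\<^sub>M (insert u J) (\<lambda>_. borel))
           (\<lambda>(x, d). \<lambda>i\<in>insert u J. if i = u then x s + d else x i)"
proof -
  have J': "J \<subseteq> {0..<T}" "insert u J \<subseteq> {0..<T}" using J su by auto
  have [measurable]: "X u \<in> borel_measurable M" "X s \<in> borel_measurable M" using X_measurable su by auto
  note cm [measurable] = coordinates_measurable[OF J'(1)]
  interpret Ls: prob_space "marginal s J" by (rule prob_space_marginal[OF J'(1)]) (use su in auto)
  interpret G: prob_space "gauss (\<rho> * v) v" by (rule prob_space_gauss)
  let ?j = "\<lambda>\<omega>. (\<lambda>i\<in>J. X i \<omega>, X u \<omega> - X s \<omega>)"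
  have jm: "?j \<in> measurable (tilted u) (Pi\<^sub>M J (\<lambda>_. borel) \<Otimes>\<^sub>M borel)" by measurable
  have "marginal s J \<Otimes>\<^sub>M gauss (\<rho> * v) v = distr (tilted u) (Pi\<^sub>M J (\<lambda>_. borel) \<Otimes>\<^sub>M borel) ?j"
  proof (rule pair_measure_eqI)
    show "sets (marginal s J \<Otimes>\<^sub>M gauss (\<rho> * v) v) = sets (distr (tilted u) (Pi\<^sub>M J (\<lambda>_. borel) \<Otimes>\<^sub>M borel) ?j)"
      by (simp cong: sets_pair_measure_cong)
    fix A B assume "A \<in> sets (marginal s J)" "B \<in> sets (gauss (\<rho> * v) v)"
    then have A: "A \<in> sets (Pi\<^sub>M J (\<lambda>_. borel))" and B: "B \<in> sets borel" by auto
    let ?A = "(\<lambda>\<omega>. \<lambda>i\<in>J. X i \<omega>) -` A \<inter> space M"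
    have "?A \<in> sets (F s)"
      using measurable_sets[OF coordinates_adapted[of J s] A] su J by simp
    from tilted_increment[OF su this B]
    have "emeasure (tilted u) (?A \<inter> {\<omega> \<in> space M. X u \<omega> - X s \<omega> \<in> B}) = emeasure (marginal s J) A * emeasure (gauss (\<rho> * v) v) B"
      unfolding marginal_def by (simp add: emeasure_distr cm A v_def coordinates_measurable J')
    also have "?A \<inter> {\<omega> \<in> space M. X u \<omega> - X s \<omega> \<in> B} = ?j -` (A \<times> B) \<inter> space (tilted u)" by auto
    also have "emeasure (tilted u) \<dots> = emeasure (distr (tilted u) (Pi\<^sub>M J (\<lambda>_. borel) \<Otimes>\<^sub>M borel) ?j) (A \<times> B)"
      by (rule emeasure_distr[OF jm, symmetric]) (use A B in auto)
    finally show "emeasure (marginal s J) A * emeasure (gauss (\<rho> * v) v) B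
        = emeasure (distr (tilted u) (Pi\<^sub>M J (\<lambda>_. borel) \<Otimes>\<^sub>M borel) ?j) (A \<times> B)" by simp
  qed (rule Ls.sigma_finite_measure_axioms G.sigma_finite_measure_axioms)+
  note eq = this
  let ?h = "\<lambda>(x, d). \<lambda>i\<in>insert u J. if i = u then (x s + d :: real) else x i"
  have hm: "?h \<in> measurable (Pi\<^sub>M J (\<lambda>_. borel) \<Otimes>\<^sub>M borel) (Pi\<^sub>M (insert u J) (\<lambda>_. borel))"
    unfolding case_prod_beta
  proof (rule measurable_restrict)
    fix i assume i: "i \<in> insert u J"
    show "(\<lambda>x. if i = u then (fst x s + snd x :: real) else fst x i) \<in> borel_measurable (Pi\<^sub>M J (\<lambda>_. borel) \<Otimes>\<^sub>M borel)"
    proof (cases "i = u")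
      case True
      have "(\<lambda>x. fst x s) \<in> borel_measurable (Pi\<^sub>M J (\<lambda>_. borel :: real measure) \<Otimes>\<^sub>M (borel :: real measure))"
        by (rule measurable_compose[OF measurable_fst measurable_component_singleton[OF J(3)]])
      from borel_measurable_add[OF this measurable_snd] True show ?thesis by simp
    next
      case False
      with i have "i \<in> J" by simp
      from measurable_compose[OF measurable_fst measurable_component_singleton[OF this]] False
      show ?thesis by simp
    qed
  qed
  have "marginal u (insert u J) = distr (tilted u) (Pi\<^sub>M (insert u J) (\<lambda>_. borel)) (?h \<circ> ?j)"
    unfolding marginal_def using su J by (intro distr_cong) (auto simp: fun_eq_iff restrict_def)
  also have "\<dots> = distr (marginal s J \<Otimes>\<^sub>M gauss (\<rho> * v) v) (Pi\<^sub>M (insert u J) (\<lambda>_. borel)) ?h"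
    unfolding eq by (rule distr_distr[OF hm jm, symmetric])
  finally show ?thesis .
qed

lemma marginal_start: "marginal 0 {0} = return (Pi\<^sub>M {0} (\<lambda>_. borel)) (\<lambda>i\<in>{0}. z / T)"
proof (rule measure_eqI)
  interpret P0: prob_space "tilted 0" by (rule prob_space_tilted) (use T_pos in auto)
  have PAE: "AE \<omega> in tilted 0. X 0 \<omega> = z / T"
    using X_start wt_measurable[of 0] T_pos unfolding tilted_def by (subst AE_density) (auto elim: eventually_mono)
  fix A assume "A \<in> sets (marginal 0 {0})"
  then have A: "A \<in> sets (Pi\<^sub>M {0} (\<lambda>_. borel))" by simp
  note cm = coordinates_measurable[of "{0}" 0]
  have "emeasure (marginal 0 {0}) A = emeasure (tilted 0) ((\<lambda>\<omega>. \<lambda>i\<in>{0}. X i \<omega>) -` A \<inter> space (tilted 0))"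
    unfolding marginal_def by (rule emeasure_distr) (use cm A T_pos in auto)
  also have "\<dots> = emeasure (tilted 0) {\<omega> \<in> space (tilted 0). (\<lambda>i\<in>{0}. z / T) \<in> A}"
  proof (rule emeasure_eq_AE)
    show "AE \<omega> in tilted 0. \<omega> \<in> (\<lambda>\<omega>. \<lambda>i\<in>{0}. X i \<omega>) -` A \<inter> space (tilted 0) \<longleftrightarrow> \<omega> \<in> {\<omega> \<in> space (tilted 0). (\<lambda>i\<in>{0}. z / T) \<in> A}"
      using PAE
    proof eventually_elim
      case (elim \<omega>)
      then have "(\<lambda>i\<in>{0}. X i \<omega>) = (\<lambda>i\<in>{0}. z / T)" by (auto simp: restrict_def)
      then show ?case by auto
    qed
  qed (use measurable_sets[OF cm A] T_pos in auto)
  also have "\<dots> = indicator A (\<lambda>i\<in>{0}. z / T)"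
    using P0.emeasure_space_1 by (auto simp: indicator_def)
  finally show "emeasure (marginal 0 {0}) A = emeasure (return (Pi\<^sub>M {0} (\<lambda>_. borel)) (\<lambda>i\<in>{0}. z / T)) A"
    using A by simp
qed simp

end

text \<open>That \<open>\<kappa>\<close> and \<open>\<kappa>'\<close> may differ is the point: the
  starting law and the transition of \<open>marginal_insert\<close> do not see them. Adjoining time
  0 provides a preceding time in each induction step, where the new time is the largest.\<close>

lemma marginal_unique:
  assumes "drift_bridge M F T W Z \<rho> \<kappa> z" "drift_bridge M' F' T W' Z' \<rho> \<kappa>' z"
    and J: "finite J" "J \<subseteq> {0<..<T}"
  shows "drift_bridge.marginal M T Z \<rho> \<kappa> z (Max (insert 0 J)) (insert 0 J)
       = drift_bridge.marginal M' T Z' \<rho> \<kappa>' z (Max (insert 0 J)) (insert 0 J)"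
proof -
  interpret a: drift_bridge M F T W Z \<rho> \<kappa> z by fact
  interpret b: drift_bridge M' F' T W' Z' \<rho> \<kappa>' z by fact
  show ?thesis using J
  proof (induction J rule: finite_linorder_max_induct)
    case empty
    show ?case using a.marginal_start b.marginal_start by simp
  next
    case (insert u J)
    define s where "s = Max (insert 0 J)"
    have fin: "finite (insert 0 J)" using insert by simp
    have sJ: "s \<in> insert 0 J" unfolding s_def by (rule Max_in[OF fin]) simp
    have ge: "i \<le> s" if "i \<in> insert 0 J" for i unfolding s_def by (rule Max_ge[OF fin that])
    have s: "0 \<le> s" "s < u" "u < T" "finite (insert 0 J)" "insert 0 J \<subseteq> {0..s}" "s \<in> insert 0 J"
    proof -
      show "0 \<le> s" by (rule ge) simp
      show "insert 0 J \<subseteq> {0..s}"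
      proof
        fix i assume i: "i \<in> insert 0 J"
        then have "0 \<le> i" using insert.prems by (auto dest!: subsetD)
        with ge[OF i] show "i \<in> {0..s}" by simp
      qed
    qed (use sJ fin insert.hyps insert.prems in auto)
    have m: "Max (insert 0 (insert u J)) = u"
      using insert s by (subst Max_eq_iff) (auto intro: less_imp_le)
    have IH: "a.marginal s (insert 0 J) = b.marginal s (insert 0 J)"
      unfolding s_def by (rule insert.IH) (use insert.prems in auto)
    show ?case unfolding m
      unfolding insert_commute[of 0 u] a.marginal_insert[OF s] b.marginal_insert[OF s] IH ..
  qed
qed

text \<open>Cylinder sets determine a finite measure on the product sigma-algebra, so agreement of
  the finite-dimensional laws suffices. With \<open>\<kappa>' = 0\<close> the right side is the
  untilted law of the bridge with known pin.\<close>

lemma path_law_unique: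
  assumes "drift_bridge M F T W Z \<rho> \<kappa> z" "drift_bridge M' F' T W' Z' \<rho> \<kappa>' z"
    and u: "0 \<le> u" "u < T"
  shows "drift_bridge.marginal M T Z \<rho> \<kappa> z u {0..u} = drift_bridge.marginal M' T Z' \<rho> \<kappa>' z u {0..u}"
proof -
  interpret a: drift_bridge M F T W Z \<rho> \<kappa> z by fact
  interpret b: drift_bridge M' F' T W' Z' \<rho> \<kappa>' z by fact
  have sub: "{0..u} \<subseteq> {0..<T}" using u by auto
  show ?thesis
  proof (rule measure_eqI_PiM_infinite)
    show "finite_measure (a.marginal u {0..u})"
      by (rule prob_space.finite_measure[OF a.prob_space_marginal[OF sub u]])
    fix A :: "real \<Rightarrow> real set" and J assume J: "finite J" "J \<subseteq> {0..u}" and A: "\<And>i. i \<in> J \<Longrightarrow> A i \<in> sets borel"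
    \<comment> \<open>Time 0 is adjoined, with no constraint on its coordinate, to match the index
      sets of \<open>marginal_unique\<close>.\<close>
    define J0 where "J0 = insert 0 J"
    define A0 where "A0 i = (if i \<in> J then A i else UNIV)" for i
    have J0: "J0 \<subseteq> {0..u}" "J0 \<subseteq> {0..<T}" "finite J0" using J u by (auto simp: J0_def)
    have A0: "Pi\<^sub>E J0 A0 \<in> sets (Pi\<^sub>M J0 (\<lambda>_. borel))"
      by (rule sets_PiM_I_finite) (use J0 A in \<open>auto simp: A0_def\<close>)
    have emb: "prod_emb {0..u} (\<lambda>_. borel) J (Pi\<^sub>E J A) \<in> sets (Pi\<^sub>M {0..u} (\<lambda>_. borel))"
      by (rule sets_PiM_I) (use J A in auto)
    have red: "emeasure (drift_bridge.marginal N T Y \<rho> k z u {0..u}) (prod_emb {0..u} (\<lambda>_. borel) J (Pi\<^sub>E J A))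
        = emeasure (drift_bridge.marginal N T Y \<rho> k z u J0) (Pi\<^sub>E J0 A0)"
      if "drift_bridge N G T V Y \<rho> k z" for N :: "'c measure" and G V Y k
    proof -
      interpret drift_bridge N G T V Y \<rho> k z by fact
      have "(\<lambda>\<omega>. \<lambda>i\<in>{0..u}. X i \<omega>) -` prod_emb {0..u} (\<lambda>_. borel) J (Pi\<^sub>E J A) \<inter> space (tilted u)
          = (\<lambda>\<omega>. \<lambda>i\<in>J0. X i \<omega>) -` Pi\<^sub>E J0 A0 \<inter> space (tilted u)"
        using J by (auto simp: prod_emb_def PiE_iff A0_def J0_def subset_iff split: if_splits)
      then show ?thesis
        unfolding marginal_def
        by (simp add: emeasure_distr[OF coordinates_measurable[OF sub] emb]
            emeasure_distr[OF coordinates_measurable[OF J0(2)] A0])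
    qed
    have m: "0 \<le> Max J0" "Max J0 \<le> u" "J0 \<subseteq> {0..Max J0}" "J0 = insert 0 (J - {0})"
      using J0 by (auto simp: J0_def)
    have "a.marginal u J0 = b.marginal u J0"
      unfolding a.marginal_mono_time[OF m(3,1,2) u(2)] b.marginal_mono_time[OF m(3,1,2) u(2)]
      unfolding m(4) by (rule marginal_unique[OF assms(1,2)]) (use J u in auto)
    then show "emeasure (a.marginal u {0..u}) (prod_emb {0..u} (\<lambda>_. borel) J (Pi\<^sub>E J A))
        = emeasure (b.marginal u {0..u}) (prod_emb {0..u} (\<lambda>_. borel) J (Pi\<^sub>E J A))"
      unfolding red[OF assms(1)] red[OF assms(2)] by simp
  qed auto
qed

subsection \<open>Behaviour at the pinning time\<close>

lemma logit_weight_flip: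
  assumes "0 < \<kappa>"
  shows "logit_weight (- \<rho>) (1 / \<kappa>) x = 1 - logit_weight \<rho> \<kappa> x"
proof -
  define e where "e = exp (2 * \<rho> * x)"
  have e: "0 < e" "exp (- (2 * \<rho> * x)) = 1 / e" by (simp_all add: e_def exp_minus inverse_eq_divide)
  have "1 / (1 + 1 / \<kappa> * e) = 1 - 1 / (1 + \<kappa> * (1 / e))"
    using e(1) assms add_pos_pos[of \<kappa> e] by (simp add: field_simps)
  then show ?thesis unfolding logit_weight_def using e by (simp add: e_def)
qed

text \<open>The posterior mean is symmetric under exchange of the pins, so the very same process
  satisfies the equation with \<open>- \<rho>\<close> and inverse odds. Everything shown for the
  weight \<open>wt\<close> thereby holds for \<open>1 - wt\<close> and the opposite pin.\<close>

lemma drift_bridge_flip: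
  assumes "drift_bridge M F T W Z \<rho> \<kappa> z" "0 < \<kappa>"
  shows "drift_bridge M F T W Z (- \<rho>) (1 / \<kappa>) z"
proof -
  interpret drift_bridge M F T W Z \<rho> \<kappa> z by fact
  have "- \<rho> * (2 * logit_weight (- \<rho>) (1 / \<kappa>) x - 1) = \<rho> * (2 * logit_weight \<rho> \<kappa> x - 1)" for x
    unfolding logit_weight_flip[OF assms(2)] by (simp add: algebra_simps)
  then show ?thesis
    using T_pos assms(2) Z_adapted Z_cont Z_sde by unfold_locales (auto simp del: mult_minus_left)
qed

context drift_bridge
begin

lemma integral_tilted:
  fixes f :: "'a \<Rightarrow> real"
  assumes "0 \<le> u" "u < T" "f \<in> borel_measurable M"
  shows "(\<integral>\<omega>. f \<omega> \<partial>tilted u) = (\<integral>\<omega>. wt u \<omega> * f \<omega> \<partial>M) / wt0"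
    and "integrable (tilted u) f \<longleftrightarrow> integrable M (\<lambda>\<omega>. wt u \<omega> * f \<omega>)"
proof -
  have m [measurable]: "wt u \<in> borel_measurable M" using wt_measurable assms by blast
  have nn: "AE \<omega> in M. 0 \<le> wt u \<omega> / wt0" using wt_bounds(1) wt0_pos by (intro AE_I2 divide_nonneg_pos less_imp_le)
  have "(\<integral>\<omega>. f \<omega> \<partial>tilted u) = (\<integral>\<omega>. (wt u \<omega> / wt0) *\<^sub>R f \<omega> \<partial>M)"
    unfolding tilted_def by (rule integral_density) (use assms nn in auto)
  then show "(\<integral>\<omega>. f \<omega> \<partial>tilted u) = (\<integral>\<omega>. wt u \<omega> * f \<omega> \<partial>M) / wt0" by simp
  have "integrable (tilted u) f \<longleftrightarrow> integrable M (\<lambda>\<omega>. (wt u \<omega> / wt0) *\<^sub>R f \<omega>)"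
    unfolding tilted_def by (rule integrable_density) (use assms nn in auto)
  then show "integrable (tilted u) f \<longleftrightarrow> integrable M (\<lambda>\<omega>. wt u \<omega> * f \<omega>)"
    using integrable_mult_right_iff[where M = M and c = "1 / wt0" and f = "\<lambda>\<omega>. wt u \<omega> * f \<omega>"] wt0_pos by simp
qed

lemma wt_mean:
  assumes "0 \<le> u" "u < T"
  shows "(\<integral>\<omega>. wt u \<omega> \<partial>M) = wt0"
proof -
  interpret P: prob_space "tilted u" by (rule prob_space_tilted[OF assms])
  show ?thesis using integral_tilted(1)[OF assms, of "\<lambda>_. 1"] P.prob_space wt0_pos by simp
qed

text \<open>Under \<open>tilted u\<close> the value \<open>Z u\<close> has mean
  \<open>\<rho> + (T - u) * (z - \<rho>) / T\<close> and variance \<open>(T - u)^2 * v\<close>,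
  which is at most \<open>T - u\<close>. This is the quantitative form of the statement that the
  tilted bridge ends at \<open>\<rho>\<close>.\<close>

lemma weighted_distance_to_pin:
  assumes u: "0 \<le> u" "u < T"
  shows "integrable M (\<lambda>\<omega>. wt u \<omega> * \<bar>Z u \<omega> - \<rho>\<bar>)"
    and "(\<integral>\<omega>. wt u \<omega> * \<bar>Z u \<omega> - \<rho>\<bar> \<partial>M) \<le> wt0 * (sqrt (T - u) + (T - u) * \<bar>z - \<rho>\<bar> / T)"
proof -
  interpret P: prob_space "tilted u" by (rule prob_space_tilted[OF u])
  define v where "v = 1 / (T - u) - 1 / T"
  define N where "N \<omega> = X u \<omega> - z / T - \<rho> * v" for \<omega>
  have mom: "integrable (tilted u) (\<lambda>\<omega>. \<bar>N \<omega>\<bar>)" "(\<integral>\<omega>. \<bar>N \<omega>\<bar> \<partial>tilted u) \<le> sqrt v"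
    unfolding N_def v_def by (rule tilted_X_moment[OF u])+
  have eq: "Z u \<omega> - \<rho> = (T - u) * N \<omega> + (T - u) * (z - \<rho>) / T" for \<omega>
  proof -
    have 1: "(T - u) * v = 1 - (T - u) / T" using u by (simp add: v_def right_diff_distrib)
    have 2: "(T - u) * X u \<omega> = Z u \<omega>" using u by (simp add: X_def)
    have "(T - u) * N \<omega> = (T - u) * X u \<omega> - (T - u) * (z / T) - \<rho> * ((T - u) * v)"
      unfolding N_def right_diff_distrib by (simp only: mult.left_commute)
    then show ?thesis unfolding 1 2 using T_pos by (simp add: algebra_simps diff_divide_distrib add_divide_distrib)
  qed
  have bd: "\<bar>Z u \<omega> - \<rho>\<bar> \<le> (T - u) * \<bar>N \<omega>\<bar> + (T - u) * \<bar>z - \<rho>\<bar> / T" for \<omega>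
    unfolding eq using u T_pos by (intro order_trans[OF abs_triangle_ineq]) (simp add: abs_mult)
  have m: "(\<lambda>\<omega>. \<bar>Z u \<omega> - \<rho>\<bar>) \<in> borel_measurable M" using Z_measurable[OF u] by measurable
  have i: "integrable (tilted u) (\<lambda>\<omega>. (T - u) * \<bar>N \<omega>\<bar> + (T - u) * \<bar>z - \<rho>\<bar> / T)"
    using mom(1) by simp
  have j: "integrable (tilted u) (\<lambda>\<omega>. \<bar>Z u \<omega> - \<rho>\<bar>)"
    by (rule Bochner_Integration.integrable_bound[OF i]) (use m bd u T_pos in \<open>auto simp: tilted_def intro!: AE_I2 order_trans[OF _ abs_ge_self]\<close>)
  then show "integrable M (\<lambda>\<omega>. wt u \<omega> * \<bar>Z u \<omega> - \<rho>\<bar>)" using integral_tilted(2)[OF u m] by simp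
  have "(T - u) * sqrt v \<le> sqrt (T - u)"
  proof -
    have "(T - u) * sqrt v = sqrt ((T - u)\<^sup>2 * v)" using u by (simp add: real_sqrt_mult)
    also have "(T - u)\<^sup>2 * v \<le> (T - u)\<^sup>2 * (1 / (T - u))"
      unfolding v_def using u T_pos by (intro mult_left_mono) auto
    also have "\<dots> = T - u" using u by (simp add: power2_eq_square)
    finally show ?thesis by simp
  qed
  moreover have "(T - u) * (\<integral>\<omega>. \<bar>N \<omega>\<bar> \<partial>tilted u) \<le> (T - u) * sqrt v"
    using mom(2) u by (intro mult_left_mono) auto
  moreover have "(\<integral>\<omega>. \<bar>Z u \<omega> - \<rho>\<bar> \<partial>tilted u) \<le> (\<integral>\<omega>. (T - u) * \<bar>N \<omega>\<bar> + (T - u) * \<bar>z - \<rho>\<bar> / T \<partial>tilted u)"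
    by (rule integral_mono[OF j i]) (rule bd)
  moreover have "\<dots> = (T - u) * (\<integral>\<omega>. \<bar>N \<omega>\<bar> \<partial>tilted u) + (T - u) * \<bar>z - \<rho>\<bar> / T"
    using mom(1) P.prob_space by simp
  ultimately have "(\<integral>\<omega>. \<bar>Z u \<omega> - \<rho>\<bar> \<partial>tilted u) \<le> sqrt (T - u) + (T - u) * \<bar>z - \<rho>\<bar> / T" by linarith
  then show "(\<integral>\<omega>. wt u \<omega> * \<bar>Z u \<omega> - \<rho>\<bar> \<partial>M) \<le> wt0 * (sqrt (T - u) + (T - u) * \<bar>z - \<rho>\<bar> / T)"
    unfolding integral_tilted(1)[OF u m] using wt0_pos by (simp add: field_simps)
qed

end

section \<open>The bridge including its terminal value\<close>

locale full_bridge = drift_bridge +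
  assumes ZT_measurable: "Z T \<in> borel_measurable M"
    and ZT_limit: "AE \<omega> in M. ((\<lambda>s. Z s \<omega>) \<longlongrightarrow> Z T \<omega>) (at_left T)"
begin

lemma Z_measurable': "0 \<le> s \<Longrightarrow> s \<le> T \<Longrightarrow> Z s \<in> borel_measurable M"
  using Z_measurable[of s] ZT_measurable by (cases "s = T") auto

text \<open>Combines \<open>path_bound\<close> with the maximal inequality on all of
  \<open>[0, T)\<close>, then passes to the limit at \<open>T\<close>. One integrable majorant
  serves every stopping time and all dominated convergence arguments below.\<close>

lemma Z_dominated:
  obtains D where "integrable M D" "AE \<omega> in M. \<forall>s\<in>{0..T}. \<bar>Z s \<omega>\<bar> \<le> D \<omega>"
proof -
  obtain D where D: "D \<in> borel_measurable M" "integrable M D"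
    "AE \<omega> in M. 0 \<le> D \<omega> \<and> (\<forall>v. 0 \<le> v \<and> v \<le> T \<and> v < T \<longrightarrow> \<bar>W v \<omega> - W 0 \<omega>\<bar> \<le> D \<omega>)"
    using W_sup_dominated[of 0 T] T_pos by auto
  define E where "E \<omega> = \<bar>z\<bar> + \<bar>\<rho>\<bar> + 2 * D \<omega>" for \<omega>
  have i: "integrable M E" unfolding E_def using D(2) by simp
  have "AE \<omega> in M. \<forall>s\<in>{0..T}. \<bar>Z s \<omega>\<bar> \<le> E \<omega>"
    using D(3) AE_path W_start ZT_limit
  proof eventually_elim
    case (elim \<omega>)
    interpret bridge_path \<rho> \<kappa> T z "\<lambda>s. W s \<omega>" "\<lambda>s. Z s \<omega>" by (rule elim(2))
    have *: "\<bar>Z s \<omega>\<bar> \<le> E \<omega>" if "0 \<le> s" "s < T" for s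
      unfolding E_def by (rule path_bound[OF _ elim(3) that]) (use elim(1,3) in auto)
    have "((\<lambda>s. \<bar>Z s \<omega>\<bar>) \<longlongrightarrow> \<bar>Z T \<omega>\<bar>) (at_left T)"
      using elim(4) by (rule tendsto_rabs)
    moreover have "\<forall>\<^sub>F s in at_left T. \<bar>Z s \<omega>\<bar> \<le> E \<omega>"
      using eventually_at_left_real[OF T_pos] by eventually_elim (use * in auto)
    ultimately have "\<bar>Z T \<omega>\<bar> \<le> E \<omega>"
      by (rule tendsto_upperbound) simp
    then show ?case using * by (metis atLeastAtMost_iff order_le_less)
  qed
  with i show thesis by (rule that)
qed

lemma Z_integrable:
  assumes "0 \<le> s" "s \<le> T"
  shows "integrable M (Z s)"
proof -
  obtain D where D: "integrable M D" "AE \<omega> in M. \<forall>s\<in>{0..T}. \<bar>Z s \<omega>\<bar> \<le> D \<omega>" by (rule Z_dominated)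
  show ?thesis
    by (rule Bochner_Integration.integrable_bound[OF D(1) Z_measurable'[OF assms]])
      (use D(2) assms in \<open>auto elim!: eventually_mono intro: order_trans[OF _ abs_ge_self]\<close>)
qed

lemma space_gen [simp]: "space (generated_filtration M T Z s) = space M"
  unfolding generated_filtration_def by (rule space_measure_of) auto

lemma sets_gen:
  "sets (generated_filtration M T Z s) = sigma_sets (space M)
     {Z u -` A \<inter> space M |u A. 0 \<le> u \<and> u \<le> T \<and> u \<le> s \<and> A \<in> sets borel}"
  unfolding generated_filtration_def by (rule sets_measure_of) auto

lemma sets_gen_sub: "sets (generated_filtration M T Z s) \<subseteq> sets M"
  unfolding sets_gen by (rule sets.sigma_sets_subset) (use Z_measurable' in \<open>auto intro: measurable_sets\<close>)

lemma sets_gen_mono: "s \<le> u \<Longrightarrow> sets (generated_filtration M T Z s) \<subseteq> sets (generated_filtration M T Z u)"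
  unfolding sets_gen by (rule sigma_sets_mono') force

lemma Z_gen_measurable:
  assumes "0 \<le> u" "u \<le> s" "u \<le> T"
  shows "Z u \<in> borel_measurable (generated_filtration M T Z s)"
  by (rule measurableI) (use assms in \<open>auto simp: sets_gen intro!: sigma_sets.Basic\<close>)

abbreviation path :: "real \<Rightarrow> 'a \<Rightarrow> real \<Rightarrow> real" where
  "path s \<omega> \<equiv> \<lambda>i\<in>{0..s}. X i \<omega>"

lemma path_gen_measurable:
  assumes "s < T"
  shows "path s \<in> measurable (generated_filtration M T Z s) (Pi\<^sub>M {0..s} (\<lambda>_. borel))"
proof (rule measurable_restrict)
  fix i assume "i \<in> {0..s}"
  then have "Z i \<in> borel_measurable (generated_filtration M T Z s)"
    using assms by (intro Z_gen_measurable) auto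
  then show "X i \<in> borel_measurable (generated_filtration M T Z s)"
    unfolding X_def[abs_def] by measurable
qed

lemma path_measurable:
  assumes "s < T"
  shows "path s \<in> measurable M (Pi\<^sub>M {0..s} (\<lambda>_. borel))"
  by (rule measurable_restrict) (use assms X_measurable in auto)

text \<open>This makes a stopping rule portable: what is known at time \<open>s < T\<close> is a
  condition on the path of \<open>X\<close>, meaningful on any other probability space. It relies on
  the generated filtration; an event of the larger \<open>F s\<close> need not have this
  form.\<close>

lemma gen_path_event:
  assumes s: "s < T" and E: "E \<in> sets (generated_filtration M T Z s)"
  obtains C where "C \<in> sets (Pi\<^sub>M {0..s} (\<lambda>_. borel))" "E = {\<omega> \<in> space M. path s \<omega> \<in> C}"
proof -
  have "\<exists>C. C \<in> sets (Pi\<^sub>M {0..s} (\<lambda>_. borel :: real measure)) \<and> E = {\<omega> \<in> space M. path s \<omega> \<in> C}"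
    using E unfolding sets_gen
  proof (induction rule: sigma_sets.induct)
    case (Basic E)
    then obtain u A where u: "E = Z u -` A \<inter> space M" "0 \<le> u" "u \<le> T" "u \<le> s" "A \<in> sets borel" by auto
    let ?C = "(\<lambda>x. (T - u) * x u) -` A \<inter> space (Pi\<^sub>M {0..s} (\<lambda>_. borel :: real measure))"
    have "(\<lambda>x. x u) \<in> borel_measurable (Pi\<^sub>M {0..s} (\<lambda>_. borel :: real measure))"
      by (rule measurable_component_singleton) (use u in auto)
    then have "(\<lambda>x. (T - u) * x u) \<in> borel_measurable (Pi\<^sub>M {0..s} (\<lambda>_. borel :: real measure))"
      by measurable
    from measurable_sets[OF this u(5)] have "?C \<in> sets (Pi\<^sub>M {0..s} (\<lambda>_. borel))" .
    moreover have "E = {\<omega> \<in> space M. path s \<omega> \<in> ?C}"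
      using u s by (auto simp: X_def space_PiM)
    ultimately show ?case by blast
  next
    case Empty
    show ?case by (intro exI[of _ "{}"]) auto
  next
    case (Compl E)
    then obtain C where C: "C \<in> sets (Pi\<^sub>M {0..s} (\<lambda>_. borel :: real measure))" "E = {\<omega> \<in> space M. path s \<omega> \<in> C}"
      by blast
    have "space M - E = {\<omega> \<in> space M. path s \<omega> \<in> space (Pi\<^sub>M {0..s} (\<lambda>_. borel)) - C}"
      unfolding C(2) by (auto simp: space_PiM)
    with sets.compl_sets[OF C(1)] show ?case by (intro exI conjI)
  next
    case (Union E)
    obtain C where CE: "\<forall>i. C i \<in> sets (Pi\<^sub>M {0..s} (\<lambda>_. borel :: real measure)) \<and> E i = {\<omega> \<in> space M. path s \<omega> \<in> C i}"
      using choice[OF allI[OF Union.IH]] ..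
    note C = CE[rule_format, THEN conjunct1] CE[rule_format, THEN conjunct2]
    have "(\<Union>i. E i) = {\<omega> \<in> space M. path s \<omega> \<in> (\<Union>i. C i)}" unfolding C(2) by auto
    moreover have "(\<Union>i. C i) \<in> sets (Pi\<^sub>M {0..s} (\<lambda>_. borel))"
      using C(1) by (intro sets.countable_UN) blast
    ultimately show ?case by (intro exI conjI)
  qed
  then show thesis using that by blast
qed

section \<open>Discretised stopping times\<close>

lemma stopping_measurable:
  assumes "\<tau> \<in> admissible_times M T Z"
  shows "\<tau> \<in> borel_measurable M"
  by (rule measurable_stopping_time[of "generated_filtration M T Z"])
    (use assms sets_gen_sub in \<open>auto simp: admissible_times_def\<close>)

text \<open>Times are rounded up, so that having reached index \<open>k\<close> or less means having
  stopped by the \<open>k\<close>-th grid time, which is known at that time.\<close>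

definition ceil_index :: "nat \<Rightarrow> real \<Rightarrow> nat" where
  "ceil_index N s = nat \<lceil>real N * s / T\<rceil>"

lemma ceil_index:
  assumes "0 < N" "0 \<le> s" "s \<le> T"
  shows "ceil_index N s \<le> N" "s \<le> T * real (ceil_index N s) / real N"
    "T * real (ceil_index N s) / real N \<le> s + T / real N"
    "\<And>k. ceil_index N s \<le> k \<longleftrightarrow> s \<le> T * real k / real N"
proof -
  have nn: "0 \<le> real N * s / T" using assms T_pos by simp
  then have r: "real (ceil_index N s) = of_int \<lceil>real N * s / T\<rceil>" unfolding ceil_index_def by simp
  have "real N * s / T \<le> real N" using assms T_pos by (simp add: divide_le_eq mult_left_mono)
  then show "ceil_index N s \<le> N" unfolding ceil_index_def by (simp add: nat_le_iff ceiling_le_iff)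
  have "real N * s / T \<le> real (ceil_index N s)" unfolding r by simp
  then show "s \<le> T * real (ceil_index N s) / real N" using assms T_pos by (simp add: field_simps)
  have "real (ceil_index N s) \<le> real N * s / T + 1" unfolding r by linarith
  then show "T * real (ceil_index N s) / real N \<le> s + T / real N" using assms T_pos by (simp add: field_simps)
  show "ceil_index N s \<le> k \<longleftrightarrow> s \<le> T * real k / real N" for k
    unfolding ceil_index_def using assms T_pos by (simp add: nat_le_iff ceiling_le_iff field_simps)
qed

text \<open>Rounded times decrease to within \<open>T / Suc n\<close> of the original one, and
  continuity on \<open>[0, T)\<close> gives convergence of the stopped values. Where the original
  time is \<open>T\<close>, rounding is exact, so no exceptional set arises.\<close>

lemma grid_approximation:
  assumes \<tau>: "\<tau> \<in> admissible_times M T Z"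
  defines "\<sigma> \<equiv> \<lambda>n \<omega>. T * real (ceil_index (Suc n) (\<tau> \<omega>)) / real (Suc n)"
  shows "(\<lambda>n. \<integral>\<omega>. Z (\<sigma> n \<omega>) \<omega> \<partial>M) \<longlonglongrightarrow> (\<integral>\<omega>. Z (\<tau> \<omega>) \<omega> \<partial>M)"
    and "integrable M (\<lambda>\<omega>. Z (\<tau> \<omega>) \<omega>)" "integrable M (\<lambda>\<omega>. Z (\<sigma> n \<omega>) \<omega>)"
proof -
  note \<tau>m [measurable] = stopping_measurable[OF \<tau>]
  have \<tau>b: "0 \<le> \<tau> \<omega>" "\<tau> \<omega> \<le> T" if "\<omega> \<in> space M" for \<omega>
    using \<tau> that by (auto simp: admissible_times_def)
  have \<sigma>b: "\<tau> \<omega> \<le> \<sigma> n \<omega>" "\<sigma> n \<omega> \<le> \<tau> \<omega> + T / real (Suc n)" "\<sigma> n \<omega> \<le> T" if "\<omega> \<in> space M" for n \<omega>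
  proof -
    note c = ceil_index[of "Suc n" "\<tau> \<omega>", OF zero_less_Suc \<tau>b[OF that]]
    show "\<tau> \<omega> \<le> \<sigma> n \<omega>" "\<sigma> n \<omega> \<le> \<tau> \<omega> + T / real (Suc n)" using c(2,3) by (auto simp: \<sigma>_def)
    have "T * real (ceil_index (Suc n) (\<tau> \<omega>)) \<le> T * real (Suc n)"
      using c(1) T_pos by (intro mult_left_mono) auto
    then show "\<sigma> n \<omega> \<le> T" by (simp add: \<sigma>_def divide_le_eq)
  qed
  have \<sigma>m: "(\<lambda>\<omega>. Z (\<sigma> n \<omega>) \<omega>) \<in> borel_measurable M" for n
  proof -
    have "(\<lambda>\<omega>. ceil_index (Suc n) (\<tau> \<omega>)) \<in> measurable M (count_space UNIV)"
      unfolding ceil_index_def by measurable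
    \<comment> \<open>The countable composition runs over all natural indices, also those whose grid
      time would exceed \<open>T\<close>; the minimum makes those terms measurable too.\<close>
    moreover have "Z (min T (T * real i / real (Suc n))) \<in> borel_measurable M" for i
      using T_pos by (intro Z_measurable') auto
    ultimately have "(\<lambda>\<omega>. Z (min T (\<sigma> n \<omega>)) \<omega>) \<in> borel_measurable M"
      unfolding \<sigma>_def by (rule measurable_compose_countable[rotated])
    then show ?thesis
      by (rule measurable_cong[THEN iffD1, rotated]) (use \<sigma>b(3) in \<open>simp add: min_absorb2\<close>)
  qed
  have lim: "(\<lambda>n. Z (\<sigma> n \<omega>) \<omega>) \<longlonglongrightarrow> Z (\<tau> \<omega>) \<omega>" if \<omega>: "\<omega> \<in> space M" for \<omega>
  proof (cases "\<tau> \<omega> = T")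
    case True
    then have "\<sigma> n \<omega> = \<tau> \<omega>" for n using \<sigma>b[OF \<omega>, of n] by simp
    then show ?thesis by simp
  next
    case False
    then have lt: "\<tau> \<omega> < T" using \<tau>b[OF \<omega>] by simp
    have s: "(\<lambda>n. \<sigma> n \<omega>) \<longlonglongrightarrow> \<tau> \<omega>"
    proof (rule tendsto_sandwich[of "\<lambda>_. \<tau> \<omega>" _ _ "\<lambda>n. \<tau> \<omega> + T / real (Suc n)"])
      show "(\<lambda>n. \<tau> \<omega> + T / real (Suc n)) \<longlonglongrightarrow> \<tau> \<omega>" by real_asymp
    qed (use \<sigma>b[OF \<omega>] in auto)
    show ?thesis
    proof (rule continuous_on_tendsto_compose[OF Z_cont[OF \<omega>] s])
      show "\<forall>\<^sub>F n in sequentially. \<sigma> n \<omega> \<in> {0..<T}"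
        using order_tendstoD(2)[OF s lt] by eventually_elim (use \<sigma>b(1)[OF \<omega>] \<tau>b(1)[OF \<omega>] in \<open>auto intro: order_trans\<close>)
    qed (use lt \<tau>b[OF \<omega>] in auto)
  qed
  have m: "(\<lambda>\<omega>. Z (\<tau> \<omega>) \<omega>) \<in> borel_measurable M"
    by (rule borel_measurable_LIMSEQ_real[OF lim \<sigma>m])
  obtain D where D: "integrable M D" "AE \<omega> in M. \<forall>s\<in>{0..T}. \<bar>Z s \<omega>\<bar> \<le> D \<omega>" by (rule Z_dominated)
  have bd: "AE \<omega> in M. norm (Z (\<sigma> n \<omega>) \<omega>) \<le> D \<omega>" for n
    using D(2) AE_space
  proof eventually_elim
    case (elim \<omega>)
    have "\<sigma> n \<omega> \<in> {0..T}"
      using \<sigma>b(1,3)[OF elim(2), of n] \<tau>b(1)[OF elim(2)] by (auto simp only: atLeastAtMost_iff intro: order_trans)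
    with elim(1) show ?case by simp
  qed
  have l: "AE \<omega> in M. (\<lambda>n. Z (\<sigma> n \<omega>) \<omega>) \<longlonglongrightarrow> Z (\<tau> \<omega>) \<omega>" using AE_space by eventually_elim (rule lim)
  show "(\<lambda>n. \<integral>\<omega>. Z (\<sigma> n \<omega>) \<omega> \<partial>M) \<longlonglongrightarrow> (\<integral>\<omega>. Z (\<tau> \<omega>) \<omega> \<partial>M)"
    by (rule integral_dominated_convergence[OF m \<sigma>m D(1) l bd])
  show "integrable M (\<lambda>\<omega>. Z (\<tau> \<omega>) \<omega>)"
    by (rule integrable_dominated_convergence[OF m \<sigma>m D(1) l bd])
  show "integrable M (\<lambda>\<omega>. Z (\<sigma> n \<omega>) \<omega>)"
    by (rule integrable_dominated_convergence2[OF m \<sigma>m D(1) l bd])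
qed

text \<open>The value is a supremum of reals, which bounds its members only once the set is bounded
  above.\<close>

lemma stopped_bdd_above: "bdd_above ((\<lambda>\<tau>. \<integral>\<omega>. Z (\<tau> \<omega>) \<omega> \<partial>M) ` admissible_times M T Z)"
proof -
  obtain D where D: "integrable M D" "AE \<omega> in M. \<forall>s\<in>{0..T}. \<bar>Z s \<omega>\<bar> \<le> D \<omega>" by (rule Z_dominated)
  have "(\<integral>\<omega>. Z (\<tau> \<omega>) \<omega> \<partial>M) \<le> (\<integral>\<omega>. D \<omega> \<partial>M)" if "\<tau> \<in> admissible_times M T Z" for \<tau>
  proof (rule integral_mono_AE[OF grid_approximation(2)[OF that] D(1)])
    show "AE \<omega> in M. Z (\<tau> \<omega>) \<omega> \<le> D \<omega>"
      using D(2) AE_space by eventually_elim (use that in \<open>auto simp: admissible_times_def abs_le_iff\<close>)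
  qed
  then show ?thesis by (auto simp: bdd_above_def)
qed

lemma const_admissible: "0 \<le> c \<Longrightarrow> c \<le> T \<Longrightarrow> (\<lambda>_. c) \<in> admissible_times M T Z"
  by (simp add: admissible_times_def stopping_time_const)

text \<open>The payoff \<open>f\<close> may depend on the outcome, so that a reward already
  collected before the end can be combined with the still open terminal value.\<close>

lemma mean_limit_at_end:
  assumes f: "\<And>\<omega>. \<omega> \<in> space M \<Longrightarrow> continuous_on UNIV (f \<omega>)" "\<And>s. 0 \<le> s \<Longrightarrow> s \<le> T \<Longrightarrow> (\<lambda>\<omega>. f \<omega> (Z s \<omega>)) \<in> borel_measurable M"
    and g: "integrable M g" "\<And>\<omega> x. \<omega> \<in> space M \<Longrightarrow> \<bar>f \<omega> x\<bar> \<le> \<bar>g \<omega>\<bar> + \<bar>x\<bar>"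
    and u: "u \<longlonglongrightarrow> T" "\<And>n. 0 \<le> u n \<and> u n < T"
  shows "(\<lambda>n. \<integral>\<omega>. f \<omega> (Z (u n) \<omega>) \<partial>M) \<longlonglongrightarrow> (\<integral>\<omega>. f \<omega> (Z T \<omega>) \<partial>M)"
    and "integrable M (\<lambda>\<omega>. f \<omega> (Z (u n) \<omega>))" "integrable M (\<lambda>\<omega>. f \<omega> (Z T \<omega>))"
proof -
  obtain D where D: "integrable M D" "AE \<omega> in M. \<forall>s\<in>{0..T}. \<bar>Z s \<omega>\<bar> \<le> D \<omega>" by (rule Z_dominated)
  have i: "integrable M (\<lambda>\<omega>. \<bar>g \<omega>\<bar> + D \<omega>)" using g(1) D(1) by simp
  have bd: "AE \<omega> in M. norm (f \<omega> (Z (u n) \<omega>)) \<le> \<bar>g \<omega>\<bar> + D \<omega>" for n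
    using D(2) AE_space
  proof eventually_elim
    case (elim \<omega>)
    then have "\<bar>Z (u n) \<omega>\<bar> \<le> D \<omega>" using u(2)[of n] by (simp add: less_imp_le)
    with g(2)[OF elim(2), of "Z (u n) \<omega>"] show ?case by simp
  qed
  have fl: "filterlim u (at_left T) sequentially"
    unfolding filterlim_at using u by (auto intro!: always_eventually)
  have l: "AE \<omega> in M. (\<lambda>n. f \<omega> (Z (u n) \<omega>)) \<longlonglongrightarrow> f \<omega> (Z T \<omega>)"
    using ZT_limit AE_space
  proof eventually_elim
    case (elim \<omega>)
    have "(\<lambda>n. Z (u n) \<omega>) \<longlonglongrightarrow> Z T \<omega>" by (rule filterlim_compose[OF elim(1) fl])
    then show ?case by (rule continuous_on_tendsto_compose[OF f(1)[OF elim(2)]]) auto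
  qed
  have m: "(\<lambda>\<omega>. f \<omega> (Z T \<omega>)) \<in> borel_measurable M" using f(2)[of T] T_pos by simp
  have m': "(\<lambda>\<omega>. f \<omega> (Z (u n) \<omega>)) \<in> borel_measurable M" for n using f(2)[of "u n"] u(2)[of n] by simp
  show "(\<lambda>n. \<integral>\<omega>. f \<omega> (Z (u n) \<omega>) \<partial>M) \<longlonglongrightarrow> (\<integral>\<omega>. f \<omega> (Z T \<omega>) \<partial>M)"
    by (rule integral_dominated_convergence[OF m m' i l bd])
  show "integrable M (\<lambda>\<omega>. f \<omega> (Z T \<omega>))" by (rule integrable_dominated_convergence[OF m m' i l bd])
  show "integrable M (\<lambda>\<omega>. f \<omega> (Z (u n) \<omega>))" by (rule integrable_dominated_convergence2[OF m m' i l bd])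
qed

end

text \<open>The definition of the bridge asks only for some terminal limit. With
  \<open>\<kappa> = 0\<close> the weight is constantly 1, and the estimate of the distance to the
  pin identifies this limit.\<close>

lemma full_bridge_end_at_pin:
  assumes "full_bridge M F T W Z \<rho> 0 z"
  shows "AE \<omega> in M. Z T \<omega> = \<rho>"
proof -
  interpret full_bridge M F T W Z \<rho> 0 z by fact
  have wt1: "wt u \<omega> = 1" "wt0 = 1" for u \<omega> by (auto simp: logit_weight_def wt0_def)
  define u where "u n = T - T / real (Suc n)" for n
  have u: "u \<longlonglongrightarrow> T" unfolding u_def by real_asymp
  have u': "0 \<le> u n \<and> u n < T" for n
    using T_pos unfolding u_def by (simp add: field_simps)
  have i: "integrable M (\<lambda>_. \<rho>)" by simp
  have m: "(\<lambda>\<omega>. \<bar>Z s \<omega> - \<rho>\<bar>) \<in> borel_measurable M" if "0 \<le> s" "s \<le> T" for s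
    using Z_measurable'[OF that] by measurable
  have c: "continuous_on UNIV (\<lambda>x. \<bar>x - \<rho>\<bar>)" by (intro continuous_intros)
  have b: "\<bar>\<bar>x - \<rho>\<bar>\<bar> \<le> \<bar>\<rho>\<bar> + \<bar>x\<bar>" for x by linarith
  note lim = mean_limit_at_end[where f = "\<lambda>_ x. \<bar>x - \<rho>\<bar>", OF c m i b u u']
  have "(\<integral>\<omega>. \<bar>Z T \<omega> - \<rho>\<bar> \<partial>M) \<le> 0"
  proof (rule LIMSEQ_le[OF lim(1)])
    show "(\<lambda>n. sqrt (T - u n) + (T - u n) * \<bar>z - \<rho>\<bar> / T) \<longlonglongrightarrow> 0"
      by (rule tendsto_eq_intros u refl | use T_pos in simp)+
    show "\<exists>N. \<forall>n\<ge>N. (\<integral>\<omega>. \<bar>Z (u n) \<omega> - \<rho>\<bar> \<partial>M) \<le> sqrt (T - u n) + (T - u n) * \<bar>z - \<rho>\<bar> / T"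
      using weighted_distance_to_pin(2)[of "u n" for n] u' unfolding wt1 by auto
  qed
  then have "(\<integral>\<omega>. \<bar>Z T \<omega> - \<rho>\<bar> \<partial>M) = 0"
    by (intro antisym Bochner_Integration.integral_nonneg) auto
  then have "AE \<omega> in M. \<bar>Z T \<omega> - \<rho>\<bar> = 0"
    using integral_nonneg_eq_0_iff_AE[OF lim(3)] by simp
  then show ?thesis by eventually_elim simp
qed

subsection \<open>Transport of stopping rules\<close>

definition grid :: "real \<Rightarrow> nat \<Rightarrow> nat \<Rightarrow> real" where
  "grid T N k = T * real k / real N"

text \<open>The set \<open>C k\<close> collects the paths on which the given rule stops at grid
  point \<open>k\<close>. The argument is a path of the scaled process, so multiplying by the
  remaining time recovers \<open>Z\<close>; the second condition is the improvement that forbids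
  stopping below \<open>r\<close>.\<close>

definition hits :: "real \<Rightarrow> nat \<Rightarrow> real \<Rightarrow> (nat \<Rightarrow> (real \<Rightarrow> real) set) \<Rightarrow> nat \<Rightarrow> (real \<Rightarrow> real) \<Rightarrow> bool" where
  "hits T N r C k x \<longleftrightarrow> restrict x {0..grid T N k} \<in> C k \<and> r \<le> (T - grid T N k) * x (grid T N k)"

text \<open>The excess over \<open>r\<close> earned at the first hit, written as a function on path
  space so that its mean is determined by the law of the path. Only indices below \<open>N\<close>
  occur: the functional reads the path strictly before \<open>T\<close>, where the laws can be
  compared.\<close>

definition gain :: "real \<Rightarrow> nat \<Rightarrow> real \<Rightarrow> (nat \<Rightarrow> (real \<Rightarrow> real) set) \<Rightarrow> (real \<Rightarrow> real) \<Rightarrow> real" where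
  "gain T N r C x = (\<Sum>k<N. if hits T N r C k x \<and> (\<forall>j<k. \<not> hits T N r C j x)
      then (T - grid T N k) * x (grid T N k) - r else 0)"

lemma gain_first:
  assumes "k < N" "hits T N r C k x" "\<And>j. j < k \<Longrightarrow> \<not> hits T N r C j x"
  shows "gain T N r C x = (T - grid T N k) * x (grid T N k) - r"
proof -
  have "gain T N r C x = (\<Sum>i<N. if i = k then (T - grid T N k) * x (grid T N k) - r else 0)"
    unfolding gain_def
  proof (rule sum.cong[OF refl])
    fix i
    have "hits T N r C i x \<and> (\<forall>j<i. \<not> hits T N r C j x) \<longleftrightarrow> i = k"
      using assms(2,3) by (metis linorder_neqE_nat)
    then show "(if hits T N r C i x \<and> (\<forall>j<i. \<not> hits T N r C j x) then (T - grid T N i) * x (grid T N i) - r else 0)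
        = (if i = k then (T - grid T N k) * x (grid T N k) - r else 0)" by simp
  qed
  then show ?thesis using assms(1) by simp
qed

lemma gain_no_hit:
  assumes "\<And>k. k < N \<Longrightarrow> \<not> hits T N r C k x"
  shows "gain T N r C x = 0"
  unfolding gain_def by (rule sum.neutral) (use assms in auto)

lemma gain_nonneg: "0 \<le> gain T N r C x"
  unfolding gain_def by (rule sum_nonneg) (auto simp: hits_def)

lemma abs_gain_le:
  "\<bar>gain T N r C x\<bar> \<le> (\<Sum>k<N. \<bar>(T - grid T N k) * x (grid T N k)\<bar> + \<bar>r\<bar>)"
  unfolding gain_def by (rule order_trans[OF sum_abs]) (intro sum_mono, auto)

context full_bridge
begin

lemma grid_bounds:
  assumes "0 < N"
  shows "0 \<le> grid T N k" "k < N \<Longrightarrow> grid T N k < T" "i \<le> j \<Longrightarrow> grid T N i \<le> grid T N j"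
    "k < N \<Longrightarrow> grid T N k \<le> grid T N (N - 1)" "grid T N N = T"
proof -
  show "0 \<le> grid T N k" using T_pos by (simp add: grid_def)
  show "grid T N k < T" if "k < N" using that T_pos by (simp add: grid_def divide_less_eq)
  show mono: "grid T N i \<le> grid T N j" if "i \<le> j" for i j
    using that T_pos by (auto simp: grid_def intro!: divide_right_mono mult_left_mono)
  show "grid T N k \<le> grid T N (N - 1)" if "k < N" using that by (intro mono) simp
  show "grid T N N = T" using assms by (simp add: grid_def)
qed

context
  fixes N :: nat and r :: real and C :: "nat \<Rightarrow> (real \<Rightarrow> real) set"
  assumes N: "0 < N" and C: "\<And>k. k < N \<Longrightarrow> C k \<in> sets (Pi\<^sub>M {0..grid T N k} (\<lambda>_. borel))"
begin

lemma hits_path: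
  assumes "k < N" "grid T N (N - 1) \<le> u"
  shows "hits T N r C k (path u \<omega>) \<longleftrightarrow> path (grid T N k) \<omega> \<in> C k \<and> r \<le> Z (grid T N k) \<omega>"
proof -
  note g = grid_bounds[OF N]
  have le: "grid T N k \<le> u" using g(4)[OF assms(1)] assms(2) by linarith
  then have "restrict (path u \<omega>) {0..grid T N k} = path (grid T N k) \<omega>" by (auto simp: restrict_def fun_eq_iff)
  moreover have "(T - grid T N k) * path u \<omega> (grid T N k) = Z (grid T N k) \<omega>"
    using le g(1)[of k] g(2)[OF assms(1)] by (simp add: X_def)
  ultimately show ?thesis by (simp add: hits_def)
qed

lemma hits_event:
  assumes "k < N" "grid T N (N - 1) \<le> u"
  shows "{\<omega> \<in> space M. hits T N r C k (path u \<omega>)} \<in> sets (generated_filtration M T Z (grid T N k))"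
proof -
  note g = grid_bounds(1,2)[OF N, of k]
  have "path (grid T N k) -` C k \<inter> space M \<in> sets (generated_filtration M T Z (grid T N k))"
    using measurable_sets[OF path_gen_measurable C[OF assms(1)]] g(2)[OF assms(1)] by simp
  moreover have Zm: "Z (grid T N k) \<in> borel_measurable (generated_filtration M T Z (grid T N k))"
    using g assms(1) by (intro Z_gen_measurable) auto
  have "Z (grid T N k) -` {r..} \<inter> space M \<in> sets (generated_filtration M T Z (grid T N k))"
    using measurable_sets[OF Zm, of "{r..}"] by simp
  ultimately have "(path (grid T N k) -` C k \<inter> space M) \<inter> (Z (grid T N k) -` {r..} \<inter> space M)
      \<in> sets (generated_filtration M T Z (grid T N k))" by (rule sets.Int)
  also have "(path (grid T N k) -` C k \<inter> space M) \<inter> (Z (grid T N k) -` {r..} \<inter> space M)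
      = {\<omega> \<in> space M. hits T N r C k (path u \<omega>)}"
    by (auto simp: hits_path[OF assms])
  finally show ?thesis .
qed

lemma gain_measurable:
  assumes "grid T N (N - 1) \<le> u"
  shows "gain T N r C \<in> borel_measurable (Pi\<^sub>M {0..u} (\<lambda>_. borel))"
proof -
  note g = grid_bounds[OF N]
  have comp: "(\<lambda>x. (T - grid T N k) * x (grid T N k)) \<in> borel_measurable (Pi\<^sub>M {0..u} (\<lambda>_. borel))" if "k < N" for k
    using g(1)[of k] g(4)[OF that] assms
    by (intro borel_measurable_times borel_measurable_const measurable_component_singleton) auto
  have h: "Measurable.pred (Pi\<^sub>M {0..u} (\<lambda>_. borel)) (hits T N r C k)" if "k < N" for k
  proof -
    have "(\<lambda>x. restrict x {0..grid T N k}) \<in> measurable (Pi\<^sub>M {0..u} (\<lambda>_. borel :: real measure)) (Pi\<^sub>M {0..grid T N k} (\<lambda>_. borel))"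
      by (rule measurable_restrict_subset) (use g(4)[OF that] assms in auto)
    from pred_sets2[OF C[OF that] this] comp[OF that]
    show ?thesis unfolding hits_def by measurable
  qed
  show ?thesis unfolding gain_def
  proof (intro borel_measurable_sum measurable_If borel_measurable_diff comp borel_measurable_const)
    fix k assume "k \<in> {..<N}"
    then have "Measurable.pred (Pi\<^sub>M {0..u} (\<lambda>_. borel)) (\<lambda>x. hits T N r C k x \<and> (\<forall>j\<in>{..<k}. \<not> hits T N r C j x))"
      by (intro pred_intros_logic pred_intros_finite h) auto
    then show "{x \<in> space (Pi\<^sub>M {0..u} (\<lambda>_. borel)). hits T N r C k x \<and> (\<forall>j<k. \<not> hits T N r C j x)} \<in> sets (Pi\<^sub>M {0..u} (\<lambda>_. borel))"
      by (simp add: pred_def lessThan_def)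
  qed auto
qed

lemma gain_path_measurable:
  assumes "grid T N (N - 1) \<le> u" "u < T"
  shows "(\<lambda>\<omega>. gain T N r C (path u \<omega>)) \<in> borel_measurable M"
  by (rule measurable_compose[OF path_measurable[OF assms(2)] gain_measurable[OF assms(1)]])

lemma gain_path_integrable:
  assumes "grid T N (N - 1) \<le> u" "u < T"
  shows "integrable M (\<lambda>\<omega>. gain T N r C (path u \<omega>))"
proof (rule Bochner_Integration.integrable_bound)
  note g = grid_bounds[OF N]
  show "integrable M (\<lambda>\<omega>. \<Sum>k<N. \<bar>Z (grid T N k) \<omega>\<bar> + \<bar>r\<bar>)"
    using g(1,2) by (intro Bochner_Integration.integrable_sum Bochner_Integration.integrable_add
        integrable_abs Z_integrable integrable_const) (auto simp: less_imp_le)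
  have "\<bar>gain T N r C (path u \<omega>)\<bar> \<le> (\<Sum>k<N. \<bar>Z (grid T N k) \<omega>\<bar> + \<bar>r\<bar>)" for \<omega>
  proof -
    have "(T - grid T N k) * path u \<omega> (grid T N k) = Z (grid T N k) \<omega>" if "k < N" for k
      using g(1)[of k] g(2)[OF that] g(4)[OF that] assms by (simp add: X_def)
    then show ?thesis using abs_gain_le[of T N r C "path u \<omega>"] by simp
  qed
  then show "AE \<omega> in M. norm (gain T N r C (path u \<omega>)) \<le> norm (\<Sum>k<N. \<bar>Z (grid T N k) \<omega>\<bar> + \<bar>r\<bar>)"
    by (auto intro!: AE_I2 order_trans[OF _ abs_ge_self])
qed (rule gain_path_measurable[OF assms])

lemma gain_path_cong:
  assumes "grid T N (N - 1) \<le> u" "grid T N (N - 1) \<le> v"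
  shows "gain T N r C (path u \<omega>) = gain T N r C (path v \<omega>)"
proof -
  note g = grid_bounds[OF N]
  have "path u \<omega> (grid T N k) = path v \<omega> (grid T N k)" if "k < N" for k
    using g(1)[of k] g(4)[OF that] assms by simp
  moreover have "hits T N r C k (path u \<omega>) \<longleftrightarrow> hits T N r C k (path v \<omega>)" if "k < N" for k
    using hits_path[OF that assms(1)] hits_path[OF that assms(2)] by simp
  ultimately show ?thesis unfolding gain_def by (intro sum.cong) auto
qed

text \<open>Without a hit the rule waits for the terminal value, hence the default
  \<open>T\<close>.\<close>

definition hit_time :: "'a \<Rightarrow> real" where
  "hit_time \<omega> = (if \<exists>k<N. hits T N r C k (path (grid T N (N - 1)) \<omega>)
     then grid T N (LEAST k. k < N \<and> hits T N r C k (path (grid T N (N - 1)) \<omega>)) else T)"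

lemma stopped_at_hit_time:
  "Z (hit_time \<omega>) \<omega> = (if \<exists>k<N. hits T N r C k (path (grid T N (N - 1)) \<omega>)
     then gain T N r C (path (grid T N (N - 1)) \<omega>) + r else Z T \<omega>)"
proof (cases "\<exists>k<N. hits T N r C k (path (grid T N (N - 1)) \<omega>)")
  case True
  let ?x = "path (grid T N (N - 1)) \<omega>"
  define k where "k = (LEAST k. k < N \<and> hits T N r C k ?x)"
  have k: "k < N" "hits T N r C k ?x" using LeastI_ex[OF True] by (auto simp: k_def)
  have "\<not> hits T N r C j ?x" if "j < k" for j
    using not_less_Least[OF that[unfolded k_def]] that k(1) by auto
  from gain_first[OF k this] have "gain T N r C ?x + r = (T - grid T N k) * ?x (grid T N k)" by simp
  also have "\<dots> = Z (grid T N k) \<omega>"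
    using grid_bounds(1)[OF N, of k] grid_bounds(2,4)[OF N k(1)] by (simp add: X_def)
  finally show ?thesis using True by (simp add: hit_time_def k_def)
qed (auto simp: hit_time_def)

text \<open>The definition mentions the path up to the last grid point before \<open>T\<close>, yet
  a hit at \<open>k\<close> is decided by the path up to that grid point. Before \<open>T\<close>,
  having stopped by time \<open>s\<close> is a finite union of such events.\<close>

lemma hit_time_admissible: "hit_time \<in> admissible_times M T Z"
proof -
  note g = grid_bounds[OF N]
  let ?h = "\<lambda>k \<omega>. hits T N r C k (path (grid T N (N - 1)) \<omega>)"
  have le: "hit_time \<omega> \<le> T" "0 \<le> hit_time \<omega>" for \<omega>
  proof -
    have "grid T N (LEAST k. k < N \<and> ?h k \<omega>) \<le> T" if "\<exists>k<N. ?h k \<omega>"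
      using g(2) LeastI_ex[OF that] by (auto simp: less_imp_le)
    then show "hit_time \<omega> \<le> T" by (simp add: hit_time_def)
    show "0 \<le> hit_time \<omega>" using g(1) T_pos by (simp add: hit_time_def)
  qed
  have iff: "hit_time \<omega> \<le> s \<longleftrightarrow> (\<exists>k\<in>{k. k < N \<and> grid T N k \<le> s}. ?h k \<omega>)" if s: "s < T" for s \<omega>
  proof
    assume a: "hit_time \<omega> \<le> s"
    then have ex: "\<exists>k<N. ?h k \<omega>" using s by (auto simp: hit_time_def split: if_splits)
    define k where "k = (LEAST k. k < N \<and> ?h k \<omega>)"
    have "k < N \<and> ?h k \<omega>" unfolding k_def by (rule LeastI_ex[OF ex])
    moreover have "hit_time \<omega> = grid T N k" using ex by (simp add: hit_time_def k_def)
    ultimately show "\<exists>k\<in>{k. k < N \<and> grid T N k \<le> s}. ?h k \<omega>" using a by auto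
  next
    assume "\<exists>k\<in>{k. k < N \<and> grid T N k \<le> s}. ?h k \<omega>"
    then obtain k where k: "k < N" "grid T N k \<le> s" "?h k \<omega>" by auto
    then have "hit_time \<omega> = grid T N (LEAST k. k < N \<and> ?h k \<omega>)" by (auto simp: hit_time_def)
    also have "\<dots> \<le> grid T N k" by (intro g(3) Least_le) (use k in simp)
    finally show "hit_time \<omega> \<le> s" using k by simp
  qed
  have "stopping_time (generated_filtration M T Z) hit_time"
  proof (rule stopping_timeI)
    fix s
    show "Measurable.pred (generated_filtration M T Z s) (\<lambda>\<omega>. hit_time \<omega> \<le> s)"
    proof (cases "s < T")
      case True
      have "{\<omega> \<in> space M. ?h k \<omega>} \<in> sets (generated_filtration M T Z s)" if "k < N" "grid T N k \<le> s" for k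
        using hits_event[OF that(1) order_refl] sets_gen_mono[OF that(2)] by blast
      then show ?thesis unfolding iff[OF True]
        by (intro pred_intros_finite) (auto simp: pred_def)
    next
      case False
      then have "hit_time \<omega> \<le> s" for \<omega> using le(1)[of \<omega>] by simp
      then show ?thesis by simp
    qed
  qed
  with le show ?thesis by (simp add: admissible_times_def)
qed

end

lemma ceil_index_event:
  assumes \<tau>: "\<tau> \<in> admissible_times M T Z" and N: "0 < N"
  shows "{\<omega> \<in> space M. ceil_index N (\<tau> \<omega>) = k} \<in> sets (generated_filtration M T Z (grid T N k))"
proof -
  have st: "stopping_time (generated_filtration M T Z) \<tau>" and b: "\<And>\<omega>. \<omega> \<in> space M \<Longrightarrow> 0 \<le> \<tau> \<omega> \<and> \<tau> \<omega> \<le> T"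
    using \<tau> by (auto simp: admissible_times_def)
  have le: "{\<omega> \<in> space M. ceil_index N (\<tau> \<omega>) \<le> k} \<in> sets (generated_filtration M T Z (grid T N k))" for k
  proof -
    have "{\<omega> \<in> space M. ceil_index N (\<tau> \<omega>) \<le> k} = {\<omega> \<in> space M. \<tau> \<omega> \<le> grid T N k}"
      using b ceil_index(4)[OF N] by (auto simp: grid_def)
    then show ?thesis using stopping_timeD[OF st, of "grid T N k"] by (simp add: pred_def)
  qed
  show ?thesis
  proof (cases k)
    case 0
    then show ?thesis using le[of 0] by simp
  next
    case (Suc j)
    have "{\<omega> \<in> space M. ceil_index N (\<tau> \<omega>) = k}
        = {\<omega> \<in> space M. ceil_index N (\<tau> \<omega>) \<le> k} - {\<omega> \<in> space M. ceil_index N (\<tau> \<omega>) \<le> j}"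
      using Suc by auto
    moreover have "{\<omega> \<in> space M. ceil_index N (\<tau> \<omega>) \<le> j} \<in> sets (generated_filtration M T Z (grid T N k))"
      using le[of j] sets_gen_mono[OF grid_bounds(3)[OF N, of j k]] Suc by auto
    ultimately show ?thesis using le[of k] by (simp add: sets.Diff)
  qed
qed

end

text \<open>The competing strategy stops with the transported rule only where the bridge is above \<open>r\<close>,
  and otherwise waits until the end: for the pinning point \<open>r\<close> this loses nothing, and for
  the pinning point \<open>- r\<close> it guarantees at least \<open>- r\<close>.\<close>

lemma stopping_transfer:
  assumes A: "full_bridge M F T W Z r \<kappa> z" and B: "full_bridge M' F' T W' Z' r 0 z"
    and \<kappa>: "0 < \<kappa>" and r: "0 < r" and \<tau>: "\<tau> \<in> admissible_times M' T Z'" and N: "0 < N"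
  defines "q \<equiv> logit_weight r \<kappa> (z / T)"
  obtains \<tau>' where "\<tau>' \<in> admissible_times M T Z"
    "q * (\<integral>\<omega>. Z' (T * real (full_bridge.ceil_index T N (\<tau> \<omega>)) / real N) \<omega> \<partial>M') - (1 - q) * r
       \<le> (\<integral>\<omega>. Z (\<tau>' \<omega>) \<omega> \<partial>M)"
proof -
  interpret a: full_bridge M F T W Z r \<kappa> z by fact
  interpret b: full_bridge M' F' T W' Z' r 0 z by fact
  interpret c: drift_bridge M F T W Z "- r" "1 / \<kappa>" z
    by (rule drift_bridge_flip[OF _ \<kappa>]) unfold_locales
  note g = a.grid_bounds[OF N]
  define t where "t = grid T N (N - 1)"
  have t: "0 \<le> t" "t < T" "grid T N (N - 1) \<le> t" using g N by (auto simp: t_def)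
  define I where "I \<omega> = b.ceil_index N (\<tau> \<omega>)" for \<omega>
  \<comment> \<open>Only indices below \<open>N\<close> become path events. Index \<open>N\<close>
    means stopping at the end, where the scaled path has no meaning; it corresponds to never
    hitting.\<close>
  have "\<forall>k. \<exists>C. k < N \<longrightarrow> C \<in> sets (Pi\<^sub>M {0..grid T N k} (\<lambda>_. borel :: real measure))
      \<and> {\<omega> \<in> space M'. I \<omega> = k} = {\<omega> \<in> space M'. b.path (grid T N k) \<omega> \<in> C}"
  proof
    fix k
    show "\<exists>C. k < N \<longrightarrow> C \<in> sets (Pi\<^sub>M {0..grid T N k} (\<lambda>_. borel :: real measure))
      \<and> {\<omega> \<in> space M'. I \<omega> = k} = {\<omega> \<in> space M'. b.path (grid T N k) \<omega> \<in> C}"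
    proof (cases "k < N")
      case True
      from b.gen_path_event[OF g(2)[OF True] b.ceil_index_event[OF \<tau> N, of k]]
      obtain C where "C \<in> sets (Pi\<^sub>M {0..grid T N k} (\<lambda>_. borel :: real measure))"
        "{\<omega> \<in> space M'. I \<omega> = k} = {\<omega> \<in> space M'. b.path (grid T N k) \<omega> \<in> C}"
        unfolding I_def by blast
      then show ?thesis by blast
    qed simp
  qed
  from choice[OF this] obtain C where CC: "\<forall>k. k < N \<longrightarrow> C k \<in> sets (Pi\<^sub>M {0..grid T N k} (\<lambda>_. borel :: real measure))
      \<and> {\<omega> \<in> space M'. I \<omega> = k} = {\<omega> \<in> space M'. b.path (grid T N k) \<omega> \<in> C k}" ..
  then have C: "\<And>k. k < N \<Longrightarrow> C k \<in> sets (Pi\<^sub>M {0..grid T N k} (\<lambda>_. borel :: real measure))"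
    and I: "\<And>k \<omega>. k < N \<Longrightarrow> \<omega> \<in> space M' \<Longrightarrow> I \<omega> = k \<longleftrightarrow> b.path (grid T N k) \<omega> \<in> C k"
    by (blast, blast)
  let ?G = "gain T N r C"
  \<comment> \<open>The improvement loses nothing on the bridge with known pin: waiting gives
    exactly \<open>r\<close>, stopping above \<open>r\<close> is kept, and stopping below
    \<open>r\<close> is replaced by waiting for \<open>r\<close>.\<close>
  have low: "(\<integral>\<omega>. Z' (grid T N (I \<omega>)) \<omega> \<partial>M') \<le> r + (\<integral>\<omega>. ?G (b.path t \<omega>) \<partial>M')"
  proof -
    have int: "integrable M' (\<lambda>\<omega>. Z' (grid T N (I \<omega>)) \<omega>)"
      using b.grid_approximation(3)[OF \<tau>, of "N - 1"] N by (simp add: I_def grid_def)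
    have gi: "integrable M' (\<lambda>\<omega>. ?G (b.path t \<omega>))"
      by (rule b.gain_path_integrable[OF N C t(3,2)])
    have "(\<integral>\<omega>. Z' (grid T N (I \<omega>)) \<omega> \<partial>M') \<le> (\<integral>\<omega>. r + ?G (b.path t \<omega>) \<partial>M')"
    proof (rule integral_mono_AE[OF int])
      show "AE \<omega> in M'. Z' (grid T N (I \<omega>)) \<omega> \<le> r + ?G (b.path t \<omega>)"
        using full_bridge_end_at_pin[OF B] AE_space
      proof eventually_elim
        case (elim \<omega>)
        have h: "hits T N r C k (b.path t \<omega>) \<longleftrightarrow> I \<omega> = k \<and> r \<le> Z' (grid T N k) \<omega>" if "k < N" for k
          using b.hits_path[OF N C that t(3)] I[OF that elim(2)] by simp
        have "I \<omega> \<le> N" using b.ceil_index(1)[OF N] \<tau> elim(2) by (auto simp: I_def admissible_times_def)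
        then consider "I \<omega> = N" | "I \<omega> < N" "r \<le> Z' (grid T N (I \<omega>)) \<omega>" | "I \<omega> < N" "Z' (grid T N (I \<omega>)) \<omega> < r"
          by linarith
        then show ?case
        proof cases
          case 1
          then have e: "?G (b.path t \<omega>) = 0" using h by (intro gain_no_hit) auto
          show ?thesis unfolding e using 1 elim(1) by (simp add: g(5))
        next
          case 2
          then have "?G (b.path t \<omega>) = (T - grid T N (I \<omega>)) * b.path t \<omega> (grid T N (I \<omega>)) - r"
            using h by (intro gain_first) auto
          also have "(T - grid T N (I \<omega>)) * b.path t \<omega> (grid T N (I \<omega>)) = Z' (grid T N (I \<omega>)) \<omega>"
            using g(1)[of "I \<omega>"] g(2,4)[OF 2(1)] by (simp add: b.X_def t_def)
          finally have e: "?G (b.path t \<omega>) = Z' (grid T N (I \<omega>)) \<omega> - r" .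
          show ?thesis unfolding e by simp
        next
          case 3
          then have e: "?G (b.path t \<omega>) = 0" using h by (intro gain_no_hit) auto
          show ?thesis unfolding e using 3 by simp
        qed
      qed
    qed (use gi in simp)
    also have "\<dots> = r + (\<integral>\<omega>. ?G (b.path t \<omega>) \<partial>M')" using gi by (simp add: b.prob_space)
    finally show ?thesis .
  qed
  have q: "a.wt0 = q" "c.wt0 = 1 - q"
    unfolding a.wt0_def c.wt0_def q_def logit_weight_flip[OF \<kappa>] by simp_all
  have q0: "0 < q" "q \<le> 1" unfolding q_def by (rule logit_weight_bounds[OF a.\<kappa>])+
  have cwt: "c.wt u \<omega> = 1 - a.wt u \<omega>" for u \<omega> by (rule logit_weight_flip[OF \<kappa>])
  define H where "H = (\<integral>\<omega>. ?G (b.path t \<omega>) \<partial>M')"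
  \<comment> \<open>Weighting by the posterior passes to the tilted measure, whose path law is that
    of the bridge pinned at \<open>r\<close>, itself of constant weight 1. The value
    \<open>H\<close> is the same for all \<open>u\<close>, since the gain reads the path only up to
    \<open>t\<close>.\<close>
  have law: "(\<integral>\<omega>. a.wt u \<omega> * ?G (a.path u \<omega>) \<partial>M) = q * H" if u: "t \<le> u" "u < T" for u
  proof -
    have u0: "0 \<le> u" using u t by simp
    have gu: "grid T N (N - 1) \<le> u" using u by (simp add: t_def)
    have bw: "b.wt u \<omega> = 1" "b.wt0 = 1" for \<omega> by (simp_all add: b.wt0_def logit_weight_def)
    note gm = a.gain_measurable[OF N C gu, of r]
    have sub: "{0..u} \<subseteq> {0..<T}" using u by auto
    have ag: "(\<lambda>\<omega>. ?G (a.path u \<omega>)) \<in> borel_measurable M" by (rule a.gain_path_measurable[OF N C gu u(2)])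
    have bg: "(\<lambda>\<omega>. ?G (b.path u \<omega>)) \<in> borel_measurable M'" by (rule b.gain_path_measurable[OF N C gu u(2)])
    have "(\<integral>\<omega>. a.wt u \<omega> * ?G (a.path u \<omega>) \<partial>M) = q * (\<integral>\<omega>. ?G (a.path u \<omega>) \<partial>a.tilted u)"
      using a.integral_tilted(1)[OF u0 u(2) ag] q0 by (simp add: q)
    also have "(\<integral>\<omega>. ?G (a.path u \<omega>) \<partial>a.tilted u) = (\<integral>x. ?G x \<partial>a.marginal u {0..u})"
      unfolding a.marginal_def by (rule integral_distr[OF a.coordinates_measurable[OF sub] gm, symmetric])
    also have "a.marginal u {0..u} = b.marginal u {0..u}"
      by (rule path_law_unique[OF a.drift_bridge_axioms b.drift_bridge_axioms u0 u(2)])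
    also have "(\<integral>x. ?G x \<partial>b.marginal u {0..u}) = (\<integral>\<omega>. ?G (b.path u \<omega>) \<partial>b.tilted u)"
      unfolding b.marginal_def by (rule integral_distr[OF b.coordinates_measurable[OF sub] gm])
    also have "\<dots> = (\<integral>\<omega>. ?G (b.path u \<omega>) \<partial>M')"
      using b.integral_tilted(1)[OF u0 u(2) bg] by (simp add: bw)
    also have "\<dots> = H"
      unfolding H_def using b.gain_path_cong[OF N C gu t(3)] by simp
    finally show ?thesis .
  qed
  let ?hit = "\<lambda>\<omega>. \<exists>k<N. hits T N r C k (a.path t \<omega>)"
  \<comment> \<open>The payoff of the competing rule with the terminal value left open:
    \<open>y\<close> is \<open>Z (u n)\<close> as long as weights are needed, and \<open>Z T\<close>
    in the limit.\<close>
  define f where "f \<omega> y = (if ?hit \<omega> then ?G (a.path t \<omega>) + r else y)" for \<omega> y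
  define \<tau>' where "\<tau>' = a.hit_time N r C"
  define u where "u n = T - (T - t) / real (Suc n)" for n
  have u: "u \<longlonglongrightarrow> T" unfolding u_def by real_asymp
  have ub: "t \<le> u n" "u n < T" "0 \<le> u n" for n
  proof -
    have "(T - t) / real (Suc n) \<le> (T - t) / 1" using t by (intro divide_left_mono) auto
    then show "t \<le> u n" by (simp add: u_def)
    then show "0 \<le> u n" using t by simp
    show "u n < T" using t by (simp add: u_def)
  qed
  have Gi: "integrable M (\<lambda>\<omega>. ?G (a.path t \<omega>) + r)"
    using a.gain_path_integrable[OF N C t(3,2), of r] by simp
  have hitM: "{\<omega> \<in> space M. ?hit \<omega>} \<in> sets M"
  proof -
    have "{\<omega> \<in> space M. ?hit \<omega>} = (\<Union>k\<in>{..<N}. {\<omega> \<in> space M. hits T N r C k (a.path t \<omega>)})" by auto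
    also have "\<dots> \<in> sets M"
      using a.hits_event[OF N C _ t(3), of _ r] a.sets_gen_sub by (intro sets.finite_UN) auto
    finally show ?thesis .
  qed
  have lim: "(\<lambda>n. \<integral>\<omega>. f \<omega> (Z (u n) \<omega>) \<partial>M) \<longlonglongrightarrow> (\<integral>\<omega>. f \<omega> (Z T \<omega>) \<partial>M)"
    and fint: "\<And>n. integrable M (\<lambda>\<omega>. f \<omega> (Z (u n) \<omega>))"
  proof -
    have 1: "continuous_on UNIV (f \<omega>)" for \<omega>
    proof -
      have "f \<omega> = (\<lambda>_. ?G (a.path t \<omega>) + r) \<or> f \<omega> = (\<lambda>y. y)"
        by (cases "?hit \<omega>") (simp_all add: f_def fun_eq_iff)
      then show ?thesis by (elim disjE) simp_all
    qed
    have 2: "(\<lambda>\<omega>. f \<omega> (Z s \<omega>)) \<in> borel_measurable M" if "0 \<le> s" "s \<le> T" for s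
      unfolding f_def
      by (rule measurable_If[OF borel_measurable_integrable[OF Gi] a.Z_measurable'[OF that] hitM])
    have 3: "\<bar>f \<omega> y\<bar> \<le> \<bar>?G (a.path t \<omega>) + r\<bar> + \<bar>y\<bar>" for \<omega> y by (simp add: f_def)
    have 4: "0 \<le> u n \<and> u n < T" for n using ub by simp
    note m = a.mean_limit_at_end[where f = f, OF 1 2 Gi 3 u 4]
    show "(\<lambda>n. \<integral>\<omega>. f \<omega> (Z (u n) \<omega>) \<partial>M) \<longlonglongrightarrow> (\<integral>\<omega>. f \<omega> (Z T \<omega>) \<partial>M)" by (rule m(1))
    show "integrable M (\<lambda>\<omega>. f \<omega> (Z (u n) \<omega>))" for n by (rule m(2))
  qed
  \<comment> \<open>The sum of the weighted distances to the pins \<open>r\<close> and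
    \<open>- r\<close> at time \<open>u n\<close>; it tends to 0.\<close>
  define \<delta> where "\<delta> n = q * (sqrt (T - u n) + (T - u n) * \<bar>z - r\<bar> / T)
      + (1 - q) * (sqrt (T - u n) + (T - u n) * \<bar>z + r\<bar> / T)" for n
  have bound: "q * r + q * H - (1 - q) * r - \<delta> n \<le> (\<integral>\<omega>. f \<omega> (Z (u n) \<omega>) \<partial>M)" for n
  proof -
    let ?w = "\<lambda>\<omega>. a.wt (u n) \<omega>" and ?y = "\<lambda>\<omega>. Z (u n) \<omega>"
    note d1 = a.weighted_distance_to_pin[OF ub(3,2), of n]
    note d2 = c.weighted_distance_to_pin[OF ub(3,2), of n, unfolded cwt q diff_minus_eq_add]
    have w: "integrable M ?w" "(\<integral>\<omega>. ?w \<omega> \<partial>M) = q"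
      using a.wt_integrable[OF ub(3,2)] a.wt_mean[OF ub(3,2)] by (auto simp: q)
    have gu: "grid T N (N - 1) \<le> u n" using ub(1)[of n] by (simp add: t_def)
    have wg: "integrable M (\<lambda>\<omega>. ?w \<omega> * ?G (a.path (u n) \<omega>))"
    proof (rule Bochner_Integration.integrable_bound[OF a.gain_path_integrable[OF N C gu ub(2), of r]])
      show "(\<lambda>\<omega>. ?w \<omega> * ?G (a.path (u n) \<omega>)) \<in> borel_measurable M"
        by (intro borel_measurable_times borel_measurable_integrable[OF w(1)] a.gain_path_measurable[OF N C gu ub(2)])
      show "AE \<omega> in M. norm (?w \<omega> * ?G (a.path (u n) \<omega>)) \<le> norm (?G (a.path (u n) \<omega>))"
        using mult_right_mono[OF a.wt_bounds(3)] by (auto simp: abs_mult)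
    qed
    \<comment> \<open>The payoff is bounded below by \<open>r + G - |y - r|\<close> and by
      \<open>- r - |y + r|\<close>, where \<open>G\<close> is the gain; the two bounds are averaged
      with weights \<open>wt\<close> and \<open>1 - wt\<close>. After a hit both follow from
      \<open>G \<ge> 0\<close> and \<open>r > 0\<close>, otherwise \<open>G = 0\<close> and the
      payoff is \<open>y\<close>.\<close>
    have pw: "r * ?w \<omega> + ?w \<omega> * ?G (a.path (u n) \<omega>) - ?w \<omega> * \<bar>?y \<omega> - r\<bar> - r * (1 - ?w \<omega>) - (1 - ?w \<omega>) * \<bar>?y \<omega> + r\<bar>
        \<le> f \<omega> (?y \<omega>)" for \<omega>
    proof -
      have G: "?G (a.path (u n) \<omega>) = ?G (a.path t \<omega>)" by (rule a.gain_path_cong[OF N C gu t(3)])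
      have w01: "0 \<le> ?w \<omega>" "0 \<le> 1 - ?w \<omega>" using a.wt_bounds[of "u n" \<omega>] by auto
      have "r + ?G (a.path t \<omega>) - \<bar>?y \<omega> - r\<bar> \<le> f \<omega> (?y \<omega>) \<and> - r - \<bar>?y \<omega> + r\<bar> \<le> f \<omega> (?y \<omega>)"
      proof (cases "?hit \<omega>")
        case True
        have "f \<omega> (?y \<omega>) = ?G (a.path t \<omega>) + r" using True by (simp only: f_def if_True)
        with gain_nonneg[of T N r C "a.path t \<omega>"] r show ?thesis by linarith
      next
        case False
        then have "?G (a.path t \<omega>) = 0" by (intro gain_no_hit) auto
        moreover have "f \<omega> (?y \<omega>) = ?y \<omega>" using False by (simp only: f_def if_False)
        ultimately show ?thesis by linarith
      qed
      then have "?w \<omega> * (r + ?G (a.path t \<omega>) - \<bar>?y \<omega> - r\<bar>) \<le> ?w \<omega> * f \<omega> (?y \<omega>)"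
        "(1 - ?w \<omega>) * (- r - \<bar>?y \<omega> + r\<bar>) \<le> (1 - ?w \<omega>) * f \<omega> (?y \<omega>)"
        using w01 by (auto intro!: mult_left_mono)
      then show ?thesis unfolding G by (simp add: algebra_simps)
    qed
    have "(\<integral>\<omega>. r * ?w \<omega> + ?w \<omega> * ?G (a.path (u n) \<omega>) - ?w \<omega> * \<bar>?y \<omega> - r\<bar> - r * (1 - ?w \<omega>) - (1 - ?w \<omega>) * \<bar>?y \<omega> + r\<bar> \<partial>M)
        \<le> (\<integral>\<omega>. f \<omega> (?y \<omega>) \<partial>M)"
      by (rule integral_mono[OF _ fint pw])
        (intro Bochner_Integration.integrable_diff Bochner_Integration.integrable_add integrable_mult_right w wg d1 d2 a.integrable_const)
    also have "(\<integral>\<omega>. r * ?w \<omega> + ?w \<omega> * ?G (a.path (u n) \<omega>) - ?w \<omega> * \<bar>?y \<omega> - r\<bar> - r * (1 - ?w \<omega>) - (1 - ?w \<omega>) * \<bar>?y \<omega> + r\<bar> \<partial>M)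
       = r * q + q * H - (\<integral>\<omega>. ?w \<omega> * \<bar>?y \<omega> - r\<bar> \<partial>M) - r * (1 - q) - (\<integral>\<omega>. (1 - ?w \<omega>) * \<bar>?y \<omega> + r\<bar> \<partial>M)"
      using w wg d1(1) d2(1) law[OF ub(1,2), of n] by (simp add: a.prob_space)
    finally show ?thesis using d1(2) d2(2) by (simp add: q \<delta>_def algebra_simps)
  qed
  have "(\<lambda>n. q * r + q * H - (1 - q) * r - \<delta> n) \<longlonglongrightarrow> q * r + q * H - (1 - q) * r - 0"
    unfolding \<delta>_def by (rule tendsto_eq_intros u refl | use a.T_pos in simp)+
  then have "q * r + q * H - (1 - q) * r - 0 \<le> (\<integral>\<omega>. f \<omega> (Z T \<omega>) \<partial>M)"
    using bound by (intro LIMSEQ_le[OF _ lim]) auto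
  also have "(\<lambda>\<omega>. f \<omega> (Z T \<omega>)) = (\<lambda>\<omega>. Z (\<tau>' \<omega>) \<omega>)"
    unfolding \<tau>'_def f_def t_def using a.stopped_at_hit_time[OF N C, of r] by simp
  finally have "q * (r + H) - (1 - q) * r \<le> (\<integral>\<omega>. Z (\<tau>' \<omega>) \<omega> \<partial>M)" by (simp add: algebra_simps)
  moreover have "q * (\<integral>\<omega>. Z' (grid T N (I \<omega>)) \<omega> \<partial>M') \<le> q * (r + H)"
    using low q0 by (intro mult_left_mono) (auto simp: H_def)
  ultimately show thesis
    using that[of \<tau>'] a.hit_time_admissible[OF N C, of r] by (simp add: \<tau>'_def I_def grid_def)
qed

section \<open>Return to the posterior and the value functions of the statement\<close>

lemma post_prob_eq_logit_weight:
  assumes "0 < p" "p < 1"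
  shows "post_prob r p t y = logit_weight r ((1 - p) / p) (y / (1 - t))"
proof -
  define e where "e = exp (2 * r * y / (1 - t))"
  have e: "0 < e" "exp (- 2 * r * (y / (1 - t))) = 1 / e" by (simp_all add: e_def exp_minus inverse_eq_divide)
  have "p / (1 - p) * e / (p / (1 - p) * e + 1) = 1 / (1 + (1 - p) / p * (1 / e))"
  proof -
    define x where "x = p / (1 - p) * e"
    have "0 < x" using assms e by (simp add: x_def)
    moreover have "(1 - p) / p * (1 / e) = 1 / x" by (simp add: x_def)
    ultimately show ?thesis unfolding x_def[symmetric] by (simp only:) (simp add: field_simps)
  qed
  then show ?thesis unfolding post_prob_def logit_weight_def e(2) by (simp add: e_def)
qed

lemma full_bridge_of_pinned_bridge:
  assumes pb: "pinned_bridge \<mu> t z M Z" and t: "t < 1" and \<kappa>: "0 \<le> \<kappa>"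
    and mean: "\<And>s y. measure_pmf.expectation (\<mu> s y) (\<lambda>x. x) = \<rho> * (2 * logit_weight \<rho> \<kappa> (y / (1 - s)) - 1)"
  obtains F W where "full_bridge M F (1 - t) W Z \<rho> \<kappa> z"
proof -
  obtain F W where bm: "brownian_motion M F (1 - t) W"
    and Z: "\<forall>s\<in>{0..<1 - t}. Z s \<in> borel_measurable (F s)"
      "\<forall>\<omega>\<in>space M. continuous_on {0..<1 - t} (\<lambda>s. Z s \<omega>)"
      "AE \<omega> in M. \<forall>s\<in>{0..<1 - t}. Z s \<omega> = z
             + integral {0..s} (\<lambda>u. (measure_pmf.expectation (\<mu> (t + u) (Z u \<omega>)) (\<lambda>x. x) - Z u \<omega>) / (1 - (t + u))) + W s \<omega>"
      "Z (1 - t) \<in> borel_measurable M" "AE \<omega> in M. ((\<lambda>s. Z s \<omega>) \<longlongrightarrow> Z (1 - t) \<omega>) (at_left (1 - t))"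
    using pb unfolding pinned_bridge_def by blast
  have d: "1 - (t + u) = (1 - t) - u" for u by simp
  interpret prob_space M using bm by (simp add: brownian_motion_def)
  have "full_bridge M F (1 - t) W Z \<rho> \<kappa> z"
    using bm Z t \<kappa> unfolding mean d by unfold_locales auto
  then show thesis by (rule that)
qed

text \<open>The competing rule changes with the grid, but only its bound by the supremum is kept; so
  the grid can be refined without any limit of stopping rules. Dividing by the positive
  \<open>q\<close> turns the estimate into an upper bound for the other supremum.\<close>

lemma bridge_value_ge:
  assumes A: "full_bridge M F T W Z r \<kappa> z" and B: "full_bridge M' F' T W' Z' r 0 z"
    and \<kappa>: "0 < \<kappa>" and r: "0 < r"
  defines "q \<equiv> logit_weight r \<kappa> (z / T)"
  shows "q * (SUP \<tau>\<in>admissible_times M' T Z'. \<integral>\<omega>. Z' (\<tau> \<omega>) \<omega> \<partial>M') - (1 - q) * r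
       \<le> (SUP \<tau>\<in>admissible_times M T Z. \<integral>\<omega>. Z (\<tau> \<omega>) \<omega> \<partial>M)" (is "q * ?v' - _ \<le> ?v")
proof -
  interpret a: full_bridge M F T W Z r \<kappa> z by fact
  interpret b: full_bridge M' F' T W' Z' r 0 z by fact
  have q: "0 < q" unfolding q_def by (rule logit_weight_bounds[OF a.\<kappa>])
  have "(\<integral>\<omega>. Z' (\<tau> \<omega>) \<omega> \<partial>M') \<le> (?v + (1 - q) * r) / q" if \<tau>: "\<tau> \<in> admissible_times M' T Z'" for \<tau>
  proof (rule LIMSEQ_le_const2[OF b.grid_approximation(1)[OF \<tau>]], intro exI allI impI)
    fix n
    obtain \<tau>' where \<tau>': "\<tau>' \<in> admissible_times M T Z"
      "q * (\<integral>\<omega>. Z' (T * real (b.ceil_index (Suc n) (\<tau> \<omega>)) / real (Suc n)) \<omega> \<partial>M') - (1 - q) * r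
       \<le> (\<integral>\<omega>. Z (\<tau>' \<omega>) \<omega> \<partial>M)"
      using stopping_transfer[OF A B \<kappa> r \<tau> zero_less_Suc[of n]] unfolding q_def by blast
    note \<tau>'(2)
    also have "(\<integral>\<omega>. Z (\<tau>' \<omega>) \<omega> \<partial>M) \<le> ?v" by (rule cSUP_upper[OF \<tau>'(1) a.stopped_bdd_above])
    finally show "(\<integral>\<omega>. Z' (T * real (b.ceil_index (Suc n) (\<tau> \<omega>)) / real (Suc n)) \<omega> \<partial>M') \<le> (?v + (1 - q) * r) / q"
      using q by (simp add: pos_le_divide_eq mult.commute)
  qed
  then have "?v' \<le> (?v + (1 - q) * r) / q"
    using b.const_admissible[of 0] b.T_pos by (intro cSUP_least) auto
  then show ?thesis using q by (simp add: pos_le_divide_eq mult.commute)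
qed

theorem proposition4p1:
  fixes r p :: real
    and M :: "real \<Rightarrow> real \<Rightarrow> 'a measure"
    and Z :: "real \<Rightarrow> real \<Rightarrow> real \<Rightarrow> 'a \<Rightarrow> real"
    and M\<^sub>r :: "real \<Rightarrow> real \<Rightarrow> 'b measure"
    and Z\<^sub>r :: "real \<Rightarrow> real \<Rightarrow> real \<Rightarrow> 'b \<Rightarrow> real"
  assumes "0 < r" and "0 < p" and "p < 1"
    and "\<And>t z. 0 \<le> t \<Longrightarrow> t < 1 \<Longrightarrow> pinned_bridge (posterior r p) t z (M t z) (Z t z)"
    and "\<And>t z. 0 \<le> t \<Longrightarrow> t < 1 \<Longrightarrow>
           pinned_bridge (\<lambda>_ _. return_pmf r) t z (M\<^sub>r t z) (Z\<^sub>r t z)"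
  shows "(\<forall>t z. 0 \<le> t \<and> t < 1 \<longrightarrow>
            bridge_value M Z t z
              \<ge> post_prob r p t z * bridge_value M\<^sub>r Z\<^sub>r t z - (1 - post_prob r p t z) * r) \<and>
         {(t, z). 0 \<le> t \<and> t < 1 \<and>
            z < post_prob r p t z * bridge_value M\<^sub>r Z\<^sub>r t z - (1 - post_prob r p t z) * r}
           \<subseteq> continuation_region (bridge_value M Z)"
proof -
  have main: "post_prob r p t z * bridge_value M\<^sub>r Z\<^sub>r t z - (1 - post_prob r p t z) * r \<le> bridge_value M Z t z"
    if t: "0 \<le> t" "t < 1" for t z
  proof -
    let ?\<kappa> = "(1 - p) / p"
    have \<kappa>: "0 < ?\<kappa>" using assms(2,3) by simp
    obtain F W where A: "full_bridge (M t z) F (1 - t) W (Z t z) r ?\<kappa> z"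
    proof (rule full_bridge_of_pinned_bridge[OF assms(4)[OF t] t(2) less_imp_le[OF \<kappa>]])
      show "measure_pmf.expectation (posterior r p s y) (\<lambda>x. x) = r * (2 * logit_weight r ?\<kappa> (y / (1 - s)) - 1)" for s y
        unfolding posterior_mean[OF assms(2,3)] post_prob_eq_logit_weight[OF assms(2,3)] ..
    qed
    \<comment> \<open>Zero odds against the pin \<open>r\<close>: the weight is constantly 1 and the
      posterior mean is \<open>r\<close>.\<close>
    obtain F' W' where B: "full_bridge (M\<^sub>r t z) F' (1 - t) W' (Z\<^sub>r t z) r 0 z"
      by (rule full_bridge_of_pinned_bridge[OF assms(5)[OF t] t(2) order_refl]) (simp_all add: logit_weight_def)
    show ?thesis
      unfolding bridge_value_def post_prob_eq_logit_weight[OF assms(2,3)]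
      by (rule bridge_value_ge[OF A B \<kappa> assms(1)])
  qed
  then show ?thesis
    by (auto simp: continuation_region_def intro: less_le_trans)
qed

end
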